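(* Let $({\cal M},g)$ be an anti-self-dual null-Kähler manifold with symmetry, with Killing vector $K$. Then the Einstein–Weyl structure $$h=|K|^{-2}g-|K|^{-4}\,{\bf K}\odot{\bf K},\qquad \nu=2|K|^{-2}\ast_g({\bf K}\wedge d{\bf K})$$ induced on the space of orbits of this symmetry is locally of the form $$h=dy^2-4\,dx\,dt-4u\,dt^2,\qquad \nu=-4u_x\,dt,\qquad u=u(x,y,t).$$
   Context: A null-Kähler structure on a four-manifold consists of a metric $g$ of signature $(++--)$ and a (non-zero) real spinor field $\iota^{A'}$ parallel with respect to the Levi-Civita connection. Here $S^A$, $S^{A'}$ are the two real rank-two spin bundles, with $T{\cal M}\cong S^A\otimes S^{A'}$, and the parallel spinor is a section of $S^{A'}$, the bundle such that self-dual two-forms are sections of ${\rm Sym}^2(S^{A'})$. The structure is anti-self-dual (ASD) if the self-dual Weyl spinor $C_{A'B'C'D'}$ vanishes. An ASD null-Kähler manifold with symmetry is one admitting a Killing vector $K$ which preserves the parallel spinor, ${\cal L}_K\iota^{A'}=0$, where ${\cal L}_K\iota^{A'}=K^b\nabla_b\iota^{A'}-\psi^{A'}{}_{B'}\iota^{B'}$ and $\nabla_aK_b=\phi_{AB}\varepsilon_{A'B'}+\psi_{A'B'}\varepsilon_{AB}$ with $\phi_{AB},\psi_{A'B'}$ symmetric. A Weyl space is a three-manifold with a conformal class $[h]$ and a torsion-free connection $D$ such that $Dh=\nu\otimes h$ for a one-form $\nu$; the pair $(h,\nu)$ is defined up to $h\to\phi^2h$, $\nu\to\nu+2\,d\ln\phi$.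 It is Einstein–Weyl if the symmetrised Ricci tensor of $D$ satisfies $W_{(ij)}=\frac13\Lambda h_{ij}$, where $\Lambda$ is the scalar curvature of $D$. For an ASD $(++--)$ four-manifold with a conformal Killing vector $K$, the formulas $h=|K|^{-2}g-|K|^{-4}\,{\bf K}\odot{\bf K}$, $\nu=2|K|^{-2}\ast_g({\bf K}\wedge d{\bf K})$ define an Einstein–Weyl structure of indefinite signature on the three-dimensional space of trajectories of $K$ (Jones–Tod correspondence), where $|K|^2=g_{ab}K^aK^b$, ${\bf K}$ is the one-form dual to $K$, $\ast_g$ is the Hodge star of $g$, and the formulas are understood where $|K|^2\neq0$. "Of the form" means for some local coordinates $(x,y,t)$ and some representative of the Einstein–Weyl structure under the rescalings $h\to\phi^2h$, $\nu\to\nu+2\,d\ln\phi$.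
   Formalization: The induced h has signature (+--) while dy^2-4dxdt-4u dt^2 has signature (++-), so no rescaling φ^2 h can equal it; the formal statement shows that -φ^2 h, with ν+2 d ln φ, has the stated form. *)

theory Defs
  imports "HOL-Analysis.Analysis"
begin

section \<open>Calculus in coordinates\<close>

primrec Ck_on :: "nat \<Rightarrow> ('a::real_normed_vector \<Rightarrow> 'b::real_normed_vector) \<Rightarrow> 'a set \<Rightarrow> bool" where
  "Ck_on 0 f S = continuous_on S f"
| "Ck_on (Suc k) f S =
     (f differentiable_on S \<and> (\<forall>v. Ck_on k (\<lambda>x. frechet_derivative f (at x) v) S))"

text \<open>Only meant for open \<open>S\<close>.\<close>

definition smooth_on :: "('a::real_normed_vector \<Rightarrow> 'b::real_normed_vector) \<Rightarrow> 'a set \<Rightarrow> bool" where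
  "smooth_on f S \<longleftrightarrow> (\<forall>k. Ck_on k f S)"

definition pd :: "(real^'n \<Rightarrow> 'b::real_normed_vector) \<Rightarrow> real^'n \<Rightarrow> 'n \<Rightarrow> 'b" where
  "pd f x a = frechet_derivative f (at x) (axis a 1)"


section \<open>Smooth four-manifolds and tensor fields\<close>

text \<open>
  The manifold is the whole type \<open>'m\<close>. A chart is a pair (domain, coordinate map), and a field
  assigns to each chart of the atlas its components as functions of the coordinates of that chart.
\<close>

type_synonym 'm chart = "'m set \<times> ('m \<Rightarrow> real^4)"
type_synonym ('m, 'v) field = "'m chart \<Rightarrow> real^4 \<Rightarrow> 'v"

definition image_of :: "'m chart \<Rightarrow> (real^4) set" where
  "image_of c = snd c ` fst c"

definition overlap :: "'m chart \<Rightarrow> 'm chart \<Rightarrow> (real^4) set" where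
  "overlap c c' = snd c ` (fst c \<inter> fst c')"

definition transition :: "'m chart \<Rightarrow> 'm chart \<Rightarrow> real^4 \<Rightarrow> real^4" where
  "transition c c' x = snd c' (inv_into (fst c) (snd c) x)"

definition smooth_atlas :: "('m::topological_space) chart set \<Rightarrow> bool" where
  "smooth_atlas A \<longleftrightarrow>
     (\<Union>c\<in>A. fst c) = UNIV \<and>
     (\<forall>c\<in>A. open (fst c) \<and> open (image_of c) \<and>
        homeomorphism (fst c) (image_of c) (snd c) (inv_into (fst c) (snd c))) \<and>
     (\<forall>c\<in>A. \<forall>c'\<in>A. smooth_on (transition c c') (overlap c c'))"

definition vector_field :: "('m::topological_space) chart set \<Rightarrow> ('m, real^4) field \<Rightarrow> bool" where
  "vector_field A K \<longleftrightarrow>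
     (\<forall>c\<in>A. smooth_on (K c) (image_of c)) \<and>
     (\<forall>c\<in>A. \<forall>c'\<in>A. \<forall>x\<in>overlap c c'.
        K c' (transition c c' x) = frechet_derivative (transition c c') (at x) (K c x))"

definition neutral_form :: "real^4^4 \<Rightarrow> bool" where
  "neutral_form G \<longleftrightarrow> transpose G = G \<and>
     (\<exists>P :: real^4^4. invertible P \<and> transpose P ** G ** P =
        (\<chi> i j. if i \<noteq> j then 0 else if i = 1 \<or> i = 2 then 1 else -1))"

definition neutral_metric :: "('m::topological_space) chart set \<Rightarrow> ('m, real^4^4) field \<Rightarrow> bool" where
  "neutral_metric A g \<longleftrightarrow>
     (\<forall>c\<in>A. smooth_on (g c) (image_of c) \<and> (\<forall>x\<in>image_of c. neutral_form (g c x))) \<and>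
     (\<forall>c\<in>A. \<forall>c'\<in>A. \<forall>x\<in>overlap c c'. \<forall>a b.
        g c x $ a $ b = (\<Sum>i\<in>UNIV. \<Sum>j\<in>UNIV.
          pd (transition c c') x a $ i * pd (transition c c') x b $ j
            * g c' (transition c c' x) $ i $ j))"


section \<open>Levi-Civita connection and curvature in a chart\<close>

type_synonym metric = "real^4 \<Rightarrow> real^4^4"

definition ginv :: "metric \<Rightarrow> real^4 \<Rightarrow> real^4^4" where
  "ginv g x = matrix_inv (g x)"

text \<open>\<open>christoffel g x a b c\<close> is $\Gamma^a{}_{bc}$, and \<open>riemann_up g x a b c d\<close> is
  $R^a{}_{bcd}=\partial_c\Gamma^a{}_{bd}-\partial_d\Gamma^a{}_{bc}+\dots$.\<close>

definition christoffel :: "metric \<Rightarrow> real^4 \<Rightarrow> 4 \<Rightarrow> 4 \<Rightarrow> 4 \<Rightarrow> real" where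
  "christoffel g x a b c = (1/2) * (\<Sum>d\<in>UNIV. ginv g x $ a $ d *
     (pd g x b $ d $ c + pd g x c $ d $ b - pd g x d $ b $ c))"

definition riemann_up :: "metric \<Rightarrow> real^4 \<Rightarrow> 4 \<Rightarrow> 4 \<Rightarrow> 4 \<Rightarrow> 4 \<Rightarrow> real" where
  "riemann_up g x a b c d =
     pd (\<lambda>z. christoffel g z a b d) x c - pd (\<lambda>z. christoffel g z a b c) x d
     + (\<Sum>e\<in>UNIV. christoffel g x a c e * christoffel g x e b d
                - christoffel g x a d e * christoffel g x e b c)"

definition riemann :: "metric \<Rightarrow> real^4 \<Rightarrow> 4 \<Rightarrow> 4 \<Rightarrow> 4 \<Rightarrow> 4 \<Rightarrow> real" where
  "riemann g x a b c d = (\<Sum>e\<in>UNIV. g x $ a $ e * riemann_up g x e b c d)"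

definition ricci :: "metric \<Rightarrow> real^4 \<Rightarrow> 4 \<Rightarrow> 4 \<Rightarrow> real" where
  "ricci g x b d = (\<Sum>a\<in>UNIV. riemann_up g x a b a d)"

definition scalar_curv :: "metric \<Rightarrow> real^4 \<Rightarrow> real" where
  "scalar_curv g x = (\<Sum>a\<in>UNIV. \<Sum>b\<in>UNIV. ginv g x $ a $ b * ricci g x a b)"

definition weyl :: "metric \<Rightarrow> real^4 \<Rightarrow> 4 \<Rightarrow> 4 \<Rightarrow> 4 \<Rightarrow> 4 \<Rightarrow> real" where
  "weyl g x a b c d = riemann g x a b c d
     - (1/2) * (g x $ a $ c * ricci g x b d - g x $ a $ d * ricci g x b c
              - g x $ b $ c * ricci g x a d + g x $ b $ d * ricci g x a c)
     + (scalar_curv g x / 6) * (g x $ a $ c * g x $ b $ d - g x $ a $ d * g x $ b $ c)"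

definition lower :: "metric \<Rightarrow> (real^4 \<Rightarrow> real^4) \<Rightarrow> real^4 \<Rightarrow> real^4" where
  "lower g K x = g x *v K x"

definition nabla_lower :: "metric \<Rightarrow> (real^4 \<Rightarrow> real^4) \<Rightarrow> real^4 \<Rightarrow> 4 \<Rightarrow> 4 \<Rightarrow> real" where
  "nabla_lower g K x a b =
     pd (lower g K) x a $ b - (\<Sum>c\<in>UNIV. christoffel g x c a b * lower g K x $ c)"


section \<open>Real two-component spinors\<close>

text \<open>
  Conventions: \<open>eps\<close> is both $\varepsilon_{AB}$ and $\varepsilon^{AB}$ (and the same for primed
  indices), with $\varepsilon_{12}=\varepsilon^{12}=1$; indices are moved by
  $\psi^A=\varepsilon^{AB}\psi_B$, $\psi_A=\psi^B\varepsilon_{BA}$.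

  A soldering form \<open>\<sigma>\<close> expresses $T{\cal M}\cong S^A\otimes S^{A'}$ in a coordinate frame and a pair
  of spin frames: \<open>\<sigma> x $ a $ A $ A'\<close> is $\sigma_a{}^{AA'}$.
\<close>

type_synonym solder = "real^4 \<Rightarrow> real^2^2^4"

definition eps :: "real^2^2" where
  "eps = (\<chi> i j. if i = 1 \<and> j = 2 then 1 else if i = 2 \<and> j = 1 then -1 else 0)"

text \<open>$g_{ab}=\varepsilon_{AB}\,\varepsilon_{A'B'}\,\sigma_a{}^{AA'}\sigma_b{}^{BB'}$; as \<open>g\<close> is
  nondegenerate, this makes \<open>\<sigma>\<close> an isomorphism.\<close>

definition solders :: "metric \<Rightarrow> solder \<Rightarrow> (real^4) set \<Rightarrow> bool" where
  "solders g \<sigma> U \<longleftrightarrow> (\<forall>x\<in>U. \<forall>a b. g x $ a $ b =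
     (\<Sum>A\<in>UNIV. \<Sum>B\<in>UNIV. \<Sum>A'\<in>UNIV. \<Sum>B'\<in>UNIV.
        eps $ A $ B * eps $ A' $ B' * \<sigma> x $ a $ A $ A' * \<sigma> x $ b $ B $ B'))"

text \<open>The inverse $\sigma^a{}_{AA'}$ of the soldering form.\<close>

definition tetrad :: "metric \<Rightarrow> solder \<Rightarrow> real^4 \<Rightarrow> 4 \<Rightarrow> 2 \<Rightarrow> 2 \<Rightarrow> real" where
  "tetrad g \<sigma> x a A A' = (\<Sum>b\<in>UNIV. \<Sum>B\<in>UNIV. \<Sum>B'\<in>UNIV.
     ginv g x $ a $ b * \<sigma> x $ b $ B $ B' * eps $ B $ A * eps $ B' $ A')"

text \<open>
  The primed Weyl spinor, from
  $C_{abcd}=C_{ABCD}\varepsilon_{A'B'}\varepsilon_{C'D'}+C_{A'B'C'D'}\varepsilon_{AB}\varepsilon_{CD}$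
  by contraction with $\frac14\varepsilon^{AB}\varepsilon^{CD}$.
\<close>

definition weyl_spinor' :: "metric \<Rightarrow> solder \<Rightarrow> real^4 \<Rightarrow> 2 \<Rightarrow> 2 \<Rightarrow> 2 \<Rightarrow> 2 \<Rightarrow> real" where
  "weyl_spinor' g \<sigma> x A' B' C' D' = (1/4) *
     (\<Sum>A\<in>UNIV. \<Sum>B\<in>UNIV. \<Sum>C\<in>UNIV. \<Sum>D\<in>UNIV. eps $ A $ B * eps $ C $ D *
       (\<Sum>a\<in>UNIV. \<Sum>b\<in>UNIV. \<Sum>c\<in>UNIV. \<Sum>d\<in>UNIV. weyl g x a b c d *
          tetrad g \<sigma> x a A A' * tetrad g \<sigma> x b B B' *
          tetrad g \<sigma> x c C C' * tetrad g \<sigma> x d D D'))"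

text \<open>
  The spin connection: \<open>\<omega> x a $ A $ B\<close> is $\omega_a{}^A{}_B$ on $S^A$, and \<open>\<omega>'\<close> is the
  same on $S^{A'}$. Trace-freeness says that $\varepsilon_{AB}$ and $\varepsilon_{A'B'}$ are parallel;
  together with $\nabla_a\sigma_b{}^{AA'}=0$ for the Levi-Civita connection it determines
  \<open>\<omega>\<close> and \<open>\<omega>'\<close> uniquely.
\<close>

definition spin_connection ::
  "metric \<Rightarrow> solder \<Rightarrow> (real^4 \<Rightarrow> 4 \<Rightarrow> real^2^2) \<Rightarrow> (real^4 \<Rightarrow> 4 \<Rightarrow> real^2^2) \<Rightarrow> (real^4) set \<Rightarrow> bool" where
  "spin_connection g \<sigma> \<omega> \<omega>' U \<longleftrightarrow> (\<forall>x\<in>U. \<forall>a.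
     trace (\<omega> x a) = 0 \<and> trace (\<omega>' x a) = 0 \<and>
     (\<forall>b A A'. pd \<sigma> x a $ b $ A $ A'
        - (\<Sum>c\<in>UNIV. christoffel g x c a b * \<sigma> x $ c $ A $ A')
        + (\<Sum>B\<in>UNIV. \<omega> x a $ A $ B * \<sigma> x $ b $ B $ A')
        + (\<Sum>B'\<in>UNIV. \<omega>' x a $ A' $ B' * \<sigma> x $ b $ A $ B') = 0))"

definition nabla_spinor' ::
  "(real^4 \<Rightarrow> 4 \<Rightarrow> real^2^2) \<Rightarrow> (real^4 \<Rightarrow> real^2) \<Rightarrow> real^4 \<Rightarrow> 4 \<Rightarrow> real^2" where
  "nabla_spinor' \<omega>' \<iota> x a = pd \<iota> x a + \<omega>' x a *v \<iota> x"

text \<open>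
  The two spin bundles on the manifold: every chart domain carries a frame of each of them, and
  \<open>S c c'\<close>, \<open>S' c c'\<close> are the \<open>SL(2,\<real>)\<close>-valued transition functions of $S^A$, $S^{A'}$ from
  the frames over \<open>c\<close> to those over \<open>c'\<close>, written in the coordinates of \<open>c\<close>.
\<close>

definition SL2_cocycle ::
  "('m::topological_space) chart set \<Rightarrow> ('m chart \<Rightarrow> ('m, real^2^2) field) \<Rightarrow> bool" where
  "SL2_cocycle A S \<longleftrightarrow>
     (\<forall>c\<in>A. \<forall>c'\<in>A. smooth_on (S c c') (overlap c c') \<and>
        (\<forall>x\<in>overlap c c'. det (S c c' x) = 1)) \<and>
     (\<forall>c\<in>A. \<forall>c'\<in>A. \<forall>c''\<in>A. \<forall>x\<in>overlap c c' \<inter> overlap c c''.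
        S c' c'' (transition c c' x) ** S c c' x = S c c'' x)"

definition spin_bundles ::
  "('m::topological_space) chart set \<Rightarrow> ('m, real^4^4) field \<Rightarrow> ('m, real^2^2^4) field \<Rightarrow>
   ('m chart \<Rightarrow> ('m, real^2^2) field) \<Rightarrow> ('m chart \<Rightarrow> ('m, real^2^2) field) \<Rightarrow> bool" where
  "spin_bundles A g \<sigma> S S' \<longleftrightarrow>
     SL2_cocycle A S \<and> SL2_cocycle A S' \<and>
     (\<forall>c\<in>A. smooth_on (\<sigma> c) (image_of c) \<and> solders (g c) (\<sigma> c) (image_of c)) \<and>
     (\<forall>c\<in>A. \<forall>c'\<in>A. \<forall>x\<in>overlap c c'. \<forall>a.
        (\<Sum>b\<in>UNIV. pd (transition c c') x a $ b *\<^sub>R \<sigma> c' (transition c c' x) $ b)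
          = S c c' x ** \<sigma> c x $ a ** transpose (S' c c' x))"

definition spinor_field' ::
  "('m::topological_space) chart set \<Rightarrow> ('m chart \<Rightarrow> ('m, real^2^2) field) \<Rightarrow>
   ('m, real^2) field \<Rightarrow> bool" where
  "spinor_field' A S' \<iota> \<longleftrightarrow>
     (\<forall>c\<in>A. smooth_on (\<iota> c) (image_of c)) \<and>
     (\<forall>c\<in>A. \<forall>c'\<in>A. \<forall>x\<in>overlap c c'. \<iota> c' (transition c c' x) = S' c c' x *v \<iota> c x)"


section \<open>Anti-self-dual null-Kaehler manifolds with symmetry\<close>

text \<open>A parallel spinor that is non-zero on a connected manifold vanishes nowhere; \<open>'m\<close> is not
  assumed connected, so nowhere vanishing is required directly.\<close>

definition null_kahler ::
  "('m::topological_space) chart set \<Rightarrow> ('m, real^4^4) field \<Rightarrow> ('m, real^2^2^4) field \<Rightarrow>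
   ('m chart \<Rightarrow> ('m, real^2^2) field) \<Rightarrow> ('m chart \<Rightarrow> ('m, real^2^2) field) \<Rightarrow>
   ('m, 4 \<Rightarrow> real^2^2) field \<Rightarrow> ('m, 4 \<Rightarrow> real^2^2) field \<Rightarrow> ('m, real^2) field \<Rightarrow> bool" where
  "null_kahler A g \<sigma> S S' \<omega> \<omega>' \<iota> \<longleftrightarrow>
     smooth_atlas A \<and> neutral_metric A g \<and> spin_bundles A g \<sigma> S S' \<and>
     (\<forall>c\<in>A. spin_connection (g c) (\<sigma> c) (\<omega> c) (\<omega>' c) (image_of c)) \<and>
     spinor_field' A S' \<iota> \<and>
     (\<forall>c\<in>A. \<forall>x\<in>image_of c. \<iota> c x \<noteq> 0 \<and> (\<forall>a. nabla_spinor' (\<omega>' c) (\<iota> c) x a = 0))"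

definition anti_self_dual ::
  "('m::topological_space) chart set \<Rightarrow> ('m, real^4^4) field \<Rightarrow> ('m, real^2^2^4) field \<Rightarrow> bool" where
  "anti_self_dual A g \<sigma> \<longleftrightarrow> (\<forall>c\<in>A. \<forall>x\<in>image_of c. \<forall>A' B' C' D'.
     weyl_spinor' (g c) (\<sigma> c) x A' B' C' D' = 0)"

definition killing ::
  "('m::topological_space) chart set \<Rightarrow> ('m, real^4^4) field \<Rightarrow> ('m, real^4) field \<Rightarrow> bool" where
  "killing A g K \<longleftrightarrow> vector_field A K \<and>
     (\<forall>c\<in>A. \<forall>x\<in>image_of c. \<forall>a b.
        nabla_lower (g c) (K c) x a b + nabla_lower (g c) (K c) x b a = 0)"

text \<open>
  ${\cal L}_K\iota^{A'}=K^b\nabla_b\iota^{A'}-\psi^{A'}{}_{B'}\iota^{B'}=0$, where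
  $\nabla_aK_b=\phi_{AB}\varepsilon_{A'B'}+\psi_{A'B'}\varepsilon_{AB}$. For a Killing vector the
  symmetric \<open>\<phi>\<close> and \<open>\<psi>\<close> exist and are unique, and \<open>eps ** \<psi>\<close> is $\psi^{A'}{}_{B'}$.
\<close>

definition preserves_spinor' ::
  "('m::topological_space) chart set \<Rightarrow> ('m, real^4^4) field \<Rightarrow> ('m, real^2^2^4) field \<Rightarrow>
   ('m, 4 \<Rightarrow> real^2^2) field \<Rightarrow> ('m, real^2) field \<Rightarrow> ('m, real^4) field \<Rightarrow> bool" where
  "preserves_spinor' A g \<sigma> \<omega>' \<iota> K \<longleftrightarrow> (\<forall>c\<in>A. \<forall>x\<in>image_of c. \<exists>\<phi> \<psi>.
     transpose \<phi> = \<phi> \<and> transpose \<psi> = \<psi> \<and>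
     (\<forall>a b. nabla_lower (g c) (K c) x a b =
        (\<Sum>A\<in>UNIV. \<Sum>B\<in>UNIV. \<Sum>A'\<in>UNIV. \<Sum>B'\<in>UNIV.
           (\<phi> $ A $ B * eps $ A' $ B' + \<psi> $ A' $ B' * eps $ A $ B)
             * \<sigma> c x $ a $ A $ A' * \<sigma> c x $ b $ B $ B')) \<and>
     (\<Sum>b\<in>UNIV. K c x $ b *\<^sub>R nabla_spinor' (\<omega>' c) (\<iota> c) x b) - (eps ** \<psi>) *v \<iota> c x = 0)"


section \<open>The structure induced on the space of orbits\<close>

definition norm2 :: "metric \<Rightarrow> (real^4 \<Rightarrow> real^4) \<Rightarrow> real^4 \<Rightarrow> real" where
  "norm2 g K x = (\<Sum>a\<in>UNIV. \<Sum>b\<in>UNIV. g x $ a $ b * K x $ a * K x $ b)"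

text \<open>
  The metric volume form
  $\epsilon_{abcd}=\varepsilon_{AC}\varepsilon_{BD}\varepsilon_{A'D'}\varepsilon_{B'C'}
    -\varepsilon_{AD}\varepsilon_{BC}\varepsilon_{A'C'}\varepsilon_{B'D'}$,
  of the orientation for which the forms $\psi_{A'B'}\varepsilon_{AB}$ are self-dual.
\<close>

definition vol :: "solder \<Rightarrow> real^4 \<Rightarrow> 4 \<Rightarrow> 4 \<Rightarrow> 4 \<Rightarrow> 4 \<Rightarrow> real" where
  "vol \<sigma> x a b c d =
     (\<Sum>A\<in>UNIV. \<Sum>B\<in>UNIV. \<Sum>C\<in>UNIV. \<Sum>D\<in>UNIV. \<Sum>A'\<in>UNIV. \<Sum>B'\<in>UNIV. \<Sum>C'\<in>UNIV. \<Sum>D'\<in>UNIV.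
        (eps $ A $ C * eps $ B $ D * eps $ A' $ D' * eps $ B' $ C'
         - eps $ A $ D * eps $ B $ C * eps $ A' $ C' * eps $ B' $ D')
        * \<sigma> x $ a $ A $ A' * \<sigma> x $ b $ B $ B' * \<sigma> x $ c $ C $ C' * \<sigma> x $ d $ D $ D')"

text \<open>
  Hodge star of a three-form, $(\ast\alpha)_d=\frac16\epsilon_{dabc}\alpha^{abc}$. In dimension four
  $\epsilon_{dabc}=-\epsilon_{abcd}$; this is the sign for which the orbit-space formulas give
  $Dh=\nu\otimes h$ with \<open>D\<close> Einstein-Weyl, rather than the same with $-\nu$.
\<close>

definition star3 ::
  "metric \<Rightarrow> solder \<Rightarrow> real^4 \<Rightarrow> (4 \<Rightarrow> 4 \<Rightarrow> 4 \<Rightarrow> real) \<Rightarrow> 4 \<Rightarrow> real" where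
  "star3 g \<sigma> x \<alpha> d = (1/6) *
     (\<Sum>a\<in>UNIV. \<Sum>b\<in>UNIV. \<Sum>c\<in>UNIV. \<Sum>i\<in>UNIV. \<Sum>j\<in>UNIV. \<Sum>k\<in>UNIV.
        vol \<sigma> x d a b c * ginv g x $ a $ i * ginv g x $ b $ j * ginv g x $ c $ k * \<alpha> i j k)"

definition ext_d :: "(real^4 \<Rightarrow> real^4) \<Rightarrow> real^4 \<Rightarrow> 4 \<Rightarrow> 4 \<Rightarrow> real" where
  "ext_d \<theta> x a b = pd \<theta> x a $ b - pd \<theta> x b $ a"

definition wedge12 :: "(4 \<Rightarrow> real) \<Rightarrow> (4 \<Rightarrow> 4 \<Rightarrow> real) \<Rightarrow> 4 \<Rightarrow> 4 \<Rightarrow> 4 \<Rightarrow> real" where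
  "wedge12 \<theta> \<beta> a b c = \<theta> a * \<beta> b c + \<theta> b * \<beta> c a + \<theta> c * \<beta> a b"

text \<open>$h$ and $\nu$ as the (basic) tensors on the four-manifold, i.e. pulled back from the space of
  orbits.\<close>

definition orbit_h :: "metric \<Rightarrow> (real^4 \<Rightarrow> real^4) \<Rightarrow> real^4 \<Rightarrow> 4 \<Rightarrow> 4 \<Rightarrow> real" where
  "orbit_h g K x a b =
     g x $ a $ b / norm2 g K x - lower g K x $ a * lower g K x $ b / (norm2 g K x)\<^sup>2"

definition orbit_nu :: "metric \<Rightarrow> solder \<Rightarrow> (real^4 \<Rightarrow> real^4) \<Rightarrow> real^4 \<Rightarrow> 4 \<Rightarrow> real" where
  "orbit_nu g \<sigma> K x d = 2 / norm2 g K x *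
     star3 g \<sigma> x (wedge12 (($) (lower g K x)) (ext_d (lower g K) x)) d"

text \<open>
  \<open>\<pi> = (x,y,t)\<close> is a coordinate system on the space of orbits of \<open>K\<close> in \<open>N\<close>: a submersion constant
  along \<open>K\<close> with connected fibres, so that the fibres are exactly the trajectories in \<open>N\<close>.
\<close>

definition orbit_coordinates ::
  "(real^4) set \<Rightarrow> (real^4 \<Rightarrow> real^4) \<Rightarrow> (real^4 \<Rightarrow> real^3) \<Rightarrow> bool" where
  "orbit_coordinates N K \<pi> \<longleftrightarrow>
     open N \<and> smooth_on \<pi> N \<and> open (\<pi> ` N) \<and>
     (\<forall>q\<in>N. surj (frechet_derivative \<pi> (at q)) \<and> frechet_derivative \<pi> (at q) (K q) = 0) \<and>
     (\<forall>z. connected {q\<in>N. \<pi> q = z})"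

text \<open>$dy^2-4\,dx\,dt-4u\,dt^2$ and $-4u_x\,dt$, with $(x,y,t)$ the components 1, 2, 3.\<close>

definition dkp_h :: "(real^3 \<Rightarrow> real) \<Rightarrow> real^3 \<Rightarrow> real^3 \<Rightarrow> real^3 \<Rightarrow> real" where
  "dkp_h u z v w = v$2 * w$2 - 2 * (v$1 * w$3 + v$3 * w$1) - 4 * u z * v$3 * w$3"

definition dkp_nu :: "(real^3 \<Rightarrow> real) \<Rightarrow> real^3 \<Rightarrow> real^3 \<Rightarrow> real" where
  "dkp_nu u z v = -4 * pd u z 1 * v$3"

text \<open>
  \<open>(h, \<nu>)\<close> on \<open>N\<close> descends to the space of orbits, where in the coordinates \<open>\<pi>\<close> a rescaling
  $(\phi^2h,\nu+2\,d\ln\phi)$ is the normal form with function \<open>u\<close>.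

  The overall minus sign is forced by signature. If $g$ has signature $(++--)$ then, whatever the sign
  of $|K|^2$, $|K|^{-2}g-|K|^{-4}{\bf K}\odot{\bf K}$ has signature $(+--)$ on the space of orbits,
  while $dy^2-4\,dx\,dt-4u\,dt^2$ has signature $(++-)$. Replacing $h$ by $-h$ affects neither \<open>D\<close>
  nor $\nu$ in $Dh=\nu\otimes h$.
\<close>

definition has_dkp_form ::
  "(real^4) set \<Rightarrow> (real^4 \<Rightarrow> 4 \<Rightarrow> 4 \<Rightarrow> real) \<Rightarrow> (real^4 \<Rightarrow> 4 \<Rightarrow> real) \<Rightarrow>
   (real^4 \<Rightarrow> real^3) \<Rightarrow> (real^3 \<Rightarrow> real) \<Rightarrow> (real^3 \<Rightarrow> real) \<Rightarrow> bool" where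
  "has_dkp_form N h \<nu> \<pi> \<phi> u \<longleftrightarrow>
     smooth_on \<phi> (\<pi> ` N) \<and> smooth_on u (\<pi> ` N) \<and> (\<forall>z\<in>\<pi> ` N. \<phi> z > 0) \<and>
     (\<forall>q\<in>N. \<forall>a b. - (\<phi> (\<pi> q))\<^sup>2 * h q a b = dkp_h u (\<pi> q) (pd \<pi> q a) (pd \<pi> q b)) \<and>
     (\<forall>q\<in>N. \<forall>a. \<nu> q a + 2 * frechet_derivative (\<lambda>z. ln (\<phi> z)) (at (\<pi> q)) (pd \<pi> q a)
        = dkp_nu u (\<pi> q) (pd \<pi> q a))"

end

theory Submission
  imports Defs
begin

text \<open>
  Write $[a,b]=\varepsilon_{AB}a^Ab^B$ and $n=|K|^2$. With $o$ normalised by $[o,\iota]=1$, the Killing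
  vector is $K=\kappa\otimes o+\frac n2\,\tau\otimes\iota$ with $[\kappa,\tau]=1$. Let
  $\theta$, $E_2$, $E_3$, $E_4$ be the one-forms $g(\kappa\iota,\cdot)$, $g(\tau o,\cdot)$, $g(\kappa o,\cdot)$, $g(\tau\iota,\cdot)$, and put
  $\beta=E_3-\frac n2E_4$, $\xi=nE_2$. These three one-forms annihilate $K$ and
  $-n^2h=\beta^2+2\theta\xi$. Since $\iota$ is parallel and preserved by $K$, only the component
  $\psi=c\,\iota\iota$ of $\psi$ survives, and differentiating the frame gives
  $d\theta=0$, $d\beta=\theta\wedge\gamma$, $d\xi=\gamma\wedge\beta+e\,\theta\wedge\xi$ with $e=2c/n$, as well as
  $\nu+2\,d\ln|n|=4e\,\theta$. Hence $\theta=dt$; on the leaves of $t$ the form $\beta$ is closed, so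
  $dy=\beta+s\,dt$; then $\rho=\xi-s\beta-\frac12s^2\theta$ is closed on the leaves as well, so
  $\rho=-2\,dx-2u\,dt$, and this is the normal form with $\phi=|n|$ and $u_x=-e$.
\<close>

section \<open>Smooth functions\<close>

text \<open>The form \<theta> is, up to sign, \<open>K\<close> contracted with the null-Kaehler
  two-form built from \<iota> \<iota>. That two-form is parallel and preserved by \<open>K\<close>,
  so by Cartan's formula \<theta> is closed and t is a Hamiltonian of \<open>K\<close>. The factor
  |n| answers a lack of information: the two halves of dK enter \<nu> with opposite signs and d ln
  |n| with equal signs, so the combination eliminates \<phi>, about which nothing is known, and
  keeps only c.

  The obstacle is that o is fixed only up to adding multiples of \<iota>, and the chosen o need not
  be invariant along \<open>K\<close>. Hence \<beta>, \<xi>, \<gamma> and s need not descend to the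
  orbits. Changing o acts on the coframe by null rotations \<beta> -> \<beta> + s \<theta>, \<xi> ->
  \<xi> - s \<beta> - s^2 \<theta> / 2, which preserve \<theta> and \<beta>^2 + 2 \<theta> \<xi>;
  this is where \<rho> comes from. Everything is therefore integrated upstairs, and only |n|, x, y,
  t and u are pushed down, because their differentials are combinations of \<theta>, \<beta>,
  \<xi>.\<close>

abbreviation dird :: "('a::real_normed_vector \<Rightarrow> 'b::real_normed_vector) \<Rightarrow> 'a \<Rightarrow> 'a \<Rightarrow> 'b" where
  "dird f v x \<equiv> frechet_derivative f (at x) v"

lemma dird_eq: "(f has_derivative f') (at x) \<Longrightarrow> dird f v x = f' v"
  by (simp add: frechet_derivative_at[symmetric])

text \<open>On an open set the values determine the derivative at each point, so
  \<open>frechet_derivative\<close>, which is taken in the whole space, respects equality on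
  \<open>S\<close>.\<close>

lemma Ck_on_cong:
  assumes "open S" "\<And>x. x \<in> S \<Longrightarrow> f x = g x" "Ck_on k f S"
  shows "Ck_on k g S"
  using assms(2,3)
proof (induction k arbitrary: f g)
  case 0
  then show ?case using continuous_on_cong by force
next
  case (Suc k)
  have fd: "f differentiable (at x)" if "x \<in> S" for x
    using Suc.prems(2) that assms(1) by (simp add: differentiable_on_eq_differentiable_at)
  have gd: "(g has_derivative frechet_derivative f (at x)) (at x)" if "x \<in> S" for x
    by (rule has_derivative_transform_within_open[OF fd[OF that, unfolded frechet_derivative_works] assms(1) that])
       (rule Suc.prems(1))
  have "g differentiable_on S"
    using gd unfolding differentiable_on_def
    by (meson differentiable_at_withinI differentiable_def)
  moreover have "Ck_on k (dird g v) S" for v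
  proof (rule Suc.IH)
    show "Ck_on k (dird f v) S" using Suc.prems(2) by simp
    show "\<And>x. x \<in> S \<Longrightarrow> dird f v x = dird g v x" using dird_eq[OF gd] by metis
  qed
  ultimately show ?case by simp
qed

text \<open>Lets a derivative known in closed form stand in for \<open>frechet_derivative\<close>,
  which is only a choice; most closure properties below rest on this rule.\<close>

lemma Ck_on_Suc:
  assumes "open S" "\<And>x. x \<in> S \<Longrightarrow> (f has_derivative f' x) (at x)"
    and "\<And>v. Ck_on k (\<lambda>x. f' x v) S"
  shows "Ck_on (Suc k) f S"
proof -
  have "f differentiable_on S"
    using assms(2) unfolding differentiable_on_def
    by (meson differentiable_at_withinI differentiable_def)
  moreover have "Ck_on k (dird f v) S" for v
    by (rule Ck_on_cong[OF assms(1) _ assms(3)[of v]]) (simp add: dird_eq[OF assms(2)])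
  ultimately show ?thesis by simp
qed

lemma Ck_on_SucD:
  assumes "open S" "Ck_on (Suc k) f S" "x \<in> S"
  shows "(f has_derivative frechet_derivative f (at x)) (at x)"
  using assms(2,3) frechet_derivative_works[of f "at x"] differentiable_on_eq_differentiable_at[OF assms(1), of f]
  by auto

lemma Ck_on_Suc_imp: "Ck_on (Suc k) f S \<Longrightarrow> Ck_on k f S"
proof (induction k arbitrary: f)
  case 0
  then show ?case by (simp add: differentiable_imp_continuous_on)
next
  case (Suc k)
  from Suc.prems have "f differentiable_on S" "\<And>v. Ck_on (Suc k) (dird f v) S"
    by (simp_all only: Ck_on.simps(2)[of "Suc k"])
  then show ?case using Suc.IH[of "dird f _"] Ck_on.simps(2)[of k f S] by blast
qed

lemma Ck_on_subset: "Ck_on k f S \<Longrightarrow> T \<subseteq> S \<Longrightarrow> Ck_on k f T"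
proof (induction k arbitrary: f)
  case 0
  then show ?case using continuous_on_subset by auto
next
  case (Suc k)
  then show ?case using differentiable_on_subset by (simp only: Ck_on.simps(2)) blast
qed

lemma Ck_on_const: "Ck_on k (\<lambda>x. c) S"
  by (induction k arbitrary: c) (simp_all only: Ck_on.simps continuous_on_const differentiable_on_const frechet_derivative_const simp_thms)

lemma Ck_on_bounded_linear:
  assumes "bounded_linear f" "open S"
  shows "Ck_on k f S"
proof (cases k)
  case 0
  then show ?thesis by (simp add: assms(1) linear_continuous_on)
next
  case (Suc m)
  have "Ck_on (Suc m) f S"
    by (rule Ck_on_Suc[OF assms(2) bounded_linear_imp_has_derivative[OF assms(1)]]) (rule Ck_on_const)
  then show ?thesis using Suc by simp
qed

lemma Ck_on_add:
  assumes "open S" "Ck_on k f S" "Ck_on k g S"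
  shows "Ck_on k (\<lambda>x. f x + g x) S"
  using assms(2,3)
proof (induction k arbitrary: f g)
  case 0
  then show ?case by (simp add: continuous_on_add)
next
  case (Suc k)
  show ?case
    by (rule Ck_on_Suc[OF assms(1) has_derivative_add
          [OF Ck_on_SucD[OF assms(1) Suc.prems(1)] Ck_on_SucD[OF assms(1) Suc.prems(2)]]])
       (use Suc in auto)
qed

lemma Ck_on_bilinear:
  assumes "bounded_bilinear pr" "open S" "Ck_on k f S" "Ck_on k g S"
  shows "Ck_on k (\<lambda>x. pr (f x) (g x)) S"
  using assms(3,4)
proof (induction k arbitrary: f g)
  case 0
  then show ?case using bounded_bilinear.continuous_on[OF assms(1)] by auto
next
  case (Suc k)
  show ?case
    by (rule Ck_on_Suc[OF assms(2) bounded_bilinear.FDERIV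
          [OF assms(1) Ck_on_SucD[OF assms(2) Suc.prems(1)] Ck_on_SucD[OF assms(2) Suc.prems(2)]]])
       (auto intro!: Ck_on_add[OF assms(2)] Suc.IH Ck_on_Suc_imp[OF Suc.prems(1)] Ck_on_Suc_imp[OF Suc.prems(2)]
         Suc.prems[unfolded Ck_on.simps, THEN conjunct2, rule_format] simp del: Ck_on.simps)
qed

lemma Ck_on_sum:
  assumes "open S" "\<And>i. i \<in> I \<Longrightarrow> Ck_on k (f i) S"
  shows "Ck_on k (\<lambda>x. \<Sum>i\<in>I. f i x) S"
  using assms(2)
  by (induction I rule: infinite_finite_induct) (simp_all add: Ck_on_add[OF assms(1)] Ck_on_const del: Ck_on.simps)

text \<open>\<open>Ck_on\<close> controls derivatives in fixed directions only, whereas in the chain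
  rule the direction \<open>dird g v x\<close> moves with \<open>x\<close>. Expanding that direction
  in the finite basis turns the derivative into a sum of products, to which the induction
  applies.\<close>

lemma Ck_on_compose:
  fixes f :: "'b::euclidean_space \<Rightarrow> 'c::real_normed_vector"
  assumes "open S" "open T" "g ` S \<subseteq> T" "Ck_on k f T" "Ck_on k g S"
  shows "Ck_on k (\<lambda>x. f (g x)) S"
  using assms(4,5)
proof (induction k arbitrary: f)
  case 0
  then show ?case using assms(3) continuous_on_compose2 by auto
next
  case (Suc k)
  have gd: "(g has_derivative frechet_derivative g (at x)) (at x)" if "x \<in> S" for x
    using Ck_on_SucD[OF assms(1) Suc.prems(2) that] .
  have fd: "(f has_derivative frechet_derivative f (at (g x))) (at (g x))" if "x \<in> S" for x
    using Ck_on_SucD[OF assms(2) Suc.prems(1)] that assms(3) by auto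
  have eq: "frechet_derivative f (at (g x)) (dird g v x)
      = (\<Sum>b\<in>Basis. (dird g v x \<bullet> b) *\<^sub>R dird f b (g x))" if "x \<in> S" for x v
  proof -
    interpret l: linear "frechet_derivative f (at (g x))"
      by (rule has_derivative_linear[OF fd[OF that]])
    show ?thesis
      by (subst euclidean_representation[of "dird g v x", symmetric])
         (simp only: l.sum l.scaleR)
  qed
  show ?case
  proof (rule Ck_on_Suc[OF assms(1) has_derivative_compose[OF gd fd]])
    fix v
    have "Ck_on k (\<lambda>x. \<Sum>b\<in>Basis. (dird g v x \<bullet> b) *\<^sub>R dird f b (g x)) S"
    proof (intro Ck_on_sum Ck_on_bilinear[OF bounded_bilinear_scaleR]
        Ck_on_bilinear[OF bounded_bilinear_inner] Ck_on_const assms(1))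
      fix b :: 'b
      show "Ck_on k (dird g v) S" using Suc.prems(2) by simp
      show "Ck_on k (\<lambda>x. dird f b (g x)) S"
        using Suc.IH[of "dird f b"] Suc.prems Ck_on_Suc_imp by auto
    qed
    then show "Ck_on k (\<lambda>x. frechet_derivative f (at (g x)) (dird g v x)) S"
      by (rule Ck_on_cong[OF assms(1), rotated]) (simp add: eq)
  qed auto
qed

lemma Ck_on_inverse:
  fixes f :: "'a::real_normed_vector \<Rightarrow> real"
  assumes "open S" "Ck_on k f S" "\<And>x. x \<in> S \<Longrightarrow> f x \<noteq> 0"
  shows "Ck_on k (\<lambda>x. inverse (f x)) S"
  using assms(2)
proof (induction k)
  case 0
  then show ?case using assms(3) by (auto intro!: continuous_on_inverse)
next
  case (Suc k)
  have i: "Ck_on k (\<lambda>x. inverse (f x)) S" using Suc Ck_on_Suc_imp by blast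
  have d: "((\<lambda>x. inverse (f x)) has_derivative
      (\<lambda>h. - (inverse (f x) * frechet_derivative f (at x) h * inverse (f x)))) (at x)" if "x \<in> S" for x
    using Deriv.has_derivative_inverse[OF assms(3)[OF that] Ck_on_SucD[OF assms(1) Suc.prems that]] .
  show ?case
  proof (rule Ck_on_Suc[OF assms(1) d])
    fix v
    have "Ck_on k (\<lambda>x. (-1) * ((inverse (f x) * dird f v x) * inverse (f x))) S"
      using i Suc.prems
      by (intro Ck_on_bilinear[OF bounded_bilinear_mult] Ck_on_const assms(1)) auto
    then show "Ck_on k (\<lambda>x. - (inverse (f x) * dird f v x * inverse (f x))) S"
      by simp
  qed auto
qed

section \<open>Closure properties of smooth maps\<close>

lemma smooth_onI: "(\<And>k. Ck_on k f S) \<Longrightarrow> smooth_on f S"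
  by (simp add: smooth_on_def)

lemma smooth_onD: "smooth_on f S \<Longrightarrow> Ck_on k f S"
  by (simp add: smooth_on_def)

lemma smooth_on_has_derivative:
  assumes "smooth_on f S" "open S" "x \<in> S"
  shows "(f has_derivative frechet_derivative f (at x)) (at x)"
  using Ck_on_SucD[OF assms(2) smooth_onD[OF assms(1)] assms(3)] .

lemma smooth_on_differentiable:
  assumes "smooth_on f S" "open S" "x \<in> S"
  shows "f differentiable (at x)"
  using smooth_on_has_derivative[OF assms] differentiable_def by blast

lemma smooth_on_continuous_on: "smooth_on f S \<Longrightarrow> continuous_on S f"
  using smooth_onD[of f S 0] unfolding Ck_on.simps .

lemma smooth_on_dird: "smooth_on f S \<Longrightarrow> smooth_on (dird f v) S"
proof (rule smooth_onI)
  fix k assume "smooth_on f S"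
  from smooth_onD[OF this, of "Suc k"] show "Ck_on k (dird f v) S"
    by simp
qed

lemma smooth_on_cong:
  "open S \<Longrightarrow> smooth_on f S \<Longrightarrow> (\<And>x. x \<in> S \<Longrightarrow> f x = g x) \<Longrightarrow> smooth_on g S"
  unfolding smooth_on_def using Ck_on_cong by blast

lemma smooth_on_subset: "smooth_on f S \<Longrightarrow> T \<subseteq> S \<Longrightarrow> smooth_on f T"
  unfolding smooth_on_def using Ck_on_subset by blast

lemma smooth_on_const: "smooth_on (\<lambda>x. c) S"
  by (rule smooth_onI) (rule Ck_on_const)

lemma smooth_on_bounded_linear: "bounded_linear f \<Longrightarrow> open S \<Longrightarrow> smooth_on f S"
  by (simp add: smooth_on_def Ck_on_bounded_linear)

lemma smooth_on_add:
  "open S \<Longrightarrow> smooth_on f S \<Longrightarrow> smooth_on g S \<Longrightarrow> smooth_on (\<lambda>x. f x + g x) S"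
  by (simp add: smooth_on_def Ck_on_add)

lemma smooth_on_mult:
  fixes f g :: "_ \<Rightarrow> real"
  shows "open S \<Longrightarrow> smooth_on f S \<Longrightarrow> smooth_on g S \<Longrightarrow> smooth_on (\<lambda>x. f x * g x) S"
  by (simp add: smooth_on_def Ck_on_bilinear[OF bounded_bilinear_mult])

lemma smooth_on_scaleR:
  "open S \<Longrightarrow> smooth_on f S \<Longrightarrow> smooth_on g S \<Longrightarrow> smooth_on (\<lambda>x. f x *\<^sub>R g x) S"
  by (simp add: smooth_on_def Ck_on_bilinear[OF bounded_bilinear_scaleR])

lemma smooth_on_sum:
  "open S \<Longrightarrow> (\<And>i. i \<in> I \<Longrightarrow> smooth_on (f i) S) \<Longrightarrow> smooth_on (\<lambda>x. \<Sum>i\<in>I. f i x) S"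
  by (simp add: smooth_on_def Ck_on_sum)

lemma smooth_on_minus: "open S \<Longrightarrow> smooth_on f S \<Longrightarrow> smooth_on (\<lambda>x. - f x) S"
  using smooth_on_scaleR[OF _ smooth_on_const[of "-1::real"], of S f] by simp

lemma smooth_on_diff:
  "open S \<Longrightarrow> smooth_on f S \<Longrightarrow> smooth_on g S \<Longrightarrow> smooth_on (\<lambda>x. f x - g x) S"
  using smooth_on_add[of S f "\<lambda>x. - g x"] smooth_on_minus[of S g] by simp

lemma smooth_on_compose:
  fixes f :: "'b::euclidean_space \<Rightarrow> 'c::real_normed_vector"
  shows "smooth_on f T \<Longrightarrow> open S \<Longrightarrow> open T \<Longrightarrow> g ` S \<subseteq> T \<Longrightarrow> smooth_on g S \<Longrightarrow>
    smooth_on (\<lambda>x. f (g x)) S"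
  by (rule smooth_onI, rule Ck_on_compose[of S T]) (simp_all add: smooth_onD)

lemma smooth_on_inverse:
  fixes f :: "_ \<Rightarrow> real"
  shows "open S \<Longrightarrow> smooth_on f S \<Longrightarrow> (\<And>x. x \<in> S \<Longrightarrow> f x \<noteq> 0) \<Longrightarrow>
    smooth_on (\<lambda>x. inverse (f x)) S"
  by (rule smooth_onI, rule Ck_on_inverse) (simp_all add: smooth_onD)

lemma smooth_on_divide:
  fixes f :: "_ \<Rightarrow> real"
  shows "open S \<Longrightarrow> smooth_on f S \<Longrightarrow> smooth_on g S \<Longrightarrow> (\<And>x. x \<in> S \<Longrightarrow> g x \<noteq> 0) \<Longrightarrow>
    smooth_on (\<lambda>x. f x / g x) S"
  unfolding divide_inverse by (intro smooth_on_mult smooth_on_inverse)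

lemma smooth_on_bounded_linear_compose:
  fixes f :: "'b::real_normed_vector \<Rightarrow> 'c::real_normed_vector"
  assumes "bounded_linear f" "open S" "smooth_on g S"
  shows "smooth_on (\<lambda>x. f (g x)) S"
proof (rule smooth_onI)
  fix k
  have "Ck_on k g S" using assms(3) by (simp add: smooth_on_def)
  then show "Ck_on k (\<lambda>x. f (g x)) S"
  proof (induction k arbitrary: g)
    case 0
    then show ?case using assms(1) by (simp add: bounded_linear.continuous_on)
  next
    case (Suc k)
    show ?case
      by (rule Ck_on_Suc[OF assms(2) bounded_linear.has_derivative[OF assms(1) Ck_on_SucD[OF assms(2) Suc.prems]]])
         (use Suc in auto)
  qed
qed

lemma smooth_on_vec_nth: "open S \<Longrightarrow> smooth_on f S \<Longrightarrow> smooth_on (\<lambda>x. f x $ i) S"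
  by (rule smooth_on_bounded_linear_compose[OF bounded_linear_vec_nth])

lemma vec_lambda_eq_sum: "(\<chi> i. h i) = (\<Sum>i\<in>UNIV. h i *\<^sub>R axis i (1::real))"
  using basis_expansion[of "\<chi> i. h i"] by (simp add: scalar_mult_eq_scaleR)

lemma smooth_on_vec_lambda:
  fixes f :: "'i::finite \<Rightarrow> 'a::real_normed_vector \<Rightarrow> real"
  assumes "open S" "\<And>i. smooth_on (f i) S"
  shows "smooth_on (\<lambda>x. \<chi> i. f i x) S"
  unfolding vec_lambda_eq_sum
  by (intro smooth_on_sum smooth_on_scaleR smooth_on_const assms)

lemma smooth_on_vecI:
  fixes f :: "'a::real_normed_vector \<Rightarrow> real^'i"
  assumes "open S" "\<And>i. smooth_on (\<lambda>x. f x $ i) S"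
  shows "smooth_on f S"
  using smooth_on_vec_lambda[of S "\<lambda>i x. f x $ i", OF assms] by simp

lemma smooth_on_pd: "smooth_on f S \<Longrightarrow> smooth_on (\<lambda>x. pd f x a) S"
  unfolding pd_def by (rule smooth_on_dird)

lemma Ck_on_prod:
  fixes f :: "'i \<Rightarrow> _ \<Rightarrow> real"
  assumes "open S" "\<And>i. i \<in> I \<Longrightarrow> Ck_on k (f i) S"
  shows "Ck_on k (\<lambda>x. \<Prod>i\<in>I. f i x) S"
  using assms(2)
  by (induction I rule: infinite_finite_induct)
    (simp_all add: Ck_on_bilinear[OF bounded_bilinear_mult assms(1)] Ck_on_const del: Ck_on.simps)

lemma Ck_on_vec_lambda:
  fixes f :: "'i::finite \<Rightarrow> 'a::real_normed_vector \<Rightarrow> real"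
  assumes "open S" "\<And>i. Ck_on k (f i) S"
  shows "Ck_on k (\<lambda>x. \<chi> i. f i x) S"
  unfolding vec_lambda_eq_sum
  by (rule Ck_on_sum[OF assms(1)], rule Ck_on_bilinear[OF bounded_bilinear_scaleR assms(1) assms(2) Ck_on_const])

text \<open>Cramer's rule exhibits \<open>y\<close> as a vector of quotients of determinants, which
  are polynomials in the entries. This serves the bootstrap for inverse functions, where
  \<open>y\<close> is a derivative of the inverse.\<close>

lemma Ck_on_matrix_solution:
  fixes M :: "'a::real_normed_vector \<Rightarrow> real^'n^'n"
  assumes S: "open S" and M: "\<And>i j. Ck_on k (\<lambda>x. M x $ i $ j) S"
    and nz: "\<And>x. x \<in> S \<Longrightarrow> det (M x) \<noteq> 0" and eq: "\<And>x. x \<in> S \<Longrightarrow> M x *v y x = b"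
  shows "Ck_on k y S"
proof -
  have det: "Ck_on k (\<lambda>x. det (N x)) S" if "\<And>i j. Ck_on k (\<lambda>x. N x $ i $ j) S"
    for N :: "'a \<Rightarrow> real^'n^'n"
    unfolding det_def
    by (rule Ck_on_sum[OF S], rule Ck_on_bilinear[OF bounded_bilinear_mult S Ck_on_const], rule Ck_on_prod[OF S that])
  have e: "Ck_on k (\<lambda>x. (\<chi> i j. if j = l then b $ i else M x $ i $ j) $ i $ j) S" for i j l
    using M[of i j] Ck_on_const[of k "b $ i" S] by (cases "j = l") (simp_all del: Ck_on.simps)
  have "Ck_on k (\<lambda>x. (\<chi> l. det (\<chi> i j. if j = l then b $ i else M x $ i $ j) / det (M x))) S"
    unfolding divide_inverse
    by (rule Ck_on_vec_lambda[OF S], rule Ck_on_bilinear[OF bounded_bilinear_mult S])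
       (rule det[OF e], rule Ck_on_inverse[OF S det[OF M] nz])
  then show ?thesis
    by (rule Ck_on_cong[OF S, rotated]) (rule cramer[OF nz, THEN iffD1, OF _ eq, symmetric])
qed

section \<open>Partial derivatives and parameter integrals\<close>

lemma pd_eq: "(f has_derivative f') (at x) \<Longrightarrow> pd f x a = f' (axis a 1)"
  by (simp add: pd_def dird_eq)

lemma frechet_eq_sum_pd:
  assumes "f differentiable (at x)"
  shows "frechet_derivative f (at x) v = (\<Sum>i\<in>UNIV. v $ i *\<^sub>R pd f x i)"
proof -
  interpret l: linear "frechet_derivative f (at x)"
    using assms by (rule linear_frechet_derivative)
  have v: "(\<Sum>i\<in>UNIV. v $ i *\<^sub>R axis i 1) = v"
    by (simp only: vec_lambda_eq_sum[symmetric]) simp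
  show ?thesis
    unfolding pd_def l.scaleR[symmetric] l.sum[symmetric] v ..
qed

lemma pd_cong:
  assumes "open S" "x \<in> S" "f differentiable (at x)" "\<And>z. z \<in> S \<Longrightarrow> f z = g z"
  shows "pd f x a = pd g x a"
  using frechet_derivative_transform_within_open[OF assms(3,1,2)] assms(4) by (simp add: pd_def)

lemma pd_const: "pd (\<lambda>z. c) x a = 0"
  by (simp add: pd_def)

lemma pd_add:
  "f differentiable (at x) \<Longrightarrow> g differentiable (at x) \<Longrightarrow>
    pd (\<lambda>z. f z + g z) x a = pd f x a + pd g x a"
  unfolding pd_def
  by (rule dird_eq[OF has_derivative_add[OF frechet_derivative_works[THEN iffD1] frechet_derivative_works[THEN iffD1]]])

lemma pd_diff:
  "f differentiable (at x) \<Longrightarrow> g differentiable (at x) \<Longrightarrow>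
    pd (\<lambda>z. f z - g z) x a = pd f x a - pd g x a"
  unfolding pd_def
  by (rule dird_eq[OF has_derivative_diff[OF frechet_derivative_works[THEN iffD1] frechet_derivative_works[THEN iffD1]]])

lemma pd_minus: "f differentiable (at x) \<Longrightarrow> pd (\<lambda>z. - f z) x a = - pd f x a"
  unfolding pd_def by (rule dird_eq[OF has_derivative_minus[OF frechet_derivative_works[THEN iffD1]]])

lemma pd_mult:
  fixes f g :: "real^'n \<Rightarrow> real"
  shows "f differentiable (at x) \<Longrightarrow> g differentiable (at x) \<Longrightarrow>
    pd (\<lambda>z. f z * g z) x a = f x * pd g x a + pd f x a * g x"
  unfolding pd_def
  by (rule dird_eq[OF has_derivative_mult[OF frechet_derivative_works[THEN iffD1] frechet_derivative_works[THEN iffD1]]])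

lemma pd_sum:
  assumes "\<And>i. i \<in> I \<Longrightarrow> f i differentiable (at x)"
  shows "pd (\<lambda>z. \<Sum>i\<in>I. f i z) x a = (\<Sum>i\<in>I. pd (f i) x a)"
proof -
  have "((\<lambda>z. \<Sum>i\<in>I. f i z) has_derivative (\<lambda>v. \<Sum>i\<in>I. frechet_derivative (f i) (at x) v)) (at x)"
    by (rule has_derivative_sum) (use assms frechet_derivative_works in blast)
  from pd_eq[OF this] show ?thesis by (simp add: pd_def)
qed

lemma pd_nth:
  fixes f :: "real^'n \<Rightarrow> 'b::real_normed_vector^'m"
  assumes "f differentiable (at x)"
  shows "pd (\<lambda>z. f z $ i) x a = pd f x a $ i"
  using pd_eq[OF bounded_linear.has_derivative[OF bounded_linear_vec_nth
        assms[unfolded frechet_derivative_works]], of i a]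
  by (simp add: pd_def)

lemma pd_coord: "pd (\<lambda>z. z $ i) x a = (if i = a then 1 else 0)"
  by (simp add: pd_eq[OF bounded_linear_imp_has_derivative[OF bounded_linear_vec_nth]] axis_def)

lemma pd_chain:
  fixes g :: "real^'n \<Rightarrow> real^'m"
  assumes "g differentiable (at x)" "f differentiable (at (g x))"
  shows "pd (\<lambda>z. f (g z)) x a = (\<Sum>i\<in>UNIV. pd g x a $ i *\<^sub>R pd f (g x) i)"
proof -
  have "((\<lambda>z. f (g z)) has_derivative (\<lambda>v. frechet_derivative f (at (g x)) (frechet_derivative g (at x) v))) (at x)"
    by (rule has_derivative_compose[OF assms[unfolded frechet_derivative_works]])
  from pd_eq[OF this] show ?thesis
    by (simp add: frechet_eq_sum_pd[OF assms(2)]) (simp add: pd_def)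
qed

section \<open>Symmetry of second derivatives\<close>

lemma line_derivative:
  fixes f :: "'a::real_normed_vector \<Rightarrow> real"
  assumes "f differentiable (at (y + s *\<^sub>R v))"
  shows "((\<lambda>s. f (y + s *\<^sub>R v)) has_real_derivative dird f v (y + s *\<^sub>R v)) (at s)"
proof -
  have 1: "((\<lambda>s. y + s *\<^sub>R v) has_derivative (\<lambda>h. h *\<^sub>R v)) (at s)"
    by (auto intro!: derivative_eq_intros)
  have 2: "(f has_derivative frechet_derivative f (at (y + s *\<^sub>R v))) (at (y + s *\<^sub>R v))"
    using assms frechet_derivative_works by blast
  interpret l: linear "frechet_derivative f (at (y + s *\<^sub>R v))"
    using assms by (rule linear_frechet_derivative)
  have "((\<lambda>s. f (y + s *\<^sub>R v)) has_derivative (\<lambda>h. h *\<^sub>R dird f v (y + s *\<^sub>R v))) (at s)"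
    using has_derivative_compose[OF 1 2] by (simp add: l.scaleR)
  then show ?thesis
    unfolding has_field_derivative_def by (rule has_derivative_eq_rhs) (simp add: fun_eq_iff)
qed

text \<open>Two applications of the mean value theorem, first along \<open>v\<close> to the
  increment \<open>p\<close>, then along \<open>w\<close> to \<open>dird f v\<close>. The second
  difference itself is symmetric in \<open>v\<close> and \<open>w\<close>.\<close>

lemma second_difference:
  fixes f :: "'a::real_normed_vector \<Rightarrow> real"
  assumes f: "smooth_on f S" and S: "open S" "ball x d \<subseteq> S"
    and h: "0 < h" "h * (norm v + norm w) < d"
  shows "\<exists>y\<in>ball x d. f (x + h *\<^sub>R v + h *\<^sub>R w) - f (x + h *\<^sub>R v) - f (x + h *\<^sub>R w) + f x
    = h * (h * dird (dird f v) w y)"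
proof -
  have in_ball: "x + s *\<^sub>R v + t *\<^sub>R w \<in> ball x d" if "0 \<le> s" "s \<le> h" "0 \<le> t" "t \<le> h" for s t
  proof -
    have "norm (s *\<^sub>R v + t *\<^sub>R w) \<le> s * norm v + t * norm w"
      using that norm_triangle_ineq[of "s *\<^sub>R v" "t *\<^sub>R w"] by simp
    also have "\<dots> \<le> h * norm v + h * norm w"
      using that by (intro add_mono mult_right_mono) auto
    finally show ?thesis
      using h(2) norm_minus_cancel[of "s *\<^sub>R v + t *\<^sub>R w"] by (simp add: dist_norm algebra_simps)
  qed
  have diff: "g differentiable (at (x + s *\<^sub>R v + t *\<^sub>R w))"
    if "smooth_on g S" "0 \<le> s" "s \<le> h" "0 \<le> t" "t \<le> h" for g :: "'a \<Rightarrow> real" and s t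
    using smooth_on_differentiable[OF that(1) S(1)] in_ball[OF that(2-)] S(2) by blast
  define p where "p s = f (x + s *\<^sub>R v + h *\<^sub>R w) - f (x + s *\<^sub>R v)" for s
  have "(p has_real_derivative
      dird f v (x + s *\<^sub>R v + h *\<^sub>R w) - dird f v (x + s *\<^sub>R v)) (at s)" if "0 \<le> s" "s \<le> h" for s
    unfolding p_def
    using line_derivative[of f "x + h *\<^sub>R w" s v] line_derivative[of f x s v]
      diff[OF f that, of h] diff[OF f that, of 0] h(1)
    by (auto intro!: derivative_intros simp: add_ac)
  from MVT2[OF h(1) this] obtain s where s: "0 < s" "s < h"
    and ps: "p h - p 0 = (h - 0) * (dird f v (x + s *\<^sub>R v + h *\<^sub>R w) - dird f v (x + s *\<^sub>R v))" by auto
  have "((\<lambda>t. dird f v (x + s *\<^sub>R v + t *\<^sub>R w)) has_real_derivative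
      dird (dird f v) w (x + s *\<^sub>R v + t *\<^sub>R w)) (at t)" if "0 \<le> t" "t \<le> h" for t
    by (rule line_derivative, rule diff[OF smooth_on_dird[OF f]]) (use s that in auto)
  from MVT2[OF h(1) this] obtain t where t: "0 < t" "t < h"
    and "dird f v (x + s *\<^sub>R v + h *\<^sub>R w) - dird f v (x + s *\<^sub>R v)
      = h * dird (dird f v) w (x + s *\<^sub>R v + t *\<^sub>R w)" by auto
  with ps have "p h - p 0 = h * (h * dird (dird f v) w (x + s *\<^sub>R v + t *\<^sub>R w))" by simp
  then show ?thesis
    using in_ball[of s t] s t by (intro bexI[of _ "x + s *\<^sub>R v + t *\<^sub>R w"]) (auto simp: p_def)
qed

lemma dird_commute:
  fixes f :: "'a::real_normed_vector \<Rightarrow> real"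
  assumes f: "smooth_on f S" and S: "open S" "x \<in> S"
  shows "dird (dird f v) w x = dird (dird f w) v x"
proof (rule ccontr)
  assume ne: "\<not> ?thesis"
  \<comment> \<open>Half the supposed gap: two errors below \<open>e\<close> cannot bridge
    it.\<close>
  define e where "e = \<bar>dird (dird f v) w x - dird (dird f w) v x\<bar> / 2"
  have e: "e > 0" using ne by (simp add: e_def)
  obtain r where r: "r > 0" "ball x r \<subseteq> S" using S open_contains_ball by blast
  have "isCont (dird (dird f v) w) x" "isCont (dird (dird f w) v) x"
    using f S smooth_on_dird smooth_on_continuous_on continuous_on_eq_continuous_at by blast+
  then obtain d1 d2 where d1: "d1 > 0" "\<And>y. dist y x < d1 \<Longrightarrow> dist (dird (dird f v) w y) (dird (dird f v) w x) < e"
    and d2: "d2 > 0" "\<And>y. dist y x < d2 \<Longrightarrow> dist (dird (dird f w) v y) (dird (dird f w) v x) < e"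
    using e unfolding continuous_at_eps_delta by metis
  define d where "d = min r (min d1 d2)"
  have d: "d > 0" "ball x d \<subseteq> S" using r d1 d2 by (auto simp: d_def)
  \<comment> \<open>The added 1 keeps the denominator positive for \<open>v = w = 0\<close> and
    makes the bound in \<open>second_difference\<close> strict.\<close>
  define h where "h = d / (norm v + norm w + 1)"
  have pos: "norm v + norm w + 1 > 0" by (simp add: add_nonneg_pos)
  have h: "h > 0" "h * (norm v + norm w) < d" "h * (norm w + norm v) < d"
    using d pos by (auto simp: h_def divide_simps mult_less_cancel_left)
  obtain y where y: "y \<in> ball x d" "f (x + h *\<^sub>R v + h *\<^sub>R w) - f (x + h *\<^sub>R v) - f (x + h *\<^sub>R w) + f x
    = h * (h * dird (dird f v) w y)"
    using second_difference[OF f S(1) d(2) h(1,2)] by blast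
  obtain z where z: "z \<in> ball x d" "f (x + h *\<^sub>R w + h *\<^sub>R v) - f (x + h *\<^sub>R w) - f (x + h *\<^sub>R v) + f x
    = h * (h * dird (dird f w) v z)"
    using second_difference[OF f S(1) d(2) h(1,3)] by blast
  have "h * (h * dird (dird f v) w y) = h * (h * dird (dird f w) v z)"
  proof -
    have "f (x + h *\<^sub>R w + h *\<^sub>R v) = f (x + h *\<^sub>R v + h *\<^sub>R w)"
      by (simp add: add.commute add.left_commute)
    with y(2) z(2) show ?thesis by linarith
  qed
  then have "dird (dird f v) w y = dird (dird f w) v z" using h(1) by simp
  moreover have "dist (dird (dird f v) w y) (dird (dird f v) w x) < e"
    "dist (dird (dird f w) v z) (dird (dird f w) v x) < e"
    using d1(2)[of y] d2(2)[of z] y(1) z(1) by (simp_all add: d_def dist_commute)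
  ultimately have "dist (dird (dird f v) w x) (dird (dird f w) v x) < e + e"
    using dist_triangle3[of "dird (dird f v) w x" "dird (dird f w) v x" "dird (dird f w) v z"] by simp
  then show False
    by (simp add: e_def dist_real_def)
qed

lemma pd_commute:
  fixes f :: "real^'n \<Rightarrow> real"
  assumes "smooth_on f S" "open S" "x \<in> S"
  shows "pd (\<lambda>z. pd f z a) x b = pd (\<lambda>z. pd f z b) x a"
  unfolding pd_def by (rule dird_commute[OF assms])

section \<open>Differentiation under the integral sign\<close>

lemma has_derivative_integral_param:
  fixes F :: "real \<times> 'a::euclidean_space \<Rightarrow> real"
  assumes I: "open I" "{0..1} \<subseteq> I" and S: "open S" "convex S" and F: "Ck_on (Suc 0) F (I \<times> S)"
    and q: "q \<in> S"
  shows "((\<lambda>q. integral {0..1} (\<lambda>s. F (s, q))) has_derivative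
    (\<lambda>v. integral {0..1} (\<lambda>s. dird F (0, v) (s, q)))) (at q)"
proof -
  have open_IS: "open (I \<times> S)" using I S open_Times by blast
  \<comment> \<open>The Leibniz rule asks for the derivative as a continuous family of operators; in
    finite dimension this reduces to continuity on each fixed vector.\<close>
  define G where "G x t = Blinfun (\<lambda>v. dird F (0, v) (t, x))" for x t
  have dF: "(F has_derivative frechet_derivative F (at (t, x))) (at (t, x))"
    if "t \<in> {0..1}" "x \<in> S" for t x
    using Ck_on_SucD[OF open_IS F] that I by auto
  have dx: "((\<lambda>x. F (t, x)) has_derivative (\<lambda>v. dird F (0, v) (t, x))) (at x)"
    if "t \<in> {0..1}" "x \<in> S" for t x
  proof -
    have "((\<lambda>x. (t, x)) has_derivative (\<lambda>v. (0, v))) (at x)"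
      by (auto intro!: derivative_eq_intros)
    from has_derivative_compose[OF this dF[OF that]] show ?thesis .
  qed
  have G: "blinfun_apply (G x t) = (\<lambda>v. dird F (0, v) (t, x))"
    if "t \<in> {0..1}" "x \<in> S" for t x
    unfolding G_def
    by (rule bounded_linear_Blinfun_apply[OF has_derivative_bounded_linear[OF dx[OF that]]])
  have contF: "continuous_on (I \<times> S) F"
    using Ck_on_Suc_imp[OF F] by simp
  have contd: "continuous_on (I \<times> S) (dird F (0, i))" for i
    using F by simp
  have contG: "continuous_on (S \<times> cbox 0 1) (\<lambda>(x, t). G x t)"
  proof (rule continuous_on_blinfun_componentwise)
    fix i :: 'a
    have "continuous_on (S \<times> cbox 0 1) (\<lambda>p. dird F (0, i) (snd p, fst p))"
      by (rule continuous_on_compose2[OF contd])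
        (use I in \<open>auto intro!: continuous_intros\<close>)
    then show "continuous_on (S \<times> cbox 0 1) (\<lambda>x. blinfun_apply (case x of (x, t) \<Rightarrow> G x t) i)"
      by (rule continuous_on_eq) (auto simp: G)
  qed
  have cont_t: "continuous_on (cbox 0 1) (\<lambda>t. G q t)"
  proof -
    have "continuous_on (cbox 0 1) (\<lambda>t. (q, t))" by (intro continuous_intros)
    from continuous_on_compose2[OF contG this] show ?thesis using q by auto
  qed
  have "((\<lambda>x. integral (cbox 0 1) (\<lambda>t. F (t, x))) has_derivative integral (cbox 0 1) (G q)) (at q within S)"
  proof (rule leibniz_rule[OF _ _ contG q S(2)])
    fix x t assume xt: "x \<in> S" "t \<in> cbox (0::real) 1"
    show "((\<lambda>x. F (t, x)) has_derivative blinfun_apply (G x t)) (at x within S)"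
      using dx[of t x] G[of t x] xt has_derivative_at_withinI by auto
  next
    fix x assume x: "x \<in> S"
    show "(\<lambda>t. F (t, x)) integrable_on cbox 0 1"
      by (rule integrable_continuous, rule continuous_on_compose2[OF contF])
         (use x I in \<open>auto intro!: continuous_intros\<close>)
  qed
  moreover have "blinfun_apply (integral (cbox 0 1) (G q)) = (\<lambda>v. integral (cbox 0 1) (\<lambda>s. dird F (0, v) (s, q)))"
  proof
    fix v
    have "blinfun_apply (integral (cbox 0 1) (G q)) v = integral (cbox 0 1) (\<lambda>s. blinfun_apply (G q s) v)"
      by (rule blinfun_apply_integral[OF integrable_continuous[OF cont_t]])
    also have "\<dots> = integral (cbox 0 1) (\<lambda>s. dird F (0, v) (s, q))"
      by (rule integral_cong) (use G q in auto)
    finally show "blinfun_apply (integral (cbox 0 1) (G q)) v = integral (cbox 0 1) (\<lambda>s. dird F (0, v) (s, q))" .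
  qed
  ultimately show ?thesis
    using at_within_open[OF q S(1)] by simp
qed

text \<open>Differentiating under the integral gives an integral of the same kind with
  \<open>dird F (0, v)\<close> in place of \<open>F\<close>, so the order climbs by induction. The
  open set \<open>I\<close> surrounds the unit interval because \<open>Ck_on\<close> is meant for
  open sets.\<close>

lemma smooth_on_integral_param:
  fixes F :: "real \<times> 'a::euclidean_space \<Rightarrow> real"
  assumes I: "open I" "{0..1} \<subseteq> I" and S: "open S" "convex S" and F: "smooth_on F (I \<times> S)"
  shows "smooth_on (\<lambda>q. integral {0..1} (\<lambda>s. F (s, q))) S"
proof (rule smooth_onI)
  fix k
  have "Ck_on k F (I \<times> S)" using F by (rule smooth_onD)
  then show "Ck_on k (\<lambda>q. integral {0..1} (\<lambda>s. F (s, q))) S"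
  proof (induction k arbitrary: F)
    case 0
    have "continuous_on (S \<times> cbox 0 1) (\<lambda>(x, t). F (t, x))"
      using 0 I unfolding split_beta
      by (auto intro!: continuous_on_compose2[of "I \<times> S" F] continuous_intros)
    from integral_continuous_on_param[OF this] show ?case by simp
  next
    case (Suc k)
    have 1: "Ck_on (Suc 0) F (I \<times> S)"
    proof -
      have "Ck_on (Suc j) F (I \<times> S) \<Longrightarrow> Ck_on (Suc 0) F (I \<times> S)" for j
        by (induction j) (simp_all only: Ck_on_Suc_imp)
      then show ?thesis using Suc.prems by blast
    qed
    show ?case
    proof (rule Ck_on_Suc[OF S(1) has_derivative_integral_param[OF I S 1]])
      fix v
      show "Ck_on k (\<lambda>q. integral {0..1} (\<lambda>s. dird F (0, v) (s, q))) S"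
        using Suc.IH[of "dird F (0, v)"] Suc.prems by simp
    qed auto
  qed
qed

section \<open>Leafwise Poincare lemma and inverse functions\<close>

lemma dird_snd:
  assumes "F differentiable (at (s, x))"
  shows "dird F (0, axis i 1) (s, x) = pd (\<lambda>z. F (s, z)) x i"
proof -
  have "((\<lambda>z. (s, z)) has_derivative (\<lambda>v. (0, v))) (at x)"
    by (auto intro!: derivative_eq_intros)
  from pd_eq[OF has_derivative_compose[OF this assms[unfolded frechet_derivative_works]], of i]
  show ?thesis by simp
qed

text \<open>Contracting only the coordinates in \<open>J\<close> gives the Poincare lemma with the remaining
  coordinates as parameters.\<close>

lemma poincare_partial:
  fixes \<beta> :: "real^'n \<Rightarrow> real^'n" and J :: "'n set"
  assumes \<beta>: "smooth_on \<beta> (ball z0 r)"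
    and closed: "\<And>z i j. z \<in> ball z0 r \<Longrightarrow> i \<in> J \<Longrightarrow> j \<in> J \<Longrightarrow> pd \<beta> z i $ j = pd \<beta> z j $ i"
  shows "\<exists>y. smooth_on y (ball z0 (r/2)) \<and> (\<forall>z\<in>ball z0 (r/2). \<forall>i\<in>J. pd y z i = \<beta> z $ i)"
proof -
  \<comment> \<open>An open interval around the range of integration. As |s| < 2 on it,
    \<open>H\<close> at most doubles the distance to \<open>z0\<close>; hence the radius
    \<open>r/2\<close>.\<close>
  define I where "I = {-1<..<2::real}"
  define S where "S = ball z0 (r/2)"
  define H where "H s z = (\<chi> i. if i \<in> J then z0 $ i + s * (z $ i - z0 $ i) else z $ i)" for s :: real and z :: "real^'n"
  \<comment> \<open>The integrand of the usual homotopy operator, with only the coordinates in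
    \<open>J\<close> contracted.\<close>
  define F where "F p = (\<Sum>j\<in>J. \<beta> (H (fst p) (snd p)) $ j * (snd p $ j - z0 $ j))" for p
  define y where "y z = integral {0..1} (\<lambda>s. F (s, z))" for z
  have I: "open I" "{0..1} \<subseteq> I" by (auto simp: I_def)
  have S: "open S" "convex S" by (auto simp: S_def)
  have IS: "open (I \<times> S)" using I S open_Times by blast
  have H_in: "H s z \<in> ball z0 r" if "s \<in> I" "z \<in> S" for s z
  proof -
    have "norm ((H s z - z0) $ i) \<le> norm ((2 *\<^sub>R (z - z0)) $ i)" for i
    proof -
      have "\<bar>s * (z $ i - z0 $ i)\<bar> \<le> \<bar>2 * (z $ i - z0 $ i)\<bar>"
        using that(1) unfolding abs_mult by (intro mult_right_mono) (auto simp: I_def)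
      then show ?thesis by (auto simp: H_def right_diff_distrib)
    qed
    then have "norm (H s z - z0) \<le> norm (2 *\<^sub>R (z - z0))" by (rule norm_le_componentwise_cart)
    then show ?thesis using that by (simp add: S_def dist_norm norm_minus_commute)
  qed
  have smooth_H: "smooth_on (\<lambda>p. H (fst p) (snd p)) (I \<times> S)"
  proof (rule smooth_on_vecI[OF IS])
    fix i
    have "smooth_on (\<lambda>p. snd p $ i) (I \<times> S)" "smooth_on (\<lambda>p. fst p) (I \<times> S)"
      by (rule smooth_on_vec_nth[OF IS smooth_on_bounded_linear[OF bounded_linear_snd IS]],
          rule smooth_on_bounded_linear[OF bounded_linear_fst IS])
    then show "smooth_on (\<lambda>p. H (fst p) (snd p) $ i) (I \<times> S)"
      by (cases "i \<in> J") (auto simp: H_def intro!: smooth_on_add smooth_on_mult smooth_on_diff smooth_on_const IS)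
  qed
  have smooth_F: "smooth_on F (I \<times> S)"
    unfolding F_def
  proof (rule smooth_on_sum[OF IS], rule smooth_on_mult[OF IS])
    fix j
    show "smooth_on (\<lambda>p. \<beta> (H (fst p) (snd p)) $ j) (I \<times> S)"
      by (rule smooth_on_vec_nth[OF IS smooth_on_compose[OF \<beta> IS open_ball _ smooth_H]]) (use H_in in auto)
    show "smooth_on (\<lambda>p. snd p $ j - z0 $ j) (I \<times> S)"
      by (intro smooth_on_diff smooth_on_vec_nth smooth_on_const IS smooth_on_bounded_linear bounded_linear_snd)
  qed
  have "smooth_on y S"
    unfolding y_def by (rule smooth_on_integral_param[OF I S smooth_F])
  moreover have "pd y z i = \<beta> z $ i" if z: "z \<in> S" and i: "i \<in> J" for z i
  proof -
    define w where "w = (\<chi> k. if k \<in> J then z $ k - z0 $ k else 0)"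
    have diff_\<beta>: "\<beta> differentiable (at (H s z))" if "s \<in> I" for s
      using smooth_on_differentiable[OF \<beta> open_ball H_in[OF that z]] .
    have diff_\<beta>_nth: "(\<lambda>z. \<beta> z $ k) differentiable (at (H s z))" if "s \<in> I" for s k
      using smooth_on_differentiable[OF smooth_on_vec_nth[OF open_ball \<beta>] open_ball H_in[OF that z]] .
    have dH: "(H s has_derivative (\<lambda>v. \<chi> k. if k \<in> J then s * v $ k else v $ k)) (at z)" for s
    proof -
      have "((\<lambda>z. if k \<in> J then z0 $ k + s * (z $ k - z0 $ k) else z $ k) has_derivative
          (\<lambda>v. if k \<in> J then s * v $ k else v $ k)) (at z)" for k
        using bounded_linear_imp_has_derivative[OF bounded_linear_vec_nth, of k "at z"]
        by (cases "k \<in> J") (auto intro!: derivative_eq_intros)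
      then show ?thesis
        unfolding H_def by (subst has_derivative_componentwise_within) (auto simp: Basis_vec_def inner_axis)
    qed
    have H': "H s differentiable (at z)" for s
      by (rule differentiableI[OF dH])
    have c: "(\<lambda>z. z $ j) differentiable (at z)" for j
      by (rule bounded_linear_imp_differentiable[OF bounded_linear_vec_nth])
    have B: "(\<lambda>z. \<beta> (H s z) $ j) differentiable (at z)" if "s \<in> I" for s j
      by (rule differentiableI[OF has_derivative_compose[OF dH diff_\<beta>_nth[OF that, unfolded frechet_derivative_works]]])
    have pdH: "pd (H s) z i $ k = (if k = i then s else 0)" for s k
      using i by (simp add: pd_eq[OF dH] axis_def)
    have dF: "dird F (0, axis i 1) (s, z)
        = \<beta> (H s z) $ i + s * (\<Sum>k\<in>J. w $ k * pd (\<lambda>z. \<beta> z $ i) (H s z) k)" if s: "s \<in> I" for s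
    proof -
      have "dird F (0, axis i 1) (s, z) = pd (\<lambda>z. F (s, z)) z i"
        by (rule dird_snd, rule smooth_on_differentiable[OF smooth_F IS]) (use s z in auto)
      also have "\<dots> = (\<Sum>j\<in>J. pd (\<lambda>z. \<beta> (H s z) $ j * (z $ j - z0 $ j)) z i)"
        unfolding F_def fst_conv snd_conv
        by (rule pd_sum) (rule differentiable_mult[OF B[OF s] differentiable_diff[OF c differentiable_const]])
      also have "\<dots> = (\<Sum>j\<in>J. \<beta> (H s z) $ j * (if j = i then 1 else 0)
          + s * pd \<beta> (H s z) i $ j * (z $ j - z0 $ j))"
      proof (rule sum.cong[OF refl])
        fix j
        have "pd (\<lambda>z. \<beta> (H s z) $ j) z i = s * pd \<beta> (H s z) i $ j"
          by (simp add: pd_chain[OF H' diff_\<beta>_nth[OF s]] pdH pd_nth[OF diff_\<beta>[OF s]] if_distrib[of "\<lambda>x. x * _"] cong: if_cong)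
        then show "pd (\<lambda>z. \<beta> (H s z) $ j * (z $ j - z0 $ j)) z i
          = \<beta> (H s z) $ j * (if j = i then 1 else 0) + s * pd \<beta> (H s z) i $ j * (z $ j - z0 $ j)"
          by (simp add: pd_mult[OF B[OF s] differentiable_diff[OF c differentiable_const]] pd_diff[OF c differentiable_const] pd_const pd_coord)
      qed
      also have "\<dots> = \<beta> (H s z) $ i + (\<Sum>j\<in>J. s * pd \<beta> (H s z) i $ j * (z $ j - z0 $ j))"
        using i by (simp add: sum.distrib if_distrib[of "\<lambda>x. _ * x"] cong: if_cong)
      also have "(\<Sum>j\<in>J. s * pd \<beta> (H s z) i $ j * (z $ j - z0 $ j))
          = s * (\<Sum>k\<in>J. w $ k * pd (\<lambda>z. \<beta> z $ i) (H s z) k)"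
        unfolding sum_distrib_left
      proof (rule sum.cong[OF refl])
        fix j assume j: "j \<in> J"
        show "s * pd \<beta> (H s z) i $ j * (z $ j - z0 $ j) = s * (w $ j * pd (\<lambda>z. \<beta> z $ i) (H s z) j)"
          using closed[OF H_in[OF s z] i j] j by (simp add: w_def pd_nth[OF diff_\<beta>[OF s]])
      qed
      finally show ?thesis .
    qed
    have H_line: "H s z = H 0 z + s *\<^sub>R w" for s
      by (auto simp: H_def w_def vec_eq_iff)
    \<comment> \<open>Closedness has already replaced the derivatives of the components
      \<open>j\<close> in direction \<open>i\<close> by those of the component \<open>i\<close> in
      direction \<open>j\<close>, so the integrand is a total derivative in
      \<open>s\<close>.\<close>
    have "((\<lambda>s. s * \<beta> (H s z) $ i) has_real_derivative dird F (0, axis i 1) (s, z)) (at s)" if s: "s \<in> I" for s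
    proof -
      have "((\<lambda>s. \<beta> (H s z) $ i) has_real_derivative dird (\<lambda>z. \<beta> z $ i) w (H s z)) (at s)"
        using line_derivative[of "\<lambda>z. \<beta> z $ i" "H 0 z" s w] diff_\<beta>_nth[OF s, of i]
        unfolding H_line[symmetric] by blast
      moreover have "dird (\<lambda>z. \<beta> z $ i) w (H s z) = (\<Sum>k\<in>J. w $ k * pd (\<lambda>z. \<beta> z $ i) (H s z) k)"
        unfolding frechet_eq_sum_pd[OF diff_\<beta>_nth[OF s]]
        by (simp, rule sum.mono_neutral_right) (auto simp: w_def)
      ultimately show ?thesis
        unfolding dF[OF s] by (auto intro!: derivative_eq_intros)
    qed
    then have "((\<lambda>s. s * \<beta> (H s z) $ i) has_vector_derivative dird F (0, axis i 1) (s, z)) (at s within {0..1})"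
      if "s \<in> {0..1}" for s
      using that I(2) has_real_derivative_iff_has_vector_derivative has_vector_derivative_at_within by blast
    from fundamental_theorem_of_calculus[OF _ this]
    have "integral {0..1} (\<lambda>s. dird F (0, axis i 1) (s, z)) = 1 * \<beta> (H 1 z) $ i - 0 * \<beta> (H 0 z) $ i"
      by (intro integral_unique) auto
    moreover have "H 1 z = z" by (simp add: H_def vec_eq_iff)
    moreover have "pd y z i = integral {0..1} (\<lambda>s. dird F (0, axis i 1) (s, z))"
      unfolding y_def by (rule pd_eq[OF has_derivative_integral_param[OF I S smooth_onD[OF smooth_F] z]])
    ultimately show ?thesis by simp
  qed
  ultimately show ?thesis unfolding S_def by blast
qed

lemma poincare:
  fixes \<theta> :: "real^'n \<Rightarrow> real^'n"
  assumes U: "open U" "p \<in> U" and \<theta>: "smooth_on \<theta> U"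
    and closed: "\<And>q i j. q \<in> U \<Longrightarrow> pd \<theta> q i $ j = pd \<theta> q j $ i"
  shows "\<exists>V t. open V \<and> p \<in> V \<and> V \<subseteq> U \<and> smooth_on t V \<and> (\<forall>q\<in>V. \<forall>i. pd t q i = \<theta> q $ i)"
proof -
  obtain r where r: "r > 0" "ball p r \<subseteq> U" using U open_contains_ball by blast
  obtain t where "smooth_on t (ball p (r/2))" "\<forall>z\<in>ball p (r/2). \<forall>i\<in>UNIV. pd t z i = \<theta> z $ i"
    using poincare_partial[OF smooth_on_subset[OF \<theta> r(2)], of UNIV] closed r(2) by blast
  moreover have "ball p (r/2) \<subseteq> U" using r by auto
  ultimately show ?thesis using r(1) by (intro exI[of _ "ball p (r/2)"] exI[of _ t]) auto
qed

section \<open>Smooth inverse functions\<close>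

lemma smooth_inverse_function:
  fixes F :: "real^'n \<Rightarrow> real^'n"
  assumes U: "open U" "p \<in> U" and F: "smooth_on F U"
    and inj: "\<And>v. frechet_derivative F (at p) v = 0 \<Longrightarrow> v = 0"
  obtains V W G where "open V" "p \<in> V" "V \<subseteq> U" "open W" "homeomorphism V W F G" "smooth_on G W"
proof -
  define F' where "F' x = Blinfun (frechet_derivative F (at x))" for x
  have dF: "(F has_derivative frechet_derivative F (at x)) (at x)" if "x \<in> U" for x
    using smooth_on_has_derivative[OF F U(1) that] .
  have F': "blinfun_apply (F' x) = frechet_derivative F (at x)" if "x \<in> U" for x
    unfolding F'_def by (rule bounded_linear_Blinfun_apply[OF has_derivative_bounded_linear[OF dF[OF that]]])
  have contF': "continuous_on U F'"
  proof (rule continuous_on_blinfun_componentwise)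
    fix i :: "real^'n"
    show "continuous_on U (\<lambda>x. blinfun_apply (F' x) i)"
      by (rule continuous_on_eq[OF smooth_on_continuous_on[OF smooth_on_dird[OF F]]]) (simp add: F')
  qed
  define L where "L = frechet_derivative F (at p)"
  have linL: "linear L" unfolding L_def using has_derivative_linear[OF dF[OF U(2)]] .
  have injL: "inj L" using linear_injective_0[OF linL] inj unfolding L_def by blast
  obtain L' where L': "linear L'" "\<And>v. L' (L v) = v"
    using linear_injective_isomorphism[OF linL injL] by blast
  have inv: "Blinfun L' o\<^sub>L F' p = id_blinfun"
    by (rule blinfun_eqI)
       (use L' in \<open>simp add: F'[OF U(2)] bounded_linear_Blinfun_apply linear_conv_bounded_linear[symmetric] L_def fun_eq_iff\<close>)
  have dF': "(F has_derivative blinfun_apply (F' x)) (at x)" if "x \<in> U" for x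
    using dF[OF that] F'[OF that] by simp
  have "\<exists>V W G G'. open V \<and> V \<subseteq> U \<and> p \<in> V \<and> open W \<and> homeomorphism V W F G \<and>
      (\<forall>y\<in>W. (G has_derivative G' y) (at y) \<and> G' y = inv (blinfun_apply (F' (G y))) \<and> bij (blinfun_apply (F' (G y))))"
  proof (rule inverse_function_theorem[OF U(1) dF' contF' U(2) inv], goal_cases)
    case (2 V W G G')
    then show ?case
      by (intro exI[of _ V] exI[of _ W] exI[of _ G] exI[of _ G'] conjI ballI 2)
  qed auto
  then obtain V W G G' where VW: "open V" "V \<subseteq> U" "p \<in> V" "open W" "homeomorphism V W F G"
    and dG: "\<And>y. y \<in> W \<Longrightarrow> (G has_derivative G' y) (at y)"
    and G': "\<And>y. y \<in> W \<Longrightarrow> G' y = inv (blinfun_apply (F' (G y)))"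
    and bij: "\<And>y. y \<in> W \<Longrightarrow> bij (blinfun_apply (F' (G y)))"
    by blast
  have GV: "G ` W \<subseteq> V" using VW(5) by (auto simp: homeomorphism_def)
  then have GU: "G y \<in> U" if "y \<in> W" for y using that VW(2) by blast
  \<comment> \<open>Bootstrap: the derivative of \<open>G\<close> at \<open>y\<close> solves a
    linear system whose matrix is the Jacobian of \<open>F\<close> at \<open>G y\<close>. If
    \<open>G\<close> is of class k, so is this matrix, hence also the solution, and \<open>G\<close>
    gains one order.\<close>
  have "Ck_on k G W" for k
  proof (induction k)
    case 0
    then show ?case using VW(5) by (simp add: homeomorphism_def)
  next
    case (Suc k)
    show ?case
    proof (rule Ck_on_Suc[OF VW(4) dG])
      fix v
      define M where "M y = matrix (frechet_derivative F (at (G y)))" for y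
      have lin: "linear (frechet_derivative F (at (G y)))" if "y \<in> W" for y
        using has_derivative_linear[OF dF[OF GU[OF that]]] .
      show "Ck_on k (\<lambda>y. G' y v) W"
      proof (rule Ck_on_matrix_solution[OF VW(4), of k M])
        fix i j
        have "Ck_on k (\<lambda>y. pd F (G y) j $ i) W"
          by (rule Ck_on_compose[OF VW(4) U(1) _ smooth_onD[OF smooth_on_vec_nth[OF U(1) smooth_on_pd[OF F]]] Suc])
             (use GU in auto)
        then show "Ck_on k (\<lambda>y. M y $ i $ j) W" by (simp add: M_def matrix_def pd_def)
      next
        fix y assume y: "y \<in> W"
        have b: "bij (frechet_derivative F (at (G y)))" using bij[OF y] F'[OF GU[OF y]] by simp
        have MF: "(*v) (M y) = frechet_derivative F (at (G y))"
          unfolding M_def using matrix_works[OF lin[OF y, folded linear_matrix_vector_mul_eq]] by auto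
        show "det (M y) \<noteq> 0"
          unfolding invertible_det_nz[symmetric] invertible_eq_bij MF by (rule b)
        show "M y *v G' y v = v"
          unfolding MF G'[OF y] F'[OF GU[OF y]] by (rule surj_f_inv_f[OF bij_is_surj[OF b]])
      qed
    qed auto
  qed
  then show ?thesis using that VW smooth_onI by blast
qed

section \<open>Change of coordinates and primitives along the leaves of a function\<close>

lemma pd_homeomorphism_inverse:
  fixes F :: "real^'n \<Rightarrow> real^'n"
  assumes VW: "open V" "open W" "homeomorphism V W F G" and F: "smooth_on F V" and G: "smooth_on G W"
    and q: "q \<in> V"
  shows "(\<Sum>k\<in>UNIV. pd F q i $ k * pd G (F q) k $ m) = (if m = i then 1 else 0)"
proof -
  have Fq: "F q \<in> W" using VW q by (auto simp: homeomorphism_def)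
  have dF: "F differentiable (at q)" by (rule smooth_on_differentiable[OF F VW(1) q])
  have dG: "G differentiable (at (F q))" by (rule smooth_on_differentiable[OF G VW(2) Fq])
  have dGm: "(\<lambda>z. G z $ m) differentiable (at (F q))"
    by (rule smooth_on_differentiable[OF smooth_on_vec_nth[OF VW(2) G] VW(2) Fq])
  have "(if m = i then 1 else 0) = pd (\<lambda>z. z $ m) q i" by (simp add: pd_coord)
  also have "\<dots> = pd (\<lambda>z. G (F z) $ m) q i"
    by (rule pd_cong[OF VW(1) q bounded_linear_imp_differentiable[OF bounded_linear_vec_nth]])
       (use VW(3) in \<open>simp add: homeomorphism_def\<close>)
  also have "\<dots> = (\<Sum>k\<in>UNIV. pd F q i $ k * pd (\<lambda>z. G z $ m) (F q) k)"
    by (simp add: pd_chain[OF dF dGm])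
  finally show ?thesis by (simp add: pd_nth[OF dG])
qed

text \<open>The two-form \<tau> wedge \<gamma> vanishes on any pair of vectors in the kernel of
  \<tau>, and the coordinate directions \<open>k\<close> and \<open>j\<close> are mapped there by
  \<open>G\<close>. The second derivatives of \<open>G\<close> cancel by symmetry.\<close>

lemma pullback_closed:
  fixes G :: "real^'n \<Rightarrow> real^'n" and \<beta> \<tau> \<gamma> :: "real^'n \<Rightarrow> real^'n"
  assumes W: "open W" "z \<in> W" and G: "smooth_on G W" "G ` W \<subseteq> U" and U: "open U"
    and \<beta>: "smooth_on \<beta> U"
    and d\<beta>: "\<And>i j. pd \<beta> (G z) i $ j - pd \<beta> (G z) j $ i = \<tau> (G z) $ i * \<gamma> (G z) $ j - \<tau> (G z) $ j * \<gamma> (G z) $ i"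
    and k: "(\<Sum>l\<in>UNIV. \<tau> (G z) $ l * pd G z k $ l) = 0"
    and j: "(\<Sum>l\<in>UNIV. \<tau> (G z) $ l * pd G z j $ l) = 0"
  defines "\<beta>' \<equiv> \<lambda>z. \<chi> j. \<Sum>i\<in>UNIV. \<beta> (G z) $ i * pd G z j $ i"
  shows "pd \<beta>' z k $ j = pd \<beta>' z j $ k"
proof -
  have Gz: "G z \<in> U" using W G by auto
  have dG: "G differentiable (at z)" by (rule smooth_on_differentiable[OF G(1) W])
  have sB: "smooth_on (\<lambda>z. \<beta> (G z) $ i) W" for i
    by (rule smooth_on_vec_nth[OF W(1) smooth_on_compose[OF \<beta> W(1) U G(2,1)]])
  have sG: "smooth_on (\<lambda>z. pd G z j $ i) W" for i j
    by (rule smooth_on_vec_nth[OF W(1) smooth_on_pd[OF G(1)]])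
  have s': "smooth_on \<beta>' W"
    unfolding \<beta>'_def by (intro smooth_on_vec_lambda smooth_on_sum smooth_on_mult W(1) sB sG)
  have dBi: "(\<lambda>z. \<beta> z $ i) differentiable (at (G z))" for i
    by (rule smooth_on_differentiable[OF smooth_on_vec_nth[OF U \<beta>] U Gz])
  have d\<beta>z: "\<beta> differentiable (at (G z))" by (rule smooth_on_differentiable[OF \<beta> U Gz])
  have second: "pd (\<lambda>z. pd G z j $ i) z k = pd (\<lambda>z. pd G z k $ i) z j" for i j k
  proof -
    have "pd (\<lambda>z. pd G z j $ i) z k = pd (\<lambda>z. pd (\<lambda>z. G z $ i) z j) z k" for j k
      by (rule pd_cong[OF W smooth_on_differentiable[OF sG W]])
         (simp add: pd_nth[OF smooth_on_differentiable[OF G(1) W(1)]])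
    then show ?thesis
      using pd_commute[OF smooth_on_vec_nth[OF W(1) G(1)] W, of i j k] by simp
  qed
  have "pd \<beta>' z k $ j = (\<Sum>i\<in>UNIV. \<beta> (G z) $ i * pd (\<lambda>z. pd G z j $ i) z k)
      + (\<Sum>i\<in>UNIV. \<Sum>l\<in>UNIV. pd G z k $ l * pd \<beta> (G z) l $ i * pd G z j $ i)" for k j
  proof -
    have "pd \<beta>' z k $ j = pd (\<lambda>z. \<Sum>i\<in>UNIV. \<beta> (G z) $ i * pd G z j $ i) z k"
      using pd_nth[OF smooth_on_differentiable[OF s' W], of j k] by (simp add: \<beta>'_def)
    also have "\<dots> = (\<Sum>i\<in>UNIV. pd (\<lambda>z. \<beta> (G z) $ i * pd G z j $ i) z k)"
      by (rule pd_sum) (rule smooth_on_differentiable[OF smooth_on_mult[OF W(1) sB sG] W])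
    also have "\<dots> = (\<Sum>i\<in>UNIV. \<beta> (G z) $ i * pd (\<lambda>z. pd G z j $ i) z k
        + (\<Sum>l\<in>UNIV. pd G z k $ l * pd \<beta> (G z) l $ i) * pd G z j $ i)"
      by (simp add: pd_mult[OF smooth_on_differentiable[OF sB W] smooth_on_differentiable[OF sG W]]
          pd_chain[OF dG dBi] pd_nth[OF d\<beta>z])
    finally show ?thesis by (simp add: sum.distrib sum_distrib_right)
  qed
  note expand = this
  have "(\<Sum>i\<in>UNIV. \<Sum>l\<in>UNIV. pd G z k $ l * pd \<beta> (G z) l $ i * pd G z j $ i)
      - (\<Sum>i\<in>UNIV. \<Sum>l\<in>UNIV. pd G z j $ l * pd \<beta> (G z) l $ i * pd G z k $ i)
      = (\<Sum>i\<in>UNIV. \<Sum>l\<in>UNIV. pd G z k $ l * pd G z j $ i * (pd \<beta> (G z) l $ i - pd \<beta> (G z) i $ l))"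
    by (subst (2) sum.swap) (simp add: sum_subtractf[symmetric] algebra_simps)
  also have "\<dots> = (\<Sum>i\<in>UNIV. \<Sum>l\<in>UNIV. (\<tau> (G z) $ l * pd G z k $ l) * (\<gamma> (G z) $ i * pd G z j $ i))
      - (\<Sum>i\<in>UNIV. \<Sum>l\<in>UNIV. (\<tau> (G z) $ i * pd G z j $ i) * (\<gamma> (G z) $ l * pd G z k $ l))"
    unfolding d\<beta> by (simp add: sum_subtractf[symmetric] algebra_simps)
  also have "\<dots> = (\<Sum>l\<in>UNIV. \<tau> (G z) $ l * pd G z k $ l) * (\<Sum>i\<in>UNIV. \<gamma> (G z) $ i * pd G z j $ i)
      - (\<Sum>i\<in>UNIV. \<tau> (G z) $ i * pd G z j $ i) * (\<Sum>l\<in>UNIV. \<gamma> (G z) $ l * pd G z k $ l)"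
    by (subst sum.swap) (simp add: sum_product)
  also have "\<dots> = 0" using k j by simp
  finally show ?thesis
    unfolding expand[of k j] expand[of j k] using second[of j _ k] by simp
qed

text \<open>Replacing the coordinate \<open>a\<close> by \<open>t\<close> turns the leaves of
  \<open>t\<close> into coordinate slices. There \<beta> is closed, and the partial Poincare lemma
  with \<open>a\<close> as parameter gives \<open>y\<close>; transversally to the leaves nothing is
  prescribed, which is the term with \<open>s\<close>.\<close>

lemma poincare_foliated:
  fixes t :: "real^'n \<Rightarrow> real" and \<beta> \<gamma> :: "real^'n \<Rightarrow> real^'n"
  assumes U: "open U" "p \<in> U" and t: "smooth_on t U" and \<beta>: "smooth_on \<beta> U" and a: "pd t p a \<noteq> 0"
    and d\<beta>: "\<And>q i j. q \<in> U \<Longrightarrow>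
      pd \<beta> q i $ j - pd \<beta> q j $ i = pd t q i * \<gamma> q $ j - pd t q j * \<gamma> q $ i"
  shows "\<exists>V y s. open V \<and> p \<in> V \<and> V \<subseteq> U \<and> smooth_on y V \<and> smooth_on s V \<and>
    (\<forall>q\<in>V. \<forall>i. pd y q i = \<beta> q $ i + s q * pd t q i)"
proof -
  define F where "F q = (\<chi> i. if i = a then t q else q $ i)" for q
  have sF: "smooth_on F U"
  proof (rule smooth_on_vecI[OF U(1)])
    show "smooth_on (\<lambda>q. F q $ i) U" for i
      by (cases "i = a") (simp_all add: F_def t smooth_on_bounded_linear[OF bounded_linear_vec_nth U(1)])
  qed
  have pdF: "pd F q i $ k = (if k = a then pd t q i else if k = i then 1 else 0)" if "q \<in> U" for q i k
    by (simp add: pd_nth[OF smooth_on_differentiable[OF sF U(1) that], symmetric] F_def pd_coord)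
  have "v = 0" if v: "frechet_derivative F (at p) v = 0" for v
  proof -
    have *: "(\<Sum>i\<in>UNIV. v $ i * pd F p i $ k) = 0" for k
      using arg_cong[OF v, of "\<lambda>w. w $ k"]
      by (simp add: frechet_eq_sum_pd[OF smooth_on_differentiable[OF sF U]])
    have "v $ k = 0" if "k \<noteq> a" for k
      using *[of k] that by (simp add: pdF[OF U(2)] if_distrib[of "\<lambda>x. _ * x"] cong: if_cong)
    moreover from this have "v $ a * pd t p a = 0"
      using *[of a] by (simp add: pdF[OF U(2)] sum.remove[of UNIV a])
    ultimately show ?thesis using a by (metis mult_eq_0_iff vec_eq_iff zero_index)
  qed
  then obtain V W G where VW: "open V" "p \<in> V" "V \<subseteq> U" "open W" "homeomorphism V W F G"
    and G: "smooth_on G W"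
    using smooth_inverse_function[OF U sF] by blast
  have GV: "G ` W \<subseteq> V" and GU: "G ` W \<subseteq> U" and FG: "\<And>z. z \<in> W \<Longrightarrow> F (G z) = z"
    and FV: "\<And>q. q \<in> V \<Longrightarrow> F q \<in> W" and GF: "\<And>q. q \<in> V \<Longrightarrow> G (F q) = q"
    using VW(3,5) by (auto simp: homeomorphism_def)
  define \<beta>' where "\<beta>' z = (\<chi> j. \<Sum>i\<in>UNIV. \<beta> (G z) $ i * pd G z j $ i)" for z
  have s': "smooth_on \<beta>' W"
    unfolding \<beta>'_def
    by (intro smooth_on_vec_lambda smooth_on_sum smooth_on_mult smooth_on_vec_nth VW(4)
        smooth_on_compose[OF \<beta> VW(4) U(1) GU G] smooth_on_pd G)
  obtain r where r: "r > 0" "ball (F p) r \<subseteq> W"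
    using VW(2,4) FV open_contains_ball by blast
  have closed': "pd \<beta>' z k $ j = pd \<beta>' z j $ k" if z: "z \<in> ball (F p) r" and kj: "k \<in> - {a}" "j \<in> - {a}" for z k j
  proof -
    have zW: "z \<in> W" using z r(2) by blast
    then have GzU: "G z \<in> U" using GU by blast
    have 0: "(\<Sum>l\<in>UNIV. pd t (G z) l * pd G z k $ l) = 0" if "k \<noteq> a" for k
    proof -
      have "(\<Sum>l\<in>UNIV. pd G z k $ l * pd F (G z) l $ a) = (if a = k then 1 else 0)"
        using pd_homeomorphism_inverse[OF VW(4,1) homeomorphism_symD[OF VW(5)] G
            smooth_on_subset[OF sF VW(3)] zW, of k a] .
      then show ?thesis using that by (simp add: pdF[OF GzU] mult.commute)
    qed
    show ?thesis
      unfolding \<beta>'_def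
      by (rule pullback_closed[OF VW(4) zW G GU U(1) \<beta>, of "\<lambda>q. \<chi> i. pd t q i" \<gamma>])
         (use d\<beta>[OF GzU] 0 kj in auto)
  qed
  have "\<exists>y. smooth_on y (ball (F p) (r/2)) \<and> (\<forall>z\<in>ball (F p) (r/2). \<forall>i\<in>- {a}. pd y z i = \<beta>' z $ i)"
    by (rule poincare_partial[OF smooth_on_subset[OF s' r(2)] closed'])
  then obtain y' where y': "smooth_on y' (ball (F p) (r/2))"
    and dy': "\<And>z i. z \<in> ball (F p) (r/2) \<Longrightarrow> i \<noteq> a \<Longrightarrow> pd y' z i = \<beta>' z $ i" by auto
  define V' where "V' = V \<inter> F -` ball (F p) (r/2)"
  have V': "open V'" "p \<in> V'" "V' \<subseteq> V" "V' \<subseteq> U" "F ` V' \<subseteq> ball (F p) (r/2)" "F ` V' \<subseteq> W"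
    using continuous_open_preimage[OF smooth_on_continuous_on[OF smooth_on_subset[OF sF VW(3)]] VW(1) open_ball]
      VW(2,3) r(1) FV by (auto simp: V'_def)
  have sF': "smooth_on F V'" by (rule smooth_on_subset[OF sF V'(4)])
  define y where "y q = y' (F q)" for q
  \<comment> \<open>The mismatch in the one direction that the partial Poincare lemma leaves free.
    Since the component \<open>a\<close> of \<open>F\<close> is \<open>t\<close>, pulling it back
    yields a multiple of the differential of \<open>t\<close>.\<close>
  define s where "s q = pd y' (F q) a - \<beta>' (F q) $ a" for q
  have "smooth_on y V'"
    unfolding y_def by (rule smooth_on_compose[OF y' V'(1) open_ball V'(5) sF'])
  moreover have "smooth_on s V'"
    unfolding s_def
    by (rule smooth_on_diff[OF V'(1) smooth_on_compose[OF smooth_on_pd[OF y'] V'(1) open_ball V'(5) sF']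
          smooth_on_vec_nth[OF V'(1) smooth_on_compose[OF s' V'(1) VW(4) V'(6) sF']]])
  moreover have "pd y q i = \<beta> q $ i + s q * pd t q i" if q: "q \<in> V'" for q i
  proof -
    have qV: "q \<in> V" and qU: "q \<in> U" and Fq: "F q \<in> ball (F p) (r/2)" using q V' by auto
    have "pd y q i = (\<Sum>k\<in>UNIV. pd F q i $ k * pd y' (F q) k)"
      unfolding y_def
      by (simp add: pd_chain[OF smooth_on_differentiable[OF sF U(1) qU] smooth_on_differentiable[OF y' open_ball Fq]])
    also have "\<dots> = (\<Sum>k\<in>UNIV. pd F q i $ k * \<beta>' (F q) $ k + (if k = a then pd F q i $ a * s q else 0))"
      by (rule sum.cong) (auto simp: s_def dy'[OF Fq] algebra_simps)
    also have "\<dots> = (\<Sum>k\<in>UNIV. \<Sum>m\<in>UNIV. \<beta> q $ m * (pd F q i $ k * pd G (F q) k $ m)) + pd t q i * s q"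
      by (simp add: sum.distrib \<beta>'_def GF[OF qV] pdF[OF qU, of i a] sum_distrib_left mult.left_commute)
    also have "(\<Sum>k\<in>UNIV. \<Sum>m\<in>UNIV. \<beta> q $ m * (pd F q i $ k * pd G (F q) k $ m)) = \<beta> q $ i"
      by (subst sum.swap)
         (simp add: sum_distrib_left[symmetric] if_distrib[of "\<lambda>x. _ * x"] cong: if_cong
            pd_homeomorphism_inverse[OF VW(1,4,5) smooth_on_subset[OF sF VW(3)] G qV])
    finally show ?thesis by simp
  qed
  ultimately show ?thesis using V' by blast
qed

section \<open>Normal form of a coframe on the orbit space\<close>

text \<open>A fourth coordinate, linear with differential \<open>\<kappa>\<close>, completes \<open>\<pi>\<close> to a chart; \<open>N\<close> is the
  preimage of a box, so the fibres of \<open>\<pi>\<close> are segments and functions constant on them descend.\<close>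

lemma submersion_chart:
  fixes \<pi> :: "real^4 \<Rightarrow> real^3" and \<kappa> :: "real^4"
  assumes U: "open U" "p \<in> U" and \<pi>: "smooth_on \<pi> U"
    and inj: "\<And>v. frechet_derivative \<pi> (at p) v = 0 \<Longrightarrow> \<kappa> \<bullet> v = 0 \<Longrightarrow> v = 0"
  shows "\<exists>N. open N \<and> p \<in> N \<and> N \<subseteq> U \<and> open (\<pi> ` N) \<and>
    (\<forall>q\<in>N. surj (frechet_derivative \<pi> (at q))) \<and> (\<forall>z. connected {q\<in>N. \<pi> q = z}) \<and>
    (\<forall>f. smooth_on f U \<longrightarrow> (\<forall>q\<in>N. \<exists>c. \<forall>i. pd f q i = (\<Sum>k\<in>UNIV. c k * pd \<pi> q i $ k)) \<longrightarrow>
      (\<exists>f'::real^3 \<Rightarrow> real. smooth_on f' (\<pi> ` N) \<and> (\<forall>q\<in>N. f' (\<pi> q) = f q)))"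
proof -
  \<comment> \<open>The index types are unrelated; \<open>e\<close> and \<open>e'\<close> match the
    three base coordinates with the first three of the chart, and index 4 is the fibre
    coordinate.\<close>
  define e :: "3 \<Rightarrow> 4" where "e i = (if i = 1 then 1 else if i = 2 then 2 else 3)" for i
  define e' :: "4 \<Rightarrow> 3" where "e' i = (if i = 1 then 1 else if i = 2 then 2 else 3)" for i
  have e: "\<forall>i. e' (e i) = i" "\<forall>i. e i \<noteq> 4" "\<forall>i. i \<noteq> 4 \<longrightarrow> e (e' i) = i"
    unfolding forall_3 forall_4 e_def e'_def by simp_all
  define F where "F q = (\<chi> i. if i = 4 then \<kappa> \<bullet> q else \<pi> q $ e' i)" for q
  define pr :: "real^4 \<Rightarrow> real^3" where "pr z = (\<chi> i. z $ e i)" for z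
  have prF: "pr (F q) = \<pi> q" for q by (simp add: pr_def F_def e vec_eq_iff)
  have sF: "smooth_on F U"
  proof (rule smooth_on_vecI[OF U(1)])
    show "smooth_on (\<lambda>q. F q $ i) U" for i
      by (cases "i = 4") (simp_all add: F_def smooth_on_vec_nth[OF U(1) \<pi>]
          smooth_on_bounded_linear[OF bounded_linear_inner_right U(1)])
  qed
  have d\<pi>: "\<pi> differentiable (at q)" if "q \<in> U" for q by (rule smooth_on_differentiable[OF \<pi> U(1) that])
  have dF: "F differentiable (at q)" if "q \<in> U" for q by (rule smooth_on_differentiable[OF sF U(1) that])
  have pdF: "pd F q i $ e k = pd \<pi> q i $ k" if "q \<in> U" for q i k
    unfolding pd_nth[OF dF[OF that], symmetric] pd_nth[OF d\<pi>[OF that], symmetric]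
    by (simp add: F_def e)
  have "v = 0" if v: "frechet_derivative F (at p) v = 0" for v
  proof (rule inj)
    have "frechet_derivative \<pi> (at p) v $ k = frechet_derivative F (at p) v $ e k" for k
      by (simp add: frechet_eq_sum_pd[OF d\<pi>[OF U(2)]] frechet_eq_sum_pd[OF dF[OF U(2)]] pdF[OF U(2)])
    then show "frechet_derivative \<pi> (at p) v = 0" by (simp add: vec_eq_iff v)
    have "((\<lambda>q. F q $ 4) has_derivative (\<lambda>v. frechet_derivative F (at p) v $ 4)) (at p)"
      by (rule bounded_linear.has_derivative[OF bounded_linear_vec_nth smooth_on_has_derivative[OF sF U]])
    moreover have "(\<lambda>q. F q $ 4) = (\<lambda>q. \<kappa> \<bullet> q)" by (simp add: F_def)
    ultimately have "(\<lambda>v. frechet_derivative F (at p) v $ 4) = (\<lambda>v. \<kappa> \<bullet> v)"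
      using has_derivative_unique bounded_linear_imp_has_derivative[OF bounded_linear_inner_right] by metis
    then show "\<kappa> \<bullet> v = 0" using v by (metis zero_index)
  qed
  then obtain V W G where VW: "open V" "p \<in> V" "V \<subseteq> U" "open W" "homeomorphism V W F G"
    and G: "smooth_on G W"
    using smooth_inverse_function[OF U sF] by blast
  have GV: "\<And>z. z \<in> W \<Longrightarrow> G z \<in> V" and FG: "\<And>z. z \<in> W \<Longrightarrow> F (G z) = z"
    and FV: "\<And>q. q \<in> V \<Longrightarrow> F q \<in> W" and GF: "\<And>q. q \<in> V \<Longrightarrow> G (F q) = q"
    using VW(5) by (auto simp: homeomorphism_def)
  obtain a b where ab: "cbox a b \<subseteq> W" "F p \<in> box a b"
    by (rule open_contains_cbox[OF VW(4) FV[OF VW(2)]])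
  have BW: "box a b \<subseteq> W" using ab(1) box_subset_cbox by blast
  define N where "N = V \<inter> F -` box a b"
  have sFV: "smooth_on F V" by (rule smooth_on_subset[OF sF VW(3)])
  have N: "open N" "p \<in> N" "N \<subseteq> V" "N \<subseteq> U"
    using continuous_open_preimage[OF smooth_on_continuous_on[OF sFV] VW(1) open_box] VW(2,3) ab(2)
    by (auto simp: N_def)
  have GN: "G z \<in> N" if "z \<in> box a b" for z
    using that BW GV FG by (auto simp: N_def)
  \<comment> \<open>A section of the projection: the fibre coordinate is frozen at its value at
    \<open>p\<close>, which is admissible over every base point because the domain is a box.\<close>
  define ins :: "real^3 \<Rightarrow> real^4" where "ins \<zeta> = (\<chi> i. if i = 4 then F p $ 4 else \<zeta> $ e' i)" for \<zeta>
  have pr_ins: "pr (ins \<zeta>) = \<zeta>" for \<zeta> by (simp add: pr_def ins_def e vec_eq_iff)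
  have ins_box: "ins \<zeta> \<in> box a b" if "\<zeta> \<in> box (pr a) (pr b)" for \<zeta>
    unfolding mem_box_cart
  proof
    fix i
    show "a $ i < ins \<zeta> $ i \<and> ins \<zeta> $ i < b $ i"
    proof (cases "i = 4")
      case True
      then show ?thesis using ab(2) by (simp add: ins_def mem_box_cart)
    next
      case False
      then have "e (e' i) = i" using e by blast
      then show ?thesis using False that by (auto simp: ins_def mem_box_cart pr_def) (metis)+
    qed
  qed
  have pr_box: "pr z \<in> box (pr a) (pr b)" if "z \<in> box a b" for z
    using that by (simp add: pr_def mem_box_cart)
  have \<pi>N: "\<pi> ` N = box (pr a) (pr b)"
  proof
    show "\<pi> ` N \<subseteq> box (pr a) (pr b)"
      using pr_box by (auto simp: N_def prF[symmetric])
    show "box (pr a) (pr b) \<subseteq> \<pi> ` N"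
    proof
      fix \<zeta> assume \<zeta>: "\<zeta> \<in> box (pr a) (pr b)"
      have "\<pi> (G (ins \<zeta>)) = \<zeta>"
        using FG[of "ins \<zeta>"] ins_box[OF \<zeta>] BW by (auto simp: prF[symmetric] pr_ins)
      then show "\<zeta> \<in> \<pi> ` N" using GN[OF ins_box[OF \<zeta>]] by force
    qed
  qed
  have inv: "(\<Sum>i\<in>UNIV. pd G z l $ i * pd \<pi> (G z) i $ k) = (if e k = l then 1 else 0)" if "z \<in> W" for z l k
    using pd_homeomorphism_inverse[OF VW(4,1) homeomorphism_symD[OF VW(5)] G sFV that, of l "e k"]
      GV[OF that] VW(3) by (auto simp: pdF)
  show ?thesis
  proof (intro exI[of _ N] conjI ballI allI impI N(1,2,4))
    show "open (\<pi> ` N)" unfolding \<pi>N by (rule open_box)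
    show "surj (frechet_derivative \<pi> (at q))" if q: "q \<in> N" for q
    proof (rule surjI)
      fix w :: "real^3"
      have z: "F q \<in> W" "G (F q) = q" "q \<in> U" using q N FV GF by auto
      have "frechet_derivative \<pi> (at q) (\<Sum>k\<in>UNIV. w $ k *\<^sub>R pd G (F q) (e k)) $ j = w $ j" for j
      proof -
        have "frechet_derivative \<pi> (at q) (\<Sum>k\<in>UNIV. w $ k *\<^sub>R pd G (F q) (e k)) $ j
          = (\<Sum>k\<in>UNIV. w $ k * (\<Sum>i\<in>UNIV. pd G (F q) (e k) $ i * pd \<pi> (G (F q)) i $ j))"
          by (simp add: frechet_eq_sum_pd[OF d\<pi>[OF z(3)]] z(2) sum_distrib_left sum_distrib_right mult.assoc)
             (rule sum.swap)
        also have "\<dots> = (\<Sum>k\<in>UNIV. w $ k * (if k = j then 1 else 0))"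
          unfolding inv[OF z(1)] by (rule sum.cong[OF refl]) (metis e(1))
        finally show ?thesis by (simp add: if_distrib[of "\<lambda>x. _ * x"] cong: if_cong)
      qed
      then show "frechet_derivative \<pi> (at q) (\<Sum>k\<in>UNIV. w $ k *\<^sub>R pd G (F q) (e k)) = w"
        by (simp add: vec_eq_iff)
    qed
    show "connected {q\<in>N. \<pi> q = z}" for z
    proof -
      have "{q\<in>N. \<pi> q = z} = G ` (box a b \<inter> {\<zeta>. \<forall>i. \<zeta> $ e i = z $ i})"
      proof (intro set_eqI iffI)
        fix q assume "q \<in> {q\<in>N. \<pi> q = z}"
        then have "q \<in> V" "F q \<in> box a b" "pr (F q) = z" by (auto simp: N_def prF)
        then show "q \<in> G ` (box a b \<inter> {\<zeta>. \<forall>i. \<zeta> $ e i = z $ i})"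
          using GF[of q] by (intro image_eqI[of _ _ "F q"]) (auto simp: pr_def vec_eq_iff)
      next
        fix q assume "q \<in> G ` (box a b \<inter> {\<zeta>. \<forall>i. \<zeta> $ e i = z $ i})"
        then obtain \<zeta> where \<zeta>: "\<zeta> \<in> box a b" "\<forall>i. \<zeta> $ e i = z $ i" "q = G \<zeta>" by blast
        have "\<pi> q = z"
        proof -
          have "F q = \<zeta>" unfolding \<zeta>(3) by (rule FG) (use \<zeta>(1) BW in blast)
          then show ?thesis using \<zeta>(2) by (simp add: prF[symmetric] pr_def vec_eq_iff)
        qed
        then show "q \<in> {q\<in>N. \<pi> q = z}" using GN \<zeta> by blast
      qed
      moreover have "convex (box a b \<inter> {\<zeta>::real^4. \<forall>i. \<zeta> $ e i = z $ i})"
        by (intro convex_Int convex_box) (auto simp: convex_def ring_distribs(2)[symmetric])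
      moreover have "continuous_on (box a b \<inter> {\<zeta>. \<forall>i. \<zeta> $ e i = z $ i}) G"
        by (rule continuous_on_subset[OF smooth_on_continuous_on[OF G]]) (use BW in blast)
      ultimately show ?thesis
        by (simp add: connected_continuous_image convex_connected)
    qed
    show "\<exists>f'. smooth_on f' (\<pi> ` N) \<and> (\<forall>q\<in>N. f' (\<pi> q) = f q)"
      if f: "smooth_on f U" and df: "\<forall>q\<in>N. \<exists>c. \<forall>i. pd f q i = (\<Sum>k\<in>UNIV. c k * pd \<pi> q i $ k)" for f :: "real^4 \<Rightarrow> real"
    proof (intro exI[of _ "\<lambda>\<zeta>. f (G (ins \<zeta>))"] conjI ballI)
      have GU: "G ` W \<subseteq> U" using GV VW(3) by auto
      have fG: "smooth_on (\<lambda>z. f (G z)) W"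
        by (rule smooth_on_compose[OF f VW(4) U(1) GU G])
      have "smooth_on ins (box (pr a) (pr b))"
      proof (rule smooth_on_vecI[OF open_box])
        show "smooth_on (\<lambda>\<zeta>. ins \<zeta> $ i) (box (pr a) (pr b))" for i
          by (cases "i = 4") (simp_all add: ins_def smooth_on_const smooth_on_bounded_linear[OF bounded_linear_vec_nth open_box])
      qed
      then show "smooth_on (\<lambda>\<zeta>. f (G (ins \<zeta>))) (\<pi> ` N)"
        unfolding \<pi>N by (intro smooth_on_compose[OF fG open_box VW(4)]) (use ins_box BW in auto)
      fix q assume q: "q \<in> N"
      have zB: "F q \<in> box a b" and GFq: "G (F q) = q" using q GF by (auto simp: N_def)
      \<comment> \<open>Along the fibre direction of the chart \<pi> does not change, so by
        hypothesis neither does \<open>f\<close> to first order.\<close>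
      have d0: "pd (\<lambda>z. f (G z)) z 4 = 0" if z: "z \<in> box a b" for z
      proof -
        have zW: "z \<in> W" using z BW by blast
        obtain c where c: "\<And>i. pd f (G z) i = (\<Sum>k\<in>UNIV. c k * pd \<pi> (G z) i $ k)"
          using df GN[OF z] by blast
        have "pd (\<lambda>z. f (G z)) z 4 = (\<Sum>i\<in>UNIV. pd G z 4 $ i * pd f (G z) i)"
          using pd_chain[OF smooth_on_differentiable[OF G VW(4) zW] smooth_on_differentiable[OF f U(1)], of 4] GU zW
          by auto
        also have "\<dots> = (\<Sum>k\<in>UNIV. c k * (\<Sum>i\<in>UNIV. pd G z 4 $ i * pd \<pi> (G z) i $ k))"
          unfolding c sum_distrib_left by (subst sum.swap) (simp add: mult.left_commute)
        also have "\<dots> = 0" unfolding inv[OF zW] using e(2) by simp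
        finally show ?thesis .
      qed
      \<comment> \<open>The parameters for which the line along the fibre stays in the box form an
        interval, so a vanishing derivative makes \<open>f\<close> constant on it; it joins
        \<open>q\<close> to the point of the section.\<close>
      define I where "I = {s. F q + s *\<^sub>R axis 4 1 \<in> box a b}"
      have "convex I" unfolding I_def
      proof (rule convexI, unfold mem_Collect_eq)
        fix s t u v :: real
        assume st: "F q + s *\<^sub>R axis 4 1 \<in> box a b" "F q + t *\<^sub>R axis 4 1 \<in> box a b" and uv: "0 \<le> u" "0 \<le> v" "u + v = 1"
        have "u *\<^sub>R (F q + s *\<^sub>R axis 4 1) + v *\<^sub>R (F q + t *\<^sub>R axis 4 1) \<in> box a b"
          by (rule convexD[OF convex_box(2) st uv])
        moreover have "u *\<^sub>R (F q + s *\<^sub>R axis 4 1) + v *\<^sub>R (F q + t *\<^sub>R axis 4 1)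
          = (u + v) *\<^sub>R F q + (u * s + v * t) *\<^sub>R axis 4 1"
          by (simp add: algebra_simps)
        ultimately show "F q + (u *\<^sub>R s + v *\<^sub>R t) *\<^sub>R axis 4 1 \<in> box a b"
          using uv by simp
      qed
      moreover have "((\<lambda>s. f (G (F q + s *\<^sub>R axis 4 1))) has_real_derivative 0) (at s within I)" if "s \<in> I" for s
      proof -
        have B: "F q + s *\<^sub>R axis 4 1 \<in> box a b" using that by (simp add: I_def)
        then have "(\<lambda>z. f (G z)) differentiable (at (F q + s *\<^sub>R axis 4 1))"
          using smooth_on_differentiable[OF fG VW(4)] BW by blast
        from line_derivative[OF this] d0[OF B] show ?thesis
          by (simp add: pd_def has_field_derivative_at_within)
      qed
      ultimately obtain c where c: "\<And>s. s \<in> I \<Longrightarrow> f (G (F q + s *\<^sub>R axis 4 1)) = c"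
        using has_field_derivative_zero_constant[of I "\<lambda>s. f (G (F q + s *\<^sub>R axis 4 1))"] by blast
      have ins: "ins (\<pi> q) = F q + (F p $ 4 - F q $ 4) *\<^sub>R axis 4 1"
        by (auto simp: ins_def F_def axis_def vec_eq_iff)
      have "ins (\<pi> q) \<in> box a b" using ins_box pr_box[OF zB] by (simp add: prF)
      then show "f (G (ins (\<pi> q))) = f q"
        using c[of "F p $ 4 - F q $ 4"] c[of 0] zB GFq unfolding ins I_def by simp
    qed
  qed
qed

section \<open>Coframes and the construction of the coordinates\<close>

lemma wedge_eq_zero:
  fixes a b :: "real^'n"
  assumes "\<And>i j. a $ i * b $ j = a $ j * b $ i" "a \<noteq> 0"
  shows "\<exists>m. \<forall>i. b $ i = m * a $ i"
proof -
  obtain k where k: "a $ k \<noteq> 0" using assms(2) by (auto simp: vec_eq_iff)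
  have "b $ i = (b $ k / a $ k) * a $ i" for i
    using assms(1)[of k i] k by (simp add: field_simps)
  then show ?thesis by blast
qed

text \<open>Linear independence in dual form: some \<kappa> completes the three covectors to a
  basis. Prescribing all four values can be verified on an explicit vector, and injectivity follows
  by counting dimensions.\<close>

definition coframe_at :: "real^4 \<Rightarrow> real^4 \<Rightarrow> real^4 \<Rightarrow> bool" where
  "coframe_at \<theta> \<beta> \<xi> \<longleftrightarrow> (\<exists>\<kappa>. \<forall>a b c d. \<exists>w. \<theta> \<bullet> w = a \<and> \<beta> \<bullet> w = b \<and> \<xi> \<bullet> w = c \<and> \<kappa> \<bullet> w = d)"

lemma coframe_at_witness: "coframe_at \<theta> \<beta> \<xi> \<Longrightarrow> \<exists>w. \<theta> \<bullet> w = a \<and> \<beta> \<bullet> w = b \<and> \<xi> \<bullet> w = c"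
  unfolding coframe_at_def by metis

lemma coframe_at_nonzero: "coframe_at \<theta> \<beta> \<xi> \<Longrightarrow> \<theta> \<noteq> 0"
  using coframe_at_witness[of \<theta> \<beta> \<xi> 1 0 0] by auto

lemma coframe_at_injective:
  assumes "coframe_at \<theta> \<beta> \<xi>"
  obtains \<kappa> where "\<And>v. \<theta> \<bullet> v = 0 \<Longrightarrow> \<beta> \<bullet> v = 0 \<Longrightarrow> \<xi> \<bullet> v = 0 \<Longrightarrow> \<kappa> \<bullet> v = 0 \<Longrightarrow> v = 0"
proof -
  obtain \<kappa> where \<kappa>: "\<And>a b c d. \<exists>w. \<theta> \<bullet> w = a \<and> \<beta> \<bullet> w = b \<and> \<xi> \<bullet> w = c \<and> \<kappa> \<bullet> w = d"
    using assms unfolding coframe_at_def by blast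
  define L :: "real^4 \<Rightarrow> real^4" where "L v = (\<chi> i. if i = 1 then \<theta> \<bullet> v else if i = 2 then \<beta> \<bullet> v else if i = 3 then \<xi> \<bullet> v else \<kappa> \<bullet> v)" for v
  have lin: "linear L"
    by (rule linearI) (auto simp: L_def vec_eq_iff inner_add_right)
  have "surj L"
    unfolding surj_def
  proof
    fix y :: "real^4"
    obtain w where "\<theta> \<bullet> w = y $ 1" "\<beta> \<bullet> w = y $ 2" "\<xi> \<bullet> w = y $ 3" "\<kappa> \<bullet> w = y $ 4" using \<kappa> by blast
    then have "L w = y" unfolding vec_eq_iff forall_4 by (simp add: L_def)
    then show "\<exists>w. y = L w" by blast
  qed
  then have "inj L" using linear_surjective_imp_injective[OF lin] by blast
  then have "v = 0" if "\<theta> \<bullet> v = 0" "\<beta> \<bullet> v = 0" "\<xi> \<bullet> v = 0" "\<kappa> \<bullet> v = 0" for v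
  proof -
    have "L v = L 0" using that by (simp add: L_def vec_eq_iff)
    then show ?thesis using \<open>inj L\<close> by (simp add: inj_eq)
  qed
  then show ?thesis using that by blast
qed

text \<open>A statement about one-forms alone; the spinors enter only through the structure
  equations. Both \<open>y\<close> and \<open>x\<close> are leafwise primitives, and the symmetry of
  their second derivatives determines the differential of the correction \<open>s\<close> or
  \<open>w\<close> modulo \<theta>, which is what the next stage consumes.\<close>

lemma dkp_coordinates:
  fixes \<theta> \<beta> \<xi> \<gamma> K :: "real^4 \<Rightarrow> real^4" and e n :: "real^4 \<Rightarrow> real"
  assumes U: "open U" "p \<in> U"
    and smooth: "smooth_on \<theta> U" "smooth_on \<beta> U" "smooth_on \<xi> U" "smooth_on n U"
    and d\<theta>: "\<And>q i j. q \<in> U \<Longrightarrow> pd \<theta> q i $ j - pd \<theta> q j $ i = 0"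
    and d\<beta>: "\<And>q i j. q \<in> U \<Longrightarrow> pd \<beta> q i $ j - pd \<beta> q j $ i = \<theta> q $ i * \<gamma> q $ j - \<theta> q $ j * \<gamma> q $ i"
    and d\<xi>: "\<And>q i j. q \<in> U \<Longrightarrow> pd \<xi> q i $ j - pd \<xi> q j $ i = \<gamma> q $ i * \<beta> q $ j - \<gamma> q $ j * \<beta> q $ i
        + e q * (\<theta> q $ i * \<xi> q $ j - \<theta> q $ j * \<xi> q $ i)"
    and dn: "\<And>q. q \<in> U \<Longrightarrow> \<exists>a b c. \<forall>i. pd n q i = a * \<theta> q $ i + b * \<beta> q $ i + c * \<xi> q $ i"
    and n: "\<And>q. q \<in> U \<Longrightarrow> n q \<noteq> 0"
    and K: "\<And>q. q \<in> U \<Longrightarrow> \<theta> q \<bullet> K q = 0 \<and> \<beta> q \<bullet> K q = 0 \<and> \<xi> q \<bullet> K q = 0"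
    and coframe: "\<And>q. q \<in> U \<Longrightarrow> coframe_at (\<theta> q) (\<beta> q) (\<xi> q)"
  shows "\<exists>N \<pi> \<phi> u. p \<in> N \<and> N \<subseteq> U \<and> orbit_coordinates N K \<pi> \<and>
    smooth_on \<phi> (\<pi> ` N) \<and> smooth_on u (\<pi> ` N) \<and> (\<forall>z\<in>\<pi> ` N. \<phi> z > 0) \<and> (\<forall>q\<in>N. \<phi> (\<pi> q) = \<bar>n q\<bar>) \<and>
    (\<forall>q\<in>N. \<forall>i j. \<beta> q $ i * \<beta> q $ j + \<theta> q $ i * \<xi> q $ j + \<xi> q $ i * \<theta> q $ j
      = dkp_h u (\<pi> q) (pd \<pi> q i) (pd \<pi> q j)) \<and>
    (\<forall>q\<in>N. \<forall>i. 4 * e q * \<theta> q $ i = dkp_nu u (\<pi> q) (pd \<pi> q i))"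
proof -
  obtain V1 t where V1: "open V1" "p \<in> V1" "V1 \<subseteq> U" and t: "smooth_on t V1"
    and dt: "\<And>q i. q \<in> V1 \<Longrightarrow> pd t q i = \<theta> q $ i"
    using poincare[OF U smooth(1)] d\<theta> by auto
  obtain a where a: "pd t p a \<noteq> 0"
    using coframe_at_nonzero[OF coframe[OF U(2)]] dt[OF V1(2)] by (auto simp: vec_eq_iff)
  have "pd \<beta> q i $ j - pd \<beta> q j $ i = pd t q i * \<gamma> q $ j - pd t q j * \<gamma> q $ i" if "q \<in> V1" for q i j
    using d\<beta>[of q i j] V1(3) that by (auto simp: dt)
  from poincare_foliated[OF V1(1,2) t smooth_on_subset[OF smooth(2) V1(3)] a this]
  obtain V2 y s where V2: "open V2" "p \<in> V2" "V2 \<subseteq> V1" and y: "smooth_on y V2" and s: "smooth_on s V2"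
    and dy: "\<And>q i. q \<in> V2 \<Longrightarrow> pd y q i = \<beta> q $ i + s q * pd t q i"
    by auto
  have V2U: "V2 \<subseteq> U" using V1 V2 by blast
  have dy: "pd y q i = \<beta> q $ i + s q * \<theta> q $ i" if "q \<in> V2" for q i
    using dy[OF that] dt that V2(3) by auto
  note sm2 = smooth_on_subset[OF smooth(1) V2U] smooth_on_subset[OF smooth(2) V2U] smooth_on_subset[OF smooth(3) V2U]
  have diff: "\<theta> differentiable (at q)" "\<beta> differentiable (at q)" "\<xi> differentiable (at q)" "s differentiable (at q)"
    "(\<lambda>z. \<theta> z $ j) differentiable (at q)" "(\<lambda>z. \<beta> z $ j) differentiable (at q)" "(\<lambda>z. \<xi> z $ j) differentiable (at q)"
    if "q \<in> V2" for q j
    using that sm2 s smooth_on_vec_nth[OF V2(1)] smooth_on_differentiable[OF _ V2(1)] by blast+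
  have ds: "\<exists>m. \<forall>i. pd s q i = \<gamma> q $ i + m * \<theta> q $ i" if q: "q \<in> V2" for q
  proof -
    have qU: "q \<in> U" using q V2U by blast
    have pp: "pd (\<lambda>z. pd y z j) q i = pd \<beta> q i $ j + s q * pd \<theta> q i $ j + pd s q i * \<theta> q $ j" for i j
    proof -
      have "pd (\<lambda>z. pd y z j) q i = pd (\<lambda>z. \<beta> z $ j + s z * \<theta> z $ j) q i"
        by (rule pd_cong[OF V2(1) q smooth_on_differentiable[OF smooth_on_pd[OF y] V2(1) q] dy])
      also have "\<dots> = pd \<beta> q i $ j + s q * pd \<theta> q i $ j + pd s q i * \<theta> q $ j"
        using diff[OF q] by (simp add: pd_add pd_mult pd_nth)
      finally show ?thesis .
    qed
    \<comment> \<open>This is \<theta> wedge (ds - \<gamma>) = 0, the content of d(dy) = 0. Cartan's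
      lemma then gives ds = \<gamma> + m \<theta>.\<close>
    have "\<theta> q $ i * (pd s q j - \<gamma> q $ j) = \<theta> q $ j * (pd s q i - \<gamma> q $ i)" for i j
      using pd_commute[OF y V2(1) q, of i j] d\<beta>[OF qU, of i j] d\<theta>[OF qU, of i j]
      unfolding pp by algebra
    from wedge_eq_zero[of "\<theta> q" "\<chi> i. pd s q i - \<gamma> q $ i"] this
    obtain m where "\<And>i. pd s q i - \<gamma> q $ i = m * \<theta> q $ i"
      using coframe_at_nonzero[OF coframe[OF qU]] by auto
    then show ?thesis by (intro exI[of _ m]) (simp add: algebra_simps)
  qed
  then obtain m where ds: "\<And>q i. q \<in> V2 \<Longrightarrow> pd s q i = \<gamma> q $ i + m q * \<theta> q $ i" by metis
  \<comment> \<open>Minus one half of the null-rotated \<xi>; the factor turns the term 2 \<theta>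
    \<xi> of the quadratic form into -4 dx dt.\<close>
  define \<rho> where "\<rho> z = (\<chi> j. (- (1/2)) * \<xi> z $ j + ((1/2) * (s z * \<beta> z $ j) + (1/4) * (s z * (s z * \<theta> z $ j))))" for z
  \<comment> \<open>Read off from the exterior derivative of \<rho>: after inserting ds = \<gamma> +
    m \<theta> all terms with \<gamma> cancel, and what is left has the factor \<theta>.\<close>
  define \<mu> where "\<mu> q = (\<chi> i. (1/2) * m q * \<beta> q $ i - (1/2) * e q * \<xi> q $ i)" for q
  have s\<rho>: "smooth_on \<rho> V2"
    unfolding \<rho>_def by (intro smooth_on_vec_lambda smooth_on_add smooth_on_mult smooth_on_const smooth_on_vec_nth V2(1) sm2 s)
  have d\<rho>: "pd \<rho> q i $ j - pd \<rho> q j $ i = \<theta> q $ i * \<mu> q $ j - \<theta> q $ j * \<mu> q $ i" if q: "q \<in> V2" for q i j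
  proof -
    have qU: "q \<in> U" using q V2U by blast
    have pp: "pd \<rho> q i $ j = - (1/2) * pd \<xi> q i $ j + (1/2) * (s q * pd \<beta> q i $ j + pd s q i * \<beta> q $ j)
        + (1/4) * (s q * (s q * pd \<theta> q i $ j + pd s q i * \<theta> q $ j) + pd s q i * (s q * \<theta> q $ j))" for i j
    proof -
      have "pd \<rho> q i $ j = pd (\<lambda>z. (- (1/2)) * \<xi> z $ j + ((1/2) * (s z * \<beta> z $ j) + (1/4) * (s z * (s z * \<theta> z $ j)))) q i"
        using pd_nth[OF smooth_on_differentiable[OF s\<rho> V2(1) q], of j i] by (simp add: \<rho>_def)
      also have "\<dots> = - (1/2) * pd \<xi> q i $ j + (1/2) * (s q * pd \<beta> q i $ j + pd s q i * \<beta> q $ j)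
        + (1/4) * (s q * (s q * pd \<theta> q i $ j + pd s q i * \<theta> q $ j) + pd s q i * (s q * \<theta> q $ j))"
        by (simp only: pd_add pd_mult pd_const pd_nth differentiable_add differentiable_mult differentiable_const diff[OF q])
      finally show ?thesis .
    qed
    show ?thesis
      using d\<theta>[OF qU, of i j] d\<beta>[OF qU, of i j] d\<xi>[OF qU, of i j]
      unfolding pp ds[OF q] \<mu>_def vec_lambda_beta by algebra
  qed
  have "pd \<rho> q i $ j - pd \<rho> q j $ i = pd t q i * \<mu> q $ j - pd t q j * \<mu> q $ i" if "q \<in> V2" for q i j
    using d\<rho>[OF that] dt V2(3) that by auto
  from poincare_foliated[OF V2(1,2) smooth_on_subset[OF t V2(3)] s\<rho> a this]
  obtain V3 x w where V3: "open V3" "p \<in> V3" "V3 \<subseteq> V2" and x: "smooth_on x V3" and w: "smooth_on w V3"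
    and dx: "\<And>q i. q \<in> V3 \<Longrightarrow> pd x q i = \<rho> q $ i + w q * pd t q i"
    by auto
  have V3U: "V3 \<subseteq> U" using V2U V3 by blast
  have dx: "pd x q i = \<rho> q $ i + w q * \<theta> q $ i" if "q \<in> V3" for q i
    using dx[OF that] dt that V2(3) V3(3) by auto
  have dw: "\<exists>m'. \<forall>i. pd w q i = \<mu> q $ i + m' * \<theta> q $ i" if q: "q \<in> V3" for q
  proof -
    have qU: "q \<in> U" and q2: "q \<in> V2" using q V3U V3 by blast+
    have pp: "pd (\<lambda>z. pd x z j) q i = pd \<rho> q i $ j + w q * pd \<theta> q i $ j + pd w q i * \<theta> q $ j" for i j
    proof -
      have "pd (\<lambda>z. pd x z j) q i = pd (\<lambda>z. \<rho> z $ j + w z * \<theta> z $ j) q i"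
        by (rule pd_cong[OF V3(1) q smooth_on_differentiable[OF smooth_on_pd[OF x] V3(1) q] dx])
      also have "\<dots> = pd \<rho> q i $ j + w q * pd \<theta> q i $ j + pd w q i * \<theta> q $ j"
        using diff[OF q2] smooth_on_differentiable[OF w V3(1) q] smooth_on_differentiable[OF s\<rho> V2(1) q2]
          smooth_on_differentiable[OF smooth_on_vec_nth[OF V2(1) s\<rho>] V2(1) q2]
        by (simp add: pd_add pd_mult pd_nth)
      finally show ?thesis .
    qed
    have "\<theta> q $ i * (pd w q j - \<mu> q $ j) = \<theta> q $ j * (pd w q i - \<mu> q $ i)" for i j
      using pd_commute[OF x V3(1) q, of i j] d\<rho>[OF q2, of i j] d\<theta>[OF qU, of i j]
      unfolding pp by algebra
    from wedge_eq_zero[of "\<theta> q" "\<chi> i. pd w q i - \<mu> q $ i"] this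
    obtain m where "\<And>i. pd w q i - \<mu> q $ i = m * \<theta> q $ i"
      using coframe_at_nonzero[OF coframe[OF qU]] by auto
    then show ?thesis by (intro exI[of _ m]) (simp add: algebra_simps)
  qed
  then obtain m' where dw: "\<And>q i. q \<in> V3 \<Longrightarrow> pd w q i = \<mu> q $ i + m' q * \<theta> q $ i" by metis
  define \<pi> :: "real^4 \<Rightarrow> real^3" where "\<pi> q = (\<chi> i. if i = 1 then x q else if i = 2 then y q else t q)" for q
  have s\<pi>: "smooth_on \<pi> V3"
  proof (rule smooth_on_vecI[OF V3(1)])
    have "smooth_on y V3" "smooth_on t V3"
      using V2(3) V3(3) by (auto intro: smooth_on_subset[OF y] smooth_on_subset[OF t])
    then show "smooth_on (\<lambda>q. \<pi> q $ i) V3" for i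
      using x by (cases "i = 1"; cases "i = 2") (simp_all add: \<pi>_def)
  qed
  have d\<pi>: "\<pi> differentiable (at q)" if "q \<in> V3" for q by (rule smooth_on_differentiable[OF s\<pi> V3(1) that])
  have pd\<pi>: "pd \<pi> q i $ 1 = \<rho> q $ i + w q * \<theta> q $ i" "pd \<pi> q i $ 2 = \<beta> q $ i + s q * \<theta> q $ i" "pd \<pi> q i $ 3 = \<theta> q $ i"
    if "q \<in> V3" for q i
    using dx[OF that, of i] dy[of q i] dt[of q i] that V2(3) V3(3)
    unfolding pd_nth[OF d\<pi>[OF that], symmetric] by (auto simp: \<pi>_def)
  have \<rho>: "\<rho> q $ i = - \<xi> q $ i / 2 + s q * \<beta> q $ i / 2 + (s q)\<^sup>2 * \<theta> q $ i / 4" for q i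
    by (simp add: \<rho>_def power2_eq_square)
  have fr\<pi>: "frechet_derivative \<pi> (at q) v $ 1 = - (\<xi> q \<bullet> v) / 2 + s q * (\<beta> q \<bullet> v) / 2 + ((s q)\<^sup>2 / 4 + w q) * (\<theta> q \<bullet> v)"
    "frechet_derivative \<pi> (at q) v $ 2 = \<beta> q \<bullet> v + s q * (\<theta> q \<bullet> v)"
    "frechet_derivative \<pi> (at q) v $ 3 = \<theta> q \<bullet> v" if "q \<in> V3" for q v
    by (simp_all add: frechet_eq_sum_pd[OF d\<pi>[OF that]] pd\<pi>[OF that] \<rho> inner_vec_def sum_distrib_left sum_distrib_right
        sum.distrib[symmetric] sum_divide_distrib sum_negf[symmetric] algebra_simps)
  obtain \<kappa> where \<kappa>: "\<And>v. \<theta> p \<bullet> v = 0 \<Longrightarrow> \<beta> p \<bullet> v = 0 \<Longrightarrow> \<xi> p \<bullet> v = 0 \<Longrightarrow> \<kappa> \<bullet> v = 0 \<Longrightarrow> v = 0"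
    using coframe_at_injective[OF coframe[OF U(2)]] by blast
  \<comment> \<open>Where \<open>n\<close> keeps the sign it has at \<open>p\<close>, its absolute
    value is a constant multiple of \<open>n\<close>, hence smooth.\<close>
  define V4 where "V4 = {q\<in>V3. sgn (n p) * n q > 0}"
  have sn: "smooth_on (\<lambda>q. sgn (n p) * n q) V3"
    by (intro smooth_on_mult smooth_on_const V3(1) smooth_on_subset[OF smooth(4) V3U])
  have V4: "open V4" "p \<in> V4" "V4 \<subseteq> V3"
    using continuous_open_preimage[OF smooth_on_continuous_on[OF sn] V3(1) open_greaterThan, of 0] V3(2) n[OF U(2)]
    by (auto simp: V4_def Int_def abs_sgn[symmetric] sgn_mult_abs mult.commute)
  have abs_n: "sgn (n p) * n q = \<bar>n q\<bar>" if "q \<in> V4" for q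
    using that by (auto simp: V4_def sgn_if zero_less_mult_iff split: if_splits)
  have inj: "v = 0" if v: "frechet_derivative \<pi> (at p) v = 0" "\<kappa> \<bullet> v = 0" for v
  proof (rule \<kappa>[OF _ _ _ v(2)])
    show 1: "\<theta> p \<bullet> v = 0" using fr\<pi>(3)[OF V3(2), of v] v(1) by simp
    show 2: "\<beta> p \<bullet> v = 0" using fr\<pi>(2)[OF V3(2), of v] v(1) 1 by simp
    show "\<xi> p \<bullet> v = 0" using fr\<pi>(1)[OF V3(2), of v] v(1) 1 2 by simp
  qed
  have "\<exists>N. open N \<and> p \<in> N \<and> N \<subseteq> V4 \<and> open (\<pi> ` N) \<and>
    (\<forall>q\<in>N. surj (frechet_derivative \<pi> (at q))) \<and> (\<forall>z. connected {q\<in>N. \<pi> q = z}) \<and>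
    (\<forall>f. smooth_on f V4 \<longrightarrow> (\<forall>q\<in>N. \<exists>c. \<forall>i. pd f q i = (\<Sum>k\<in>UNIV. c k * pd \<pi> q i $ k)) \<longrightarrow>
      (\<exists>f'::real^3 \<Rightarrow> real. smooth_on f' (\<pi> ` N) \<and> (\<forall>q\<in>N. f' (\<pi> q) = f q)))"
    by (rule submersion_chart[OF V4(1,2) smooth_on_subset[OF s\<pi> V4(3)] inj])
  then obtain N where N: "open N" "p \<in> N" "N \<subseteq> V4" "open (\<pi> ` N)"
    and surj: "\<forall>q\<in>N. surj (frechet_derivative \<pi> (at q))"
    and conn: "\<forall>z. connected {q\<in>N. \<pi> q = z}"
    and descend: "\<forall>f. smooth_on f V4 \<longrightarrow> (\<forall>q\<in>N. \<exists>c. \<forall>i. pd f q i = (\<Sum>k\<in>UNIV. c k * pd \<pi> q i $ k)) \<longrightarrow>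
      (\<exists>f'::real^3 \<Rightarrow> real. smooth_on f' (\<pi> ` N) \<and> (\<forall>q\<in>N. f' (\<pi> q) = f q))"
    by (elim exE conjE) (rule that, assumption+)
  have N3: "N \<subseteq> V3" and NU: "N \<subseteq> U" using N V4 V3U by auto
  have span: "\<exists>c. \<forall>i. f i = (\<Sum>k\<in>UNIV. c k * pd \<pi> q i $ k)"
    if q: "q \<in> V3" and f: "\<And>i. f i = a * \<theta> q $ i + b * \<beta> q $ i + c * \<xi> q $ i" for f q a b c
  proof (intro exI allI)
    fix i
    \<comment> \<open>The coefficients come from back substitution in the triangular system that
      expresses dx, dy, dt through \<xi>, \<beta>, \<theta>.\<close>
    show "f i = (\<Sum>k\<in>UNIV. (if k = 1 then - 2 * c else if k = 2 then b + s q * c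
        else a - s q * (b + s q * c) + 2 * c * ((s q)\<^sup>2 / 4 + w q)) * pd \<pi> q i $ k)"
      unfolding f sum_3 by (simp add: pd\<pi>[OF q] \<rho> algebra_simps power2_eq_square)
  qed
  have "\<exists>c. \<forall>i. pd (\<lambda>q. sgn (n p) * n q) q i = (\<Sum>k\<in>UNIV. c k * pd \<pi> q i $ k)" if q: "q \<in> N" for q
  proof -
    obtain a b c where abc: "\<And>i. pd n q i = a * \<theta> q $ i + b * \<beta> q $ i + c * \<xi> q $ i"
      using dn[of q] q NU by blast
    have "pd (\<lambda>q. sgn (n p) * n q) q i = (sgn (n p) * a) * \<theta> q $ i + (sgn (n p) * b) * \<beta> q $ i + (sgn (n p) * c) * \<xi> q $ i" for i
      using smooth_on_differentiable[OF smooth(4) U(1)] q NU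
      by (subst pd_mult) (auto simp: pd_const abc algebra_simps)
    then show ?thesis by (rule span[rotated]) (use q N3 in auto)
  qed
  then have "\<exists>f'::real^3 \<Rightarrow> real. smooth_on f' (\<pi> ` N) \<and> (\<forall>q\<in>N. f' (\<pi> q) = sgn (n p) * n q)"
    using descend smooth_on_subset[OF sn V4(3)] by blast
  then
  obtain \<phi> :: "real^3 \<Rightarrow> real" where \<phi>: "smooth_on \<phi> (\<pi> ` N)" "\<And>q. q \<in> N \<Longrightarrow> \<phi> (\<pi> q) = \<bar>n q\<bar>"
    using abs_n N(3) by force
  have sw: "smooth_on (\<lambda>q. - w q) V3" by (rule smooth_on_minus[OF V3(1) w])
  have dmw: "pd (\<lambda>q. - w q) q i = - m' q * \<theta> q $ i + - (m q / 2) * \<beta> q $ i + e q / 2 * \<xi> q $ i" if "q \<in> V3" for q i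
    using pd_minus[OF smooth_on_differentiable[OF w V3(1) that], of i] by (simp add: dw[OF that] \<mu>_def)
  have "\<exists>c. \<forall>i. pd (\<lambda>q. - w q) q i = (\<Sum>k\<in>UNIV. c k * pd \<pi> q i $ k)" if q: "q \<in> N" for q
    by (rule span[OF _ dmw]) (use q N3 in auto)
  then have "\<exists>f'::real^3 \<Rightarrow> real. smooth_on f' (\<pi> ` N) \<and> (\<forall>q\<in>N. f' (\<pi> q) = - w q)"
    using descend smooth_on_subset[OF sw V4(3)] by blast
  then
  obtain u :: "real^3 \<Rightarrow> real" where u: "smooth_on u (\<pi> ` N)" "\<And>q. q \<in> N \<Longrightarrow> u (\<pi> q) = - w q"
    by blast
  have ux: "pd u (\<pi> q) 1 = - e q" if q: "q \<in> N" for q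
  proof -
    have q3: "q \<in> V3" using q N3 by blast
    have "pd (\<lambda>q. - w q) q i = (\<Sum>k\<in>UNIV. pd \<pi> q i $ k * pd u (\<pi> q) k)" for i
    proof -
      have "pd (\<lambda>q. - w q) q i = pd (\<lambda>q. u (\<pi> q)) q i"
        by (rule pd_cong[OF N(1) q smooth_on_differentiable[OF sw V3(1) q3]]) (simp add: u(2))
      also have "\<dots> = (\<Sum>k\<in>UNIV. pd \<pi> q i $ k * pd u (\<pi> q) k)"
        using pd_chain[OF d\<pi>[OF q3] smooth_on_differentiable[OF u(1) N(4)], of i] q by auto
      finally show ?thesis .
    qed
    then have eq: "- m' q * \<theta> q $ i + - (m q / 2) * \<beta> q $ i + e q / 2 * \<xi> q $ i
      = (\<rho> q $ i + w q * \<theta> q $ i) * pd u (\<pi> q) 1 + (\<beta> q $ i + s q * \<theta> q $ i) * pd u (\<pi> q) 2 + \<theta> q $ i * pd u (\<pi> q) 3" for i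
      unfolding dmw[OF q3] sum_3 pd\<pi>[OF q3] by blast
    \<comment> \<open>The vector dual to \<xi>: on it dt and dy vanish and dx is -1/2, so it
      isolates the derivative of \<open>u\<close> in x, while the differential of -w takes the value
      e/2.\<close>
    obtain v where v: "\<theta> q \<bullet> v = 0" "\<beta> q \<bullet> v = 0" "\<xi> q \<bullet> v = 1"
      using coframe_at_witness[OF coframe[of q]] q NU by blast
    have "- m' q * (\<theta> q \<bullet> v) + - (m q / 2) * (\<beta> q \<bullet> v) + e q / 2 * (\<xi> q \<bullet> v)
      = (\<Sum>i\<in>UNIV. (- m' q * \<theta> q $ i + - (m q / 2) * \<beta> q $ i + e q / 2 * \<xi> q $ i) * v $ i)"
      by (simp add: inner_vec_def sum_distrib_left sum.distrib[symmetric] algebra_simps)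
    also have "\<dots> = (- (\<xi> q \<bullet> v) / 2 + s q * (\<beta> q \<bullet> v) / 2 + ((s q)\<^sup>2 / 4 + w q) * (\<theta> q \<bullet> v)) * pd u (\<pi> q) 1
        + (\<beta> q \<bullet> v + s q * (\<theta> q \<bullet> v)) * pd u (\<pi> q) 2 + (\<theta> q \<bullet> v) * pd u (\<pi> q) 3"
      unfolding eq \<rho>
      by (simp add: inner_vec_def sum_distrib_left sum_distrib_right sum.distrib[symmetric] sum_divide_distrib
          sum_negf[symmetric] algebra_simps)
    finally show ?thesis using v by simp
  qed
  have fr0: "frechet_derivative \<pi> (at q) (K q) = 0" if q: "q \<in> N" for q
  proof -
    have "q \<in> V3" "q \<in> U" using q N3 NU by auto
    then show ?thesis unfolding vec_eq_iff forall_3 by (simp add: fr\<pi> K)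
  qed
  have f1: "orbit_coordinates N K \<pi>"
    unfolding orbit_coordinates_def
    using N surj conn fr0 smooth_on_subset[OF s\<pi> N3] by blast
  have f2: "\<phi> z > 0" if "z \<in> \<pi> ` N" for z
    using that \<phi>(2) n NU by auto
  have f3: "\<beta> q $ i * \<beta> q $ j + \<theta> q $ i * \<xi> q $ j + \<xi> q $ i * \<theta> q $ j
      = dkp_h u (\<pi> q) (pd \<pi> q i) (pd \<pi> q j)" if q: "q \<in> N" for q i j
  proof -
    have q3: "q \<in> V3" using q N3 by blast
    show ?thesis
      unfolding dkp_h_def pd\<pi>[OF q3] u(2)[OF q] \<rho> by (simp add: field_simps power2_eq_square)
  qed
  have f4: "4 * e q * \<theta> q $ i = dkp_nu u (\<pi> q) (pd \<pi> q i)" if q: "q \<in> N" for q i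
    using pd\<pi>(3)[of q i] q N3 by (auto simp: dkp_nu_def ux[OF q])
  show ?thesis
    by (intro exI[of _ N] exI[of _ \<pi>] exI[of _ \<phi>] exI[of _ u] conjI ballI allI)
       (rule N(2) NU \<phi> u(1) f1 f2 f3 f4; assumption)+
qed

section \<open>Two-spinor algebra\<close>

definition spin_bracket :: "real^2 \<Rightarrow> real^2 \<Rightarrow> real" where
  "spin_bracket a b = a $ 1 * b $ 2 - a $ 2 * b $ 1"

definition spin_tensor :: "real^2 \<Rightarrow> real^2 \<Rightarrow> real^2^2" where
  "spin_tensor a b = (\<chi> A A'. a $ A * b $ A')"

text \<open>The polarised determinant: \<open>spin_metric X X\<close> is twice the determinant of
  \<open>X\<close>. It is the metric on spinor components of vectors.\<close>

definition spin_metric :: "real^2^2 \<Rightarrow> real^2^2 \<Rightarrow> real" where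
  "spin_metric X Y = X $ 1 $ 1 * Y $ 2 $ 2 - X $ 1 $ 2 * Y $ 2 $ 1 - X $ 2 $ 1 * Y $ 1 $ 2 + X $ 2 $ 2 * Y $ 1 $ 1"

definition spin_form :: "real^2^2 \<Rightarrow> real^2 \<Rightarrow> real^2 \<Rightarrow> real" where
  "spin_form M a b = (\<Sum>A\<in>UNIV. \<Sum>B\<in>UNIV. M $ A $ B * a $ A * b $ B)"

definition contract' :: "real^2^2 \<Rightarrow> real^2 \<Rightarrow> real^2" where
  "contract' X b = (\<chi> A. X $ A $ 1 * b $ 2 - X $ A $ 2 * b $ 1)"

text \<open>For symmetric \<phi> and \<psi>, the two-form with anti-self-dual part \<phi> and
  self-dual part \<psi>, evaluated on the spinor components of two vectors.\<close>

definition two_form :: "real^2^2 \<Rightarrow> real^2^2 \<Rightarrow> real^2^2 \<Rightarrow> real^2^2 \<Rightarrow> real" where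
  "two_form \<phi> \<psi> X Y = (\<Sum>A\<in>UNIV. \<Sum>B\<in>UNIV. \<Sum>A'\<in>UNIV. \<Sum>B'\<in>UNIV.
     (\<phi> $ A $ B * eps $ A' $ B' + \<psi> $ A' $ B' * eps $ A $ B) * X $ A $ A' * Y $ B $ B')"

lemma eps_simps [simp]: "eps $ 1 $ 1 = 0" "eps $ 1 $ 2 = 1" "eps $ 2 $ 1 = -1" "eps $ 2 $ 2 = 0"
  by (simp_all add: eps_def)

lemmas spin_defs = spin_bracket_def spin_tensor_def spin_metric_def spin_form_def contract'_def
  sum_2 eps_simps

lemma two_form_explicit:
  "two_form \<phi> \<psi> X Y =
     \<phi> $ 1 $ 1 * (X $ 1 $ 1 * Y $ 1 $ 2 - X $ 1 $ 2 * Y $ 1 $ 1) + \<phi> $ 1 $ 2 * (X $ 1 $ 1 * Y $ 2 $ 2 - X $ 1 $ 2 * Y $ 2 $ 1)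
     + \<phi> $ 2 $ 1 * (X $ 2 $ 1 * Y $ 1 $ 2 - X $ 2 $ 2 * Y $ 1 $ 1) + \<phi> $ 2 $ 2 * (X $ 2 $ 1 * Y $ 2 $ 2 - X $ 2 $ 2 * Y $ 2 $ 1)
     + \<psi> $ 1 $ 1 * (X $ 1 $ 1 * Y $ 2 $ 1 - X $ 2 $ 1 * Y $ 1 $ 1) + \<psi> $ 1 $ 2 * (X $ 1 $ 1 * Y $ 2 $ 2 - X $ 2 $ 1 * Y $ 1 $ 2)
     + \<psi> $ 2 $ 1 * (X $ 1 $ 2 * Y $ 2 $ 1 - X $ 2 $ 2 * Y $ 1 $ 1) + \<psi> $ 2 $ 2 * (X $ 1 $ 2 * Y $ 2 $ 2 - X $ 2 $ 2 * Y $ 1 $ 2)"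
  unfolding two_form_def sum_2 by (simp add: ring_distribs)

lemma symmetric_2: "transpose M = M \<Longrightarrow> M $ 2 $ 1 = M $ 1 $ (2::2)"
proof -
  have "M $ 2 $ 1 = transpose M $ 1 $ 2" by (simp add: transpose_def)
  then show "transpose M = M \<Longrightarrow> M $ 2 $ 1 = M $ 1 $ 2" by simp
qed

lemma spin_metric_sum:
  "(\<Sum>A\<in>UNIV. \<Sum>B\<in>UNIV. \<Sum>A'\<in>UNIV. \<Sum>B'\<in>UNIV.
     eps $ A $ B * eps $ A' $ B' * X $ A $ A' * Y $ B $ B') = spin_metric X Y"
  by (simp add: spin_defs)

lemma spin_metric_commute: "spin_metric X Y = spin_metric Y X"
  by (simp add: spin_metric_def algebra_simps)

lemma spin_metric_add: "spin_metric X (Y + Z) = spin_metric X Y + spin_metric X Z"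
  by (simp add: spin_metric_def algebra_simps)

lemma spin_metric_scaleR: "spin_metric X (c *\<^sub>R Y) = c * spin_metric X Y"
  by (simp add: spin_metric_def algebra_simps)

lemma spin_bracket_contract': "spin_bracket (contract' X b) a = spin_metric X (spin_tensor a b)"
  by (simp add: spin_defs algebra_simps)

text \<open>The Schouten identity: in dimension two any three spinors are dependent, with brackets
  as coefficients.\<close>

lemma spin_bracket_basis:
  assumes "spin_bracket a b = 1"
  shows "v = spin_bracket v b *\<^sub>R a - spin_bracket v a *\<^sub>R b"
proof -
  have "spin_bracket a b * v $ A = (spin_bracket v b *\<^sub>R a - spin_bracket v a *\<^sub>R b) $ A" for A
    using exhaust_2[of A] by (auto simp: spin_bracket_def algebra_simps)
  then show ?thesis using assms by (simp add: vec_eq_iff)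
qed

text \<open>The four products form a null tetrad. Its nonzero inner products are +1 for
  \<open>k o'\<close> with \<open>\<tau> \<iota>\<close> and -1 for \<open>k \<iota>\<close> with
  \<open>\<tau> o'\<close>, which explains the signs.\<close>

lemma spin_tensor_basis:
  assumes "spin_bracket k \<tau> = 1" "spin_bracket o' \<iota> = 1"
  shows "Y = spin_metric Y (spin_tensor \<tau> \<iota>) *\<^sub>R spin_tensor k o' - spin_metric Y (spin_tensor \<tau> o') *\<^sub>R spin_tensor k \<iota>
    - spin_metric Y (spin_tensor k \<iota>) *\<^sub>R spin_tensor \<tau> o' + spin_metric Y (spin_tensor k o') *\<^sub>R spin_tensor \<tau> \<iota>"
  (is "Y = ?R")
proof -
  have "spin_bracket k \<tau> * spin_bracket o' \<iota> * Y $ A $ B = ?R $ A $ B" for A B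
    using exhaust_2[of A] exhaust_2[of B] by (auto simp: spin_defs algebra_simps)
  then show ?thesis using assms by (simp add: vec_eq_iff)
qed

lemma spin_form_diff: "spin_form M (a - b) c = spin_form M a c - spin_form M b c"
  by (simp add: spin_defs algebra_simps)

lemma spin_form_scaleR: "spin_form M (r *\<^sub>R a) c = r * spin_form M a c"
  by (simp add: spin_defs algebra_simps)

lemma spin_form_commute: "transpose M = M \<Longrightarrow> spin_form M a b = spin_form M b a"
proof -
  assume "transpose M = M"
  then have "M $ 2 $ 1 = M $ 1 $ 2" by (rule symmetric_2)
  then show ?thesis by (simp add: spin_defs algebra_simps)
qed

lemma two_form_add: "two_form \<phi> \<psi> X (Y + Z) = two_form \<phi> \<psi> X Y + two_form \<phi> \<psi> X Z"
  by (simp add: two_form_explicit ring_distribs)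

lemma two_form_scaleR: "two_form \<phi> \<psi> X (c *\<^sub>R Y) = c * two_form \<phi> \<psi> X Y"
  by (simp add: two_form_explicit algebra_simps)

lemma two_form_antisym:
  assumes "transpose \<phi> = \<phi>" "transpose \<psi> = \<psi>"
  shows "two_form \<phi> \<psi> X Y = - two_form \<phi> \<psi> Y X"
proof -
  show ?thesis by (simp add: two_form_explicit symmetric_2[OF assms(1)] symmetric_2[OF assms(2)] ring_distribs)
qed

lemma two_form_tensor:
  "two_form \<phi> \<psi> X (spin_tensor a b) =
     spin_form \<phi> (contract' X b) a + spin_form \<psi> (contract' (transpose X) a) b"
  by (simp add: two_form_explicit spin_defs transpose_def ring_distribs)

lemma two_form_split: "two_form \<phi> \<psi> X Y = two_form \<phi> 0 X Y + two_form 0 \<psi> X Y"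
  by (simp add: two_form_explicit ring_distribs)

text \<open>The null coframe is \<open>E1, E2, E3, E4\<close>; \<open>f0, f1, f2\<close> are the components of \<open>\<phi>\<close> in the frame
  \<open>k, \<tau>\<close>, and \<open>c\<close> is the single component of \<open>\<psi>\<close>.\<close>

lemma two_form_frame:
  fixes X \<phi> \<psi> :: "real^2^2" and k \<tau> o' \<iota> :: "real^2"
  assumes b: "spin_bracket k \<tau> = 1" "spin_bracket o' \<iota> = 1"
    and sym: "transpose \<phi> = \<phi>" "transpose \<psi> = \<psi>" and \<psi>: "\<And>v. spin_form \<psi> v \<iota> = 0"
  defines "E1 \<equiv> spin_metric X (spin_tensor k \<iota>)" and "E2 \<equiv> spin_metric X (spin_tensor \<tau> o')"
    and "E3 \<equiv> spin_metric X (spin_tensor k o')" and "E4 \<equiv> spin_metric X (spin_tensor \<tau> \<iota>)"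
    and "f0 \<equiv> spin_form \<phi> k k" and "f1 \<equiv> spin_form \<phi> k \<tau>" and "f2 \<equiv> spin_form \<phi> \<tau> \<tau>"
    and "c \<equiv> spin_form \<psi> o' o'"
  shows "two_form \<phi> \<psi> X (spin_tensor k \<iota>) = f0 * E4 - f1 * E1"
    and "two_form \<phi> \<psi> X (spin_tensor \<tau> \<iota>) = f1 * E4 - f2 * E1"
    and "two_form \<phi> \<psi> X (spin_tensor k o') = f0 * E2 - f1 * E3 + c * E1"
    and "two_form \<phi> \<psi> X (spin_tensor \<tau> o') = f1 * E2 - f2 * E3 + c * E4"
    and "two_form 0 \<psi> X (spin_tensor k o') = c * E1"
    and "two_form 0 \<psi> X (spin_tensor \<tau> \<iota>) = 0"
proof -
  have exp: "spin_form M v a = spin_bracket v \<tau> * spin_form M k a - spin_bracket v k * spin_form M \<tau> a" for M v a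
    by (subst spin_bracket_basis[OF b(1), of v]) (simp add: spin_form_diff spin_form_scaleR)
  \<comment> \<open>As \<psi> annihilates \<iota>, only the coefficient of \<open>o'\<close> in the
    expansion of \<open>v\<close> survives.\<close>
  have exp': "spin_form \<psi> v o' = spin_bracket v \<iota> * c" for v
    by (subst spin_bracket_basis[OF b(2), of v])
       (simp add: spin_form_diff spin_form_scaleR c_def spin_form_commute[OF sym(2), of \<iota>] \<psi>)
  have tr: "spin_metric (transpose X) (spin_tensor b a) = spin_metric X (spin_tensor a b)" for a b
    by (simp add: spin_defs transpose_def algebra_simps)
  have 0: "spin_form 0 v a = 0" for v a by (simp add: spin_form_def)
  note defs = E1_def E2_def E3_def E4_def f0_def f1_def f2_def
  note rules = two_form_tensor exp[of \<phi> "contract' X _"] \<psi> exp' tr spin_bracket_contract' spin_form_commute[OF sym(1), of \<tau> k] 0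
  show "two_form \<phi> \<psi> X (spin_tensor k \<iota>) = f0 * E4 - f1 * E1"
    "two_form \<phi> \<psi> X (spin_tensor \<tau> \<iota>) = f1 * E4 - f2 * E1"
    "two_form \<phi> \<psi> X (spin_tensor k o') = f0 * E2 - f1 * E3 + c * E1"
    "two_form \<phi> \<psi> X (spin_tensor \<tau> o') = f1 * E2 - f2 * E3 + c * E4"
    "two_form 0 \<psi> X (spin_tensor k o') = c * E1"
    "two_form 0 \<psi> X (spin_tensor \<tau> \<iota>) = 0"
    unfolding defs by (simp_all add: rules)
qed

section \<open>Metric contractions and the Hodge star in spinor form\<close>

definition vol_spin :: "real^2^2 \<Rightarrow> real^2^2 \<Rightarrow> real^2^2 \<Rightarrow> real^2^2 \<Rightarrow> real" where
  "vol_spin X Y Z W =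
     (\<Sum>A\<in>UNIV. \<Sum>B\<in>UNIV. \<Sum>C\<in>UNIV. \<Sum>D\<in>UNIV. \<Sum>A'\<in>UNIV. \<Sum>B'\<in>UNIV. \<Sum>C'\<in>UNIV. \<Sum>D'\<in>UNIV.
        (eps $ A $ C * eps $ B $ D * eps $ A' $ D' * eps $ B' $ C'
         - eps $ A $ D * eps $ B $ C * eps $ A' $ C' * eps $ B' $ D')
        * X $ A $ A' * Y $ B $ B' * Z $ C $ C' * W $ D $ D')"

definition mat_unit :: "2 \<Rightarrow> 2 \<Rightarrow> real^2^2" where
  "mat_unit A B = (\<chi> i j. if i = A \<and> j = B then 1 else 0)"

lemma mat_unit_nth [simp]: "mat_unit A B $ i $ j = (if i = A \<and> j = B then 1 else 0)"
  by (simp add: mat_unit_def)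

lemma linear_mat_unit:
  assumes "linear f"
  shows "f X = X $ 1 $ 1 *\<^sub>R f (mat_unit 1 1) + X $ 1 $ 2 *\<^sub>R f (mat_unit 1 2)
    + X $ 2 $ 1 *\<^sub>R f (mat_unit 2 1) + X $ 2 $ 2 *\<^sub>R f (mat_unit 2 2)"
proof -
  have "X = X $ 1 $ 1 *\<^sub>R mat_unit 1 1 + X $ 1 $ 2 *\<^sub>R mat_unit 1 2
    + X $ 2 $ 1 *\<^sub>R mat_unit 2 1 + X $ 2 $ 2 *\<^sub>R mat_unit 2 2"
    unfolding vec_eq_iff forall_2 by simp
  then show ?thesis using linear_add[OF assms] linear_scale[OF assms] by metis
qed

text \<open>The hypothesis says that \<open>M\<close> is the inverse metric in spinor form. Linear
  functionals are determined by their values on the matrix units, and the two factors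
  \<open>eps\<close> leave only four pairs of those.\<close>

lemma contract_pair:
  fixes s :: "4 \<Rightarrow> real^2^2" and f h :: "real^2^2 \<Rightarrow> real"
  assumes M: "\<And>A A' B B'. (\<Sum>a\<in>UNIV. \<Sum>i\<in>UNIV. M a i * s a $ A $ A' * s i $ B $ B') = eps $ A $ B * eps $ A' $ B'"
    and f: "linear f" and h: "linear h"
  shows "(\<Sum>a\<in>UNIV. \<Sum>i\<in>UNIV. M a i * (f (s a) * h (s i)))
    = f (mat_unit 1 1) * h (mat_unit 2 2) - f (mat_unit 1 2) * h (mat_unit 2 1)
      - f (mat_unit 2 1) * h (mat_unit 1 2) + f (mat_unit 2 2) * h (mat_unit 1 1)"
proof -
  have f': "f X = (\<Sum>A\<in>UNIV. \<Sum>A'\<in>UNIV. X $ A $ A' * f (mat_unit A A'))" for X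
    using linear_mat_unit[OF f, of X] by (simp add: sum_2)
  have h': "h X = (\<Sum>A\<in>UNIV. \<Sum>A'\<in>UNIV. X $ A $ A' * h (mat_unit A A'))" for X
    using linear_mat_unit[OF h, of X] by (simp add: sum_2)
  have "(\<Sum>a\<in>UNIV. \<Sum>i\<in>UNIV. M a i * (f (s a) * h (s i)))
    = (\<Sum>a\<in>UNIV. \<Sum>i\<in>UNIV. \<Sum>A\<in>UNIV. \<Sum>A'\<in>UNIV. \<Sum>B\<in>UNIV. \<Sum>B'\<in>UNIV.
        f (mat_unit A A') * h (mat_unit B B') * (M a i * s a $ A $ A' * s i $ B $ B'))"
    by (intro sum.cong refl, subst f', subst h') (simp add: sum_2 algebra_simps)
  also have "\<dots> = (\<Sum>A\<in>UNIV. \<Sum>A'\<in>UNIV. \<Sum>B\<in>UNIV. \<Sum>B'\<in>UNIV. f (mat_unit A A') * h (mat_unit B B')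
      * (\<Sum>a\<in>UNIV. \<Sum>i\<in>UNIV. M a i * s a $ A $ A' * s i $ B $ B'))"
    unfolding sum_2 by (simp add: sum.distrib sum_distrib_left)
  also have "\<dots> = f (mat_unit 1 1) * h (mat_unit 2 2) - f (mat_unit 1 2) * h (mat_unit 2 1)
      - f (mat_unit 2 1) * h (mat_unit 1 2) + f (mat_unit 2 2) * h (mat_unit 1 1)"
    unfolding M by (simp add: sum_2)
  finally show ?thesis .
qed

text \<open>Brings each index next to the one it is contracted with, so that a triple contraction
  can be done one pair at a time.\<close>

lemma sum_interleave:
  fixes f :: "'a::finite \<Rightarrow> 'b::finite \<Rightarrow> 'c::finite \<Rightarrow> 'd::finite \<Rightarrow> 'e::finite \<Rightarrow> 'f::finite \<Rightarrow> real"
  shows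
  "(\<Sum>a\<in>UNIV. \<Sum>b\<in>UNIV. \<Sum>c\<in>UNIV. \<Sum>i\<in>UNIV. \<Sum>j\<in>UNIV. \<Sum>k\<in>UNIV. f a b c i j k)
    = (\<Sum>a\<in>UNIV. \<Sum>i\<in>UNIV. \<Sum>b\<in>UNIV. \<Sum>j\<in>UNIV. \<Sum>c\<in>UNIV. \<Sum>k\<in>UNIV. f a b c i j k)"
proof -
  have 1: "(\<Sum>b\<in>UNIV. \<Sum>c\<in>UNIV. \<Sum>i\<in>UNIV. g b c i) = (\<Sum>i\<in>UNIV. \<Sum>b\<in>UNIV. \<Sum>c\<in>UNIV. g b c i)"
    for g :: "'b::finite \<Rightarrow> 'c::finite \<Rightarrow> 'd::finite \<Rightarrow> real"
  proof -
    have "(\<Sum>b\<in>UNIV. \<Sum>c\<in>UNIV. \<Sum>i\<in>UNIV. g b c i) = (\<Sum>b\<in>UNIV. \<Sum>i\<in>UNIV. \<Sum>c\<in>UNIV. g b c i)"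
      by (rule sum.cong[OF refl sum.swap])
    also have "\<dots> = (\<Sum>i\<in>UNIV. \<Sum>b\<in>UNIV. \<Sum>c\<in>UNIV. g b c i)" by (rule sum.swap)
    finally show ?thesis .
  qed
  have 2: "(\<Sum>c\<in>UNIV. \<Sum>j\<in>UNIV. \<Sum>k\<in>UNIV. f a b c i j k) = (\<Sum>j\<in>UNIV. \<Sum>c\<in>UNIV. \<Sum>k\<in>UNIV. f a b c i j k)" for a b i
    by (rule sum.swap)
  show ?thesis
  proof (rule sum.cong[OF refl])
    fix a
    have "(\<Sum>b\<in>UNIV. \<Sum>c\<in>UNIV. \<Sum>i\<in>UNIV. \<Sum>j\<in>UNIV. \<Sum>k\<in>UNIV. f a b c i j k)
      = (\<Sum>i\<in>UNIV. \<Sum>b\<in>UNIV. \<Sum>c\<in>UNIV. \<Sum>j\<in>UNIV. \<Sum>k\<in>UNIV. f a b c i j k)"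
      by (rule 1)
    also have "\<dots> = (\<Sum>i\<in>UNIV. \<Sum>b\<in>UNIV. \<Sum>j\<in>UNIV. \<Sum>c\<in>UNIV. \<Sum>k\<in>UNIV. f a b c i j k)"
      by (intro sum.cong refl 2)
    finally show "(\<Sum>b\<in>UNIV. \<Sum>c\<in>UNIV. \<Sum>i\<in>UNIV. \<Sum>j\<in>UNIV. \<Sum>k\<in>UNIV. f a b c i j k)
      = (\<Sum>i\<in>UNIV. \<Sum>b\<in>UNIV. \<Sum>j\<in>UNIV. \<Sum>c\<in>UNIV. \<Sum>k\<in>UNIV. f a b c i j k)" .
  qed
qed

text \<open>The inverse metric in the basis of matrix units pairs \<open>mat_unit A A'\<close> with
  \<open>mat_unit (3 - A) (3 - A')\<close>, with sign $+1$ exactly if \<open>A = A'\<close>.\<close>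

definition triple_contraction :: "(real^2^2 \<Rightarrow> real^2^2 \<Rightarrow> real^2^2 \<Rightarrow> real) \<Rightarrow> (real^2^2 \<Rightarrow> real^2^2 \<Rightarrow> real^2^2 \<Rightarrow> real) \<Rightarrow> real" where
  "triple_contraction f h = (\<Sum>A\<in>UNIV. \<Sum>A'\<in>UNIV. \<Sum>B\<in>UNIV. \<Sum>B'\<in>UNIV. \<Sum>C\<in>UNIV. \<Sum>C'\<in>UNIV.
     (-1) ^ (if A = A' then 0 else 1) * (-1) ^ (if B = B' then 0 else 1) * (-1) ^ (if C = C' then 0 else 1)
     * f (mat_unit A A') (mat_unit B B') (mat_unit C C') * h (mat_unit (3 - A) (3 - A')) (mat_unit (3 - B) (3 - B')) (mat_unit (3 - C) (3 - C')))"

lemma contract_pair':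
  fixes s :: "4 \<Rightarrow> real^2^2" and f h :: "real^2^2 \<Rightarrow> real"
  assumes M: "\<And>A A' B B'. (\<Sum>a\<in>UNIV. \<Sum>i\<in>UNIV. M a i * s a $ A $ A' * s i $ B $ B') = eps $ A $ B * eps $ A' $ B'"
    and f: "linear f" and h: "linear h"
  shows "(\<Sum>a\<in>UNIV. \<Sum>i\<in>UNIV. M a i * (f (s a) * h (s i)))
    = (\<Sum>A\<in>UNIV. \<Sum>A'\<in>UNIV. (-1) ^ (if A = A' then 0 else 1) * (f (mat_unit A A') * h (mat_unit (3 - A) (3 - A'))))"
proof -
  \<comment> \<open>Arithmetic modulo two: \<open>3 - A\<close> exchanges the two spinor
    indices.\<close>
  have "(3::2) - 1 = 2" "(3::2) - 2 = 1" by simp_all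
  then show ?thesis unfolding contract_pair[OF M f h] sum_2 by simp
qed

lemma contract_triple:
  fixes s :: "4 \<Rightarrow> real^2^2"
  assumes M: "\<And>A A' B B'. (\<Sum>a\<in>UNIV. \<Sum>i\<in>UNIV. M a i * s a $ A $ A' * s i $ B $ B') = eps $ A $ B * eps $ A' $ B'"
    and f: "\<And>Y Z. linear (\<lambda>X. f X Y Z)" "\<And>X Z. linear (\<lambda>Y. f X Y Z)" "\<And>X Y. linear (f X Y)"
    and h: "\<And>Y Z. linear (\<lambda>X. h X Y Z)" "\<And>X Z. linear (\<lambda>Y. h X Y Z)" "\<And>X Y. linear (h X Y)"
  shows "(\<Sum>a\<in>UNIV. \<Sum>b\<in>UNIV. \<Sum>c\<in>UNIV. \<Sum>i\<in>UNIV. \<Sum>j\<in>UNIV. \<Sum>k\<in>UNIV.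
     f (s a) (s b) (s c) * M a i * M b j * M c k * h (s i) (s j) (s k)) = triple_contraction f h"
proof -
  define \<epsilon> where "\<epsilon> A A' = (-1::real) ^ (if A = A' then 0 else 1)" for A A' :: 2
  have "(\<Sum>a\<in>UNIV. \<Sum>i\<in>UNIV. \<Sum>b\<in>UNIV. \<Sum>j\<in>UNIV. \<Sum>c\<in>UNIV. \<Sum>k\<in>UNIV.
      f (s a) (s b) (s c) * M a i * M b j * M c k * h (s i) (s j) (s k))
    = (\<Sum>a\<in>UNIV. \<Sum>i\<in>UNIV. M a i * (\<Sum>b\<in>UNIV. \<Sum>j\<in>UNIV. M b j *
        (\<Sum>c\<in>UNIV. \<Sum>k\<in>UNIV. M c k * (f (s a) (s b) (s c) * h (s i) (s j) (s k)))))"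
    by (simp add: sum_distrib_left mult_ac)
  also have "\<dots> = (\<Sum>a\<in>UNIV. \<Sum>i\<in>UNIV. M a i * (\<Sum>C\<in>UNIV. \<Sum>C'\<in>UNIV. \<epsilon> C C' *
      (\<Sum>b\<in>UNIV. \<Sum>j\<in>UNIV. M b j *
        (f (s a) (s b) (mat_unit C C') * h (s i) (s j) (mat_unit (3 - C) (3 - C'))))))"
    unfolding contract_pair'[OF M f(3) h(3)] \<epsilon>_def[symmetric] sum_2
    by (simp add: sum_distrib_left sum.distrib algebra_simps)
  also have "\<dots> = (\<Sum>C\<in>UNIV. \<Sum>C'\<in>UNIV. \<epsilon> C C' * (\<Sum>B\<in>UNIV. \<Sum>B'\<in>UNIV. \<epsilon> B B' *
      (\<Sum>a\<in>UNIV. \<Sum>i\<in>UNIV. M a i *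
        (f (s a) (mat_unit B B') (mat_unit C C') * h (s i) (mat_unit (3 - B) (3 - B')) (mat_unit (3 - C) (3 - C'))))))"
    unfolding contract_pair'[OF M f(2) h(2)] \<epsilon>_def[symmetric] sum_2
    by (simp add: sum_distrib_left sum.distrib algebra_simps)
  also have "\<dots> = triple_contraction f h"
    unfolding contract_pair'[OF M f(1) h(1)] \<epsilon>_def[symmetric] triple_contraction_def
    unfolding sum_2 by (simp add: algebra_simps)
  finally show ?thesis by (rule trans[OF sum_interleave])
qed

text \<open>Carrying out the primed sums first, as products of brackets, keeps the eightfold sum of
  the volume form small enough to expand.\<close>

lemma sum_eps_pairs:
  "(\<Sum>A'\<in>UNIV. \<Sum>B'\<in>UNIV. \<Sum>C'\<in>UNIV. \<Sum>D'\<in>UNIV.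
      (p * eps $ A' $ D' * eps $ B' $ C' - q * eps $ A' $ C' * eps $ B' $ D') * x $ A' * y $ B' * z $ C' * w $ D')
    = p * spin_bracket x w * spin_bracket y z - q * spin_bracket x z * spin_bracket y w"
  by (simp add: sum_2 spin_bracket_def algebra_simps)

lemma vol_spin_explicit:
  "vol_spin X Y Z W =
     X $ 1 $ 1 * (Y $ 1 $ 2 * (- Z $ 2 $ 1 * W $ 2 $ 2 + Z $ 2 $ 2 * W $ 2 $ 1) + Y $ 2 $ 1 * (Z $ 1 $ 2 * W $ 2 $ 2 - Z $ 2 $ 2 * W $ 1 $ 2) + Y $ 2 $ 2 * (- Z $ 1 $ 2 * W $ 2 $ 1 + Z $ 2 $ 1 * W $ 1 $ 2))
     + X $ 1 $ 2 * (Y $ 1 $ 1 * (Z $ 2 $ 1 * W $ 2 $ 2 - Z $ 2 $ 2 * W $ 2 $ 1) + Y $ 2 $ 1 * (- Z $ 1 $ 1 * W $ 2 $ 2 + Z $ 2 $ 2 * W $ 1 $ 1) + Y $ 2 $ 2 * (Z $ 1 $ 1 * W $ 2 $ 1 - Z $ 2 $ 1 * W $ 1 $ 1))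
     + X $ 2 $ 1 * (Y $ 1 $ 1 * (- Z $ 1 $ 2 * W $ 2 $ 2 + Z $ 2 $ 2 * W $ 1 $ 2) + Y $ 1 $ 2 * (Z $ 1 $ 1 * W $ 2 $ 2 - Z $ 2 $ 2 * W $ 1 $ 1) + Y $ 2 $ 2 * (- Z $ 1 $ 1 * W $ 1 $ 2 + Z $ 1 $ 2 * W $ 1 $ 1))
     + X $ 2 $ 2 * (Y $ 1 $ 1 * (Z $ 1 $ 2 * W $ 2 $ 1 - Z $ 2 $ 1 * W $ 1 $ 2) + Y $ 1 $ 2 * (- Z $ 1 $ 1 * W $ 2 $ 1 + Z $ 2 $ 1 * W $ 1 $ 1) + Y $ 2 $ 1 * (Z $ 1 $ 1 * W $ 1 $ 2 - Z $ 1 $ 2 * W $ 1 $ 1))"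
  unfolding vol_spin_def sum_eps_pairs
  by (simp add: sum_2 spin_bracket_def algebra_simps)

lemma linear_vol_spin:
  "linear (\<lambda>Y. vol_spin X Y Z W)" "linear (\<lambda>Z. vol_spin X Y Z W)" "linear (vol_spin X Y Z)"
  by (rule linearI; simp add: vol_spin_explicit ring_distribs)+

lemma linear_spin_metric: "linear (\<lambda>X. spin_metric X Y)"
  by (rule linearI) (simp_all add: spin_metric_def algebra_simps)

lemma linear_two_form: "linear (\<lambda>Y. two_form \<phi> \<psi> X Y)" "linear (\<lambda>X. two_form \<phi> \<psi> X Y)"
  by (rule linearI; simp add: two_form_explicit algebra_simps)+

text \<open>The star of a one-form wedge a two-form is the dual of the two-form with the
  corresponding vector in its second slot, and duality is +1 on the \<psi> half and -1 on the \<phi>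
  half. The orientation enters here. The factor 6 cancels the 1/6 of \<open>star3\<close>; the
  factors 2 anticipate that dK is twice the covariant derivative of \<open>K\<close>.\<close>

lemma star_wedge_spin:
  fixes N \<phi> \<psi> :: "real^2^2"
  assumes sym: "transpose \<phi> = \<phi>" "transpose \<psi> = \<psi>"
  defines "\<alpha> \<equiv> \<lambda>X Y Z. spin_metric X N * (2 * two_form \<phi> \<psi> Y Z)
    + spin_metric Y N * (2 * two_form \<phi> \<psi> Z X) + spin_metric Z N * (2 * two_form \<phi> \<psi> X Y)"
  shows "triple_contraction (vol_spin D) \<alpha> = 6 * (2 * two_form 0 \<psi> D N - 2 * two_form \<phi> 0 D N)"
proof -
  have s: "\<phi> $ 2 $ 1 = \<phi> $ 1 $ 2" "\<psi> $ 2 $ 1 = \<psi> $ 1 $ 2"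
    using sym by (auto intro: symmetric_2)
  have 3: "(3::2) - 1 = 2" "(3::2) - 2 = 1" by simp_all
  \<comment> \<open>Alternation removes repeated matrix units, so just the 24 orderings of three
    distinct units contribute.\<close>
  have alt: "vol_spin D Y Y Z = 0" "vol_spin D Y Z Y = 0" "vol_spin D Z Y Y = 0" for Y Z
    by (simp_all add: vol_spin_explicit algebra_simps)
  have vol: "vol_spin D (mat_unit 1 1) (mat_unit 1 2) (mat_unit 2 1) = D $ 2 $ 2"
    "vol_spin D (mat_unit 1 1) (mat_unit 1 2) (mat_unit 2 2) = - D $ 2 $ 1"
    "vol_spin D (mat_unit 1 1) (mat_unit 2 1) (mat_unit 1 2) = - D $ 2 $ 2"
    "vol_spin D (mat_unit 1 1) (mat_unit 2 1) (mat_unit 2 2) = D $ 1 $ 2"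
    "vol_spin D (mat_unit 1 1) (mat_unit 2 2) (mat_unit 1 2) = D $ 2 $ 1"
    "vol_spin D (mat_unit 1 1) (mat_unit 2 2) (mat_unit 2 1) = - D $ 1 $ 2"
    "vol_spin D (mat_unit 1 2) (mat_unit 1 1) (mat_unit 2 1) = - D $ 2 $ 2"
    "vol_spin D (mat_unit 1 2) (mat_unit 1 1) (mat_unit 2 2) = D $ 2 $ 1"
    "vol_spin D (mat_unit 1 2) (mat_unit 2 1) (mat_unit 1 1) = D $ 2 $ 2"
    "vol_spin D (mat_unit 1 2) (mat_unit 2 1) (mat_unit 2 2) = - D $ 1 $ 1"
    "vol_spin D (mat_unit 1 2) (mat_unit 2 2) (mat_unit 1 1) = - D $ 2 $ 1"
    "vol_spin D (mat_unit 1 2) (mat_unit 2 2) (mat_unit 2 1) = D $ 1 $ 1"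
    "vol_spin D (mat_unit 2 1) (mat_unit 1 1) (mat_unit 1 2) = D $ 2 $ 2"
    "vol_spin D (mat_unit 2 1) (mat_unit 1 1) (mat_unit 2 2) = - D $ 1 $ 2"
    "vol_spin D (mat_unit 2 1) (mat_unit 1 2) (mat_unit 1 1) = - D $ 2 $ 2"
    "vol_spin D (mat_unit 2 1) (mat_unit 1 2) (mat_unit 2 2) = D $ 1 $ 1"
    "vol_spin D (mat_unit 2 1) (mat_unit 2 2) (mat_unit 1 1) = D $ 1 $ 2"
    "vol_spin D (mat_unit 2 1) (mat_unit 2 2) (mat_unit 1 2) = - D $ 1 $ 1"
    "vol_spin D (mat_unit 2 2) (mat_unit 1 1) (mat_unit 1 2) = - D $ 2 $ 1"
    "vol_spin D (mat_unit 2 2) (mat_unit 1 1) (mat_unit 2 1) = D $ 1 $ 2"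
    "vol_spin D (mat_unit 2 2) (mat_unit 1 2) (mat_unit 1 1) = D $ 2 $ 1"
    "vol_spin D (mat_unit 2 2) (mat_unit 1 2) (mat_unit 2 1) = - D $ 1 $ 1"
    "vol_spin D (mat_unit 2 2) (mat_unit 2 1) (mat_unit 1 1) = - D $ 1 $ 2"
    "vol_spin D (mat_unit 2 2) (mat_unit 2 1) (mat_unit 1 2) = D $ 1 $ 1"
    by (simp_all add: vol_spin_explicit)
  have \<alpha>: "\<alpha> X Y Z = spin_metric X N * (2 * two_form \<phi> \<psi> Y Z)
    + spin_metric Y N * (2 * two_form \<phi> \<psi> Z X) + spin_metric Z N * (2 * two_form \<phi> \<psi> X Y)" for X Y Z
    by (simp add: \<alpha>_def)
  have metric: "spin_metric (mat_unit 1 1) N = N $ 2 $ 2" "spin_metric (mat_unit 1 2) N = - N $ 2 $ 1"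
    "spin_metric (mat_unit 2 1) N = - N $ 1 $ 2" "spin_metric (mat_unit 2 2) N = N $ 1 $ 1"
    by (simp_all add: spin_metric_def)
  have form: "two_form \<phi> \<psi> (mat_unit 1 1) (mat_unit 1 2) = \<phi> $ 1 $ 1" "two_form \<phi> \<psi> (mat_unit 1 2) (mat_unit 1 1) = - \<phi> $ 1 $ 1"
    "two_form \<phi> \<psi> (mat_unit 1 1) (mat_unit 2 1) = \<psi> $ 1 $ 1" "two_form \<phi> \<psi> (mat_unit 2 1) (mat_unit 1 1) = - \<psi> $ 1 $ 1"
    "two_form \<phi> \<psi> (mat_unit 1 1) (mat_unit 2 2) = \<phi> $ 1 $ 2 + \<psi> $ 1 $ 2" "two_form \<phi> \<psi> (mat_unit 2 2) (mat_unit 1 1) = - \<phi> $ 1 $ 2 - \<psi> $ 1 $ 2"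
    "two_form \<phi> \<psi> (mat_unit 1 2) (mat_unit 2 1) = \<psi> $ 1 $ 2 - \<phi> $ 1 $ 2" "two_form \<phi> \<psi> (mat_unit 2 1) (mat_unit 1 2) = \<phi> $ 1 $ 2 - \<psi> $ 1 $ 2"
    "two_form \<phi> \<psi> (mat_unit 1 2) (mat_unit 2 2) = \<psi> $ 2 $ 2" "two_form \<phi> \<psi> (mat_unit 2 2) (mat_unit 1 2) = - \<psi> $ 2 $ 2"
    "two_form \<phi> \<psi> (mat_unit 2 1) (mat_unit 2 2) = \<phi> $ 2 $ 2" "two_form \<phi> \<psi> (mat_unit 2 2) (mat_unit 2 1) = - \<phi> $ 2 $ 2"
    by (simp_all add: two_form_explicit s)
  show ?thesis
    unfolding triple_contraction_def sum_2 3 vol alt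
    unfolding \<alpha> metric form two_form_explicit s
    by (simp add: algebra_simps)
qed

section \<open>Structure equations of the invariant coframe\<close>

lemma pd_bilinear:
  assumes "bounded_bilinear pr" "f differentiable (at x)" "g differentiable (at x)"
  shows "pd (\<lambda>z. pr (f z) (g z)) x i = pr (f x) (pd g x i) + pr (pd f x i) (g x)"
  unfolding pd_def
  by (rule dird_eq[OF bounded_bilinear.FDERIV[OF assms(1) assms(2,3)[unfolded frechet_derivative_works]]])

lemma smooth_on_bilinear:
  "bounded_bilinear pr \<Longrightarrow> open S \<Longrightarrow> smooth_on f S \<Longrightarrow> smooth_on g S \<Longrightarrow> smooth_on (\<lambda>x. pr (f x) (g x)) S"
  by (simp add: smooth_on_def Ck_on_bilinear)

text \<open>All four spinor operations are bilinear, so their smoothness and product rules are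
  instances of one general fact.\<close>

lemma bounded_bilinear_spin:
  "bounded_bilinear spin_metric" "bounded_bilinear spin_bracket" "bounded_bilinear spin_tensor" "bounded_bilinear contract'"
  unfolding bilinear_conv_bounded_bilinear[symmetric] bilinear_def
  by (auto intro!: linearI simp: spin_metric_def spin_bracket_def spin_tensor_def contract'_def vec_eq_iff algebra_simps)

lemmas smooth_on_spin = bounded_bilinear_spin[THEN smooth_on_bilinear]
lemmas pd_spin = bounded_bilinear_spin[THEN pd_bilinear]

lemma contract'_decompose:
  assumes "spin_bracket o' \<iota> = 1"
  shows "X = spin_tensor (contract' X \<iota>) o' - spin_tensor (contract' X o') \<iota>"
proof -
  have "spin_bracket o' \<iota> * X $ A $ B = (spin_tensor (contract' X \<iota>) o' - spin_tensor (contract' X o') \<iota>) $ A $ B" for A B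
    using exhaust_2[of B] by (auto simp: spin_defs algebra_simps)
  then show ?thesis using assms by (simp add: vec_eq_iff)
qed

text \<open>A 2 by 2 matrix rescales the area form by its determinant, which is half of
  \<open>spin_metric X X\<close>. This produces the n/2 in the frame adapted to
  \<open>K\<close>.\<close>

lemma spin_bracket_contract'_contract':
  "spin_bracket (contract' X a) (contract' X b) = spin_metric X X / 2 * spin_bracket a b"
  by (simp add: spin_defs algebra_simps)

lemma matrix_inv_left: "invertible A \<Longrightarrow> matrix_inv A ** A = mat 1"
  unfolding invertible_def matrix_inv_def by (rule someI2_ex) auto

lemma invertible_neutral_form:
  assumes "neutral_form G"
  shows "invertible G"
proof -
  obtain P :: "real^4^4" where P: "transpose P ** G ** P = (\<chi> i j. if i \<noteq> j then 0 else if i = 1 \<or> i = 2 then 1 else -1)"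
    using assms unfolding neutral_form_def by blast
  have "det (transpose P ** G ** P) \<noteq> 0"
    unfolding P by (subst det_diagonal) simp_all
  then show ?thesis by (simp add: det_mul invertible_det_nz)
qed

text \<open>The setting of one chart, cut down to the part where |K|^2 is nonzero. The invariance
  condition on \<psi> is purely algebraic here, because the derivative term of the Lie derivative is
  zero for a parallel spinor.\<close>

locale null_kahler_chart =
  fixes U :: "(real^4) set" and g :: metric and \<sigma> :: solder
    and \<omega> \<omega>' :: "real^4 \<Rightarrow> 4 \<Rightarrow> real^2^2" and \<iota> :: "real^4 \<Rightarrow> real^2" and K :: "real^4 \<Rightarrow> real^4"
  assumes U: "open U"
    and smooth: "smooth_on g U" "smooth_on \<sigma> U" "smooth_on \<iota> U" "smooth_on K U"
    and neutral: "x \<in> U \<Longrightarrow> neutral_form (g x)"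
    and solder: "solders g \<sigma> U"
    and connection: "spin_connection g \<sigma> \<omega> \<omega>' U"
    and nonzero: "x \<in> U \<Longrightarrow> \<iota> x \<noteq> 0"
    and parallel: "x \<in> U \<Longrightarrow> nabla_spinor' \<omega>' \<iota> x a = 0"
    and preserves: "x \<in> U \<Longrightarrow> \<exists>\<phi> \<psi>. transpose \<phi> = \<phi> \<and> transpose \<psi> = \<psi> \<and>
      (\<forall>a b. nabla_lower g K x a b = two_form \<phi> \<psi> (\<sigma> x $ a) (\<sigma> x $ b)) \<and> (eps ** \<psi>) *v \<iota> x = 0"
    and norm: "x \<in> U \<Longrightarrow> norm2 g K x \<noteq> 0"
begin

abbreviation "n \<equiv> norm2 g K"

text \<open>The spinor components $K^{AA'}$ of \<open>K\<close>.\<close>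

definition "kill x = (\<Sum>c\<in>UNIV. K x $ c *\<^sub>R \<sigma> x $ c)"

text \<open>\<open>dual\<close>, \<open>kappa\<close>, \<open>tau\<close> are the spinor fields $o$, $\kappa$, $\tau$.\<close>

definition dual :: "real^4 \<Rightarrow> real^2" where
  "dual x = (1 / (\<iota> x $ 1 * \<iota> x $ 1 + \<iota> x $ 2 * \<iota> x $ 2)) *\<^sub>R (\<chi> A. if A = 1 then \<iota> x $ 2 else - \<iota> x $ 1)"

definition "kappa x = contract' (kill x) (\<iota> x)"

definition "tau x = (- 2 / n x) *\<^sub>R contract' (kill x) (dual x)"

definition "coframe a b x = (\<chi> c. spin_metric (\<sigma> x $ c) (spin_tensor (a x) (b x)))"

text \<open>The covariant derivative of the spinor components of \<open>K\<close>: both spin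
  connections act, and no Christoffel symbol occurs because the coordinate index of \<open>K\<close>
  has been traded for spinor indices.\<close>

definition "nabla_kill x i = (\<chi> A A'. pd kill x i $ A $ A'
  + (\<omega> x i $ A $ 1 * kill x $ 1 $ A' + \<omega> x i $ A $ 2 * kill x $ 2 $ A')
  + (\<omega>' x i $ A' $ 1 * kill x $ A $ 1 + \<omega>' x i $ A' $ 2 * kill x $ A $ 2))"

lemma metric_eq: "x \<in> U \<Longrightarrow> g x $ a $ b = spin_metric (\<sigma> x $ a) (\<sigma> x $ b)"
  using solder unfolding solders_def spin_metric_sum by blast

lemma lower_eq: "x \<in> U \<Longrightarrow> lower g K x $ a = spin_metric (\<sigma> x $ a) (kill x)"
proof -
  interpret l: linear "spin_metric X" for X
    by (rule linearI) (simp_all add: spin_metric_add spin_metric_scaleR)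
  assume "x \<in> U"
  then show ?thesis
    by (simp add: lower_def matrix_vector_mult_def metric_eq kill_def l.sum l.scaleR mult.commute)
qed

lemma norm2_eq: "x \<in> U \<Longrightarrow> n x = spin_metric (kill x) (kill x)"
proof -
  interpret l: linear "\<lambda>X. spin_metric X Y" for Y by (rule linear_spin_metric)
  assume x: "x \<in> U"
  have "n x = (\<Sum>a\<in>UNIV. K x $ a * lower g K x $ a)"
    by (simp add: norm2_def lower_def matrix_vector_mult_def sum_distrib_left mult_ac)
  also have "\<dots> = spin_metric (kill x) (kill x)"
    by (subst (1) kill_def) (simp add: lower_eq[OF x] l.sum l.scaleR)
  finally show ?thesis .
qed

text \<open>Nondegeneracy of \<open>g\<close> makes the soldering map injective, and dimensions
  agree. Linear identities known on the matrices \<open>\<sigma> x $ a\<close> thereby extend to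
  every spinor matrix.\<close>

lemma tetrad_surj:
  assumes x: "x \<in> U"
  shows "\<exists>v. (\<Sum>a\<in>UNIV. v $ a *\<^sub>R \<sigma> x $ a) = N"
proof -
  define flat :: "real^2^2 \<Rightarrow> real^4" where
    "flat M = (\<chi> i. if i = 1 then M $ 1 $ 1 else if i = 2 then M $ 1 $ 2 else if i = 3 then M $ 2 $ 1 else M $ 2 $ 2)" for M
  define L where "L v = (\<Sum>a\<in>UNIV. v $ a *\<^sub>R \<sigma> x $ a)" for v
  have flat_inj: "flat M = flat M' \<Longrightarrow> M = M'" for M M'
    unfolding vec_eq_iff forall_2 forall_4 by (simp add: flat_def)
  have lin: "linear (\<lambda>v. flat (L v))"
    unfolding vec_eq_iff forall_4
    by (rule linearI) (auto simp: flat_def L_def vec_eq_iff algebra_simps sum.distrib sum_distrib_left)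
  have "v = 0" if "flat (L v) = 0" for v
  proof -
    interpret l: linear "spin_metric X" for X
      by (rule linearI) (simp_all add: spin_metric_add spin_metric_scaleR)
    have "flat (L v) = flat 0" using that by (simp add: flat_def vec_eq_iff)
    then have L0: "L v = 0" by (rule flat_inj)
    have "(g x *v v) $ a = spin_metric (\<sigma> x $ a) (L v)" for a
      by (simp add: matrix_vector_mult_def metric_eq[OF x] L_def l.sum l.scaleR mult.commute)
    then have "g x *v v = 0" by (simp add: vec_eq_iff L0 l.zero)
    moreover obtain B where "B ** g x = mat 1"
      using invertible_neutral_form[OF neutral[OF x]] by (auto simp: invertible_def)
    ultimately show ?thesis
      by (metis matrix_vector_mul_assoc matrix_vector_mul_lid matrix_vector_mult_0_right)
  qed
  then have "inj (\<lambda>v. flat (L v))" using linear_injective_0[OF lin] by blast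
  then have "surj (\<lambda>v. flat (L v))" using linear_injective_imp_surjective[OF lin] by simp
  then obtain v where "flat N = flat (L v)" by (metis surjD)
  then show ?thesis using flat_inj unfolding L_def by metis
qed

lemma ginv_contract:
  assumes x: "x \<in> U"
  shows "(\<Sum>a\<in>UNIV. \<Sum>i\<in>UNIV. ginv g x $ a $ i * \<sigma> x $ a $ A $ A' * \<sigma> x $ i $ B $ B') = eps $ A $ B * eps $ A' $ B'"
proof -
  interpret l: linear "spin_metric X" for X
    by (rule linearI) (simp_all add: spin_metric_add spin_metric_scaleR)
  \<comment> \<open>Chosen so that the inner product with \<open>N\<close> reads off the entry
    \<open>B B'\<close>; the vector soldered to \<open>N\<close> is then the raised form of that
    column of \<sigma>.\<close>
  define N :: "real^2^2" where "N = (\<chi> C C'. eps $ C $ B * eps $ C' $ B')"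
  obtain v where v: "(\<Sum>a\<in>UNIV. v $ a *\<^sub>R \<sigma> x $ a) = N" using tetrad_surj[OF x] by blast
  have N: "spin_metric Z N = Z $ B $ B'" for Z
    using exhaust_2[of B] exhaust_2[of B'] by (auto simp: spin_metric_def N_def)
  have gv: "(g x *v v) $ i = \<sigma> x $ i $ B $ B'" for i
    unfolding N[symmetric] v[symmetric]
    by (simp add: matrix_vector_mult_def metric_eq[OF x] l.sum l.scaleR mult.commute)
  have "ginv g x ** g x = mat 1"
    unfolding ginv_def by (rule matrix_inv_left[OF invertible_neutral_form[OF neutral[OF x]]])
  then have "ginv g x *v (g x *v v) = v"
    by (simp add: matrix_vector_mul_assoc)
  then have "v $ a = (\<Sum>i\<in>UNIV. ginv g x $ a $ i * \<sigma> x $ i $ B $ B')" for a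
    by (metis (no_types, lifting) gv matrix_vector_mult_def sum.cong vec_lambda_beta)
  then have "(\<Sum>a\<in>UNIV. \<Sum>i\<in>UNIV. ginv g x $ a $ i * \<sigma> x $ a $ A $ A' * \<sigma> x $ i $ B $ B')
    = (\<Sum>a\<in>UNIV. v $ a * \<sigma> x $ a $ A $ A')"
    by (simp add: sum_distrib_left sum_distrib_right mult_ac)
  also have "\<dots> = (\<Sum>a\<in>UNIV. v $ a *\<^sub>R \<sigma> x $ a) $ A $ A'" by simp
  finally show ?thesis unfolding v by (simp add: N_def)
qed

text \<open>\<open>dual\<close> is \<iota> turned by a right angle and divided by the square of its
  Euclidean length in the spin frame, a smooth choice since \<iota> has no zeros.\<close>

lemma dual_bracket: "x \<in> U \<Longrightarrow> spin_bracket (dual x) (\<iota> x) = 1"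
proof -
  assume "x \<in> U"
  then have "\<iota> x $ 1 \<noteq> 0 \<or> \<iota> x $ 2 \<noteq> 0" using nonzero by (auto simp: vec_eq_iff forall_2)
  then have "\<iota> x $ 1 * \<iota> x $ 1 + \<iota> x $ 2 * \<iota> x $ 2 \<noteq> 0" by (simp add: sum_squares_eq_zero_iff)
  then show ?thesis by (simp add: spin_bracket_def dual_def add_divide_distrib[symmetric] add.commute)
qed

text \<open>The contractions of \<open>K\<close> with \<iota> and with o have bracket -n/2; this is
  the origin of the factor -2/n in \<open>tau\<close>.\<close>

lemma kappa_tau_bracket: "x \<in> U \<Longrightarrow> spin_bracket (kappa x) (tau x) = 1"
proof -
  assume x: "x \<in> U"
  have "spin_bracket (\<iota> x) (dual x) = - 1"
    using dual_bracket[OF x] by (simp add: spin_bracket_def algebra_simps)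
  then have "spin_bracket (kappa x) (contract' (kill x) (dual x)) = - n x / 2"
    by (simp add: kappa_def spin_bracket_contract'_contract' norm2_eq[OF x])
  then show ?thesis
    unfolding tau_def bounded_bilinear.scaleR_right[OF bounded_bilinear_spin(2)]
    using norm[OF x] by simp
qed

lemma kill_decompose:
  "x \<in> U \<Longrightarrow> kill x = spin_tensor (kappa x) (dual x) + (n x / 2) *\<^sub>R spin_tensor (tau x) (\<iota> x)"
proof -
  assume x: "x \<in> U"
  have "contract' (kill x) (dual x) = - (n x / 2) *\<^sub>R tau x"
    using norm[OF x] by (simp add: tau_def)
  then show ?thesis
    using contract'_decompose[OF dual_bracket[OF x], of "kill x"]
      bounded_bilinear.scaleR_left[OF bounded_bilinear_spin(3), of "- (n x / 2)" "tau x" "\<iota> x"]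
    by (simp add: kappa_def)
qed

lemma smooth_sigma: "smooth_on (\<lambda>x. \<sigma> x $ c) U"
  by (rule smooth_on_vec_nth[OF U smooth(2)])

lemma smooth_kill: "smooth_on kill U"
  unfolding kill_def by (intro smooth_on_sum smooth_on_scaleR smooth_on_vec_nth U smooth)

lemma smooth_n: "smooth_on n U"
  by (rule smooth_on_cong[OF U smooth_on_spin(1)[OF U smooth_kill smooth_kill]]) (simp add: norm2_eq)

lemma smooth_dual: "smooth_on dual U"
proof -
  have "\<iota> x $ 1 * \<iota> x $ 1 + \<iota> x $ 2 * \<iota> x $ 2 \<noteq> 0" if "x \<in> U" for x
    using nonzero[OF that] by (auto simp: vec_eq_iff forall_2 sum_squares_eq_zero_iff)
  moreover have "smooth_on (\<lambda>x. (\<chi> A. if A = 1 then \<iota> x $ 2 else - \<iota> x $ 1) :: real^2) U"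
  proof (rule smooth_on_vec_lambda[OF U])
    show "smooth_on (\<lambda>x. if A = 1 then \<iota> x $ 2 else - \<iota> x $ 1) U" for A :: 2
      by (cases "A = 1") (simp_all add: smooth_on_vec_nth[OF U smooth(3)] smooth_on_minus[OF U smooth_on_vec_nth[OF U smooth(3)]])
  qed
  ultimately show ?thesis
    unfolding dual_def
    by (intro smooth_on_scaleR smooth_on_divide smooth_on_const smooth_on_add smooth_on_mult smooth_on_vec_nth U smooth(3)) auto
qed

lemma smooth_kappa: "smooth_on kappa U"
  unfolding kappa_def by (rule smooth_on_spin(4)[OF U smooth_kill smooth(3)])

lemma smooth_tau: "smooth_on tau U"
  unfolding tau_def
  by (intro smooth_on_scaleR smooth_on_divide smooth_on_const smooth_on_spin(4) U smooth_kill smooth_dual smooth_n norm)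

lemma smooth_coframe: "smooth_on a U \<Longrightarrow> smooth_on b U \<Longrightarrow> smooth_on (coframe a b) U"
  unfolding coframe_def by (intro smooth_on_vec_lambda smooth_on_spin U smooth_sigma)

lemma differentiable: "smooth_on f U \<Longrightarrow> x \<in> U \<Longrightarrow> f differentiable (at x)"
  using smooth_on_differentiable U by blast

lemma tracefree:
  assumes "x \<in> U"
  shows "\<omega> x i $ 2 $ 2 = - \<omega> x i $ 1 $ 1" "\<omega>' x i $ 2 $ 2 = - \<omega>' x i $ 1 $ 1"
  using connection assms unfolding spin_connection_def trace_def sum_2 by (auto simp: add_eq_0_iff)

section \<open>Levi-Civita derivatives in terms of spinors\<close>

lemma christoffel_sym:
  assumes x: "x \<in> U"
  shows "christoffel g x a b c = christoffel g x a c b"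
proof -
  have d: "g differentiable (at x)" by (rule differentiable[OF smooth(1) x])
  have dn: "(\<lambda>z. g z $ i) differentiable (at x)" for i
    by (rule differentiable[OF smooth_on_vec_nth[OF U smooth(1)] x])
  have dnn: "(\<lambda>z. g z $ i $ j) differentiable (at x)" for i j
    by (rule differentiable[OF smooth_on_vec_nth[OF U smooth_on_vec_nth[OF U smooth(1)]] x])
  have "pd g x e $ i $ j = pd g x e $ j $ i" for e i j
  proof -
    have "pd g x e $ i $ j = pd (\<lambda>z. g z $ i $ j) x e" for i j
      by (simp add: pd_nth[OF d] pd_nth[OF dn])
    moreover have "pd (\<lambda>z. g z $ i $ j) x e = pd (\<lambda>z. g z $ j $ i) x e"
      by (rule pd_cong[OF U x dnn]) (simp add: metric_eq spin_metric_commute)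
    ultimately show ?thesis by simp
  qed
  then show ?thesis unfolding christoffel_def by (simp add: algebra_simps)
qed

lemma pd_sigma:
  assumes x: "x \<in> U"
  shows "pd \<sigma> x i $ j $ A $ A' = (\<Sum>c\<in>UNIV. christoffel g x c i j *\<^sub>R \<sigma> x $ c) $ A $ A'
    - (\<omega> x i $ A $ 1 * \<sigma> x $ j $ 1 $ A' + \<omega> x i $ A $ 2 * \<sigma> x $ j $ 2 $ A')
    - (\<omega>' x i $ A' $ 1 * \<sigma> x $ j $ A $ 1 + \<omega>' x i $ A' $ 2 * \<sigma> x $ j $ A $ 2)"
proof -
  have "pd \<sigma> x i $ j $ A $ A' - (\<Sum>c\<in>UNIV. christoffel g x c i j * \<sigma> x $ c $ A $ A')
    + (\<omega> x i $ A $ 1 * \<sigma> x $ j $ 1 $ A' + \<omega> x i $ A $ 2 * \<sigma> x $ j $ 2 $ A')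
    + (\<omega>' x i $ A' $ 1 * \<sigma> x $ j $ A $ 1 + \<omega>' x i $ A' $ 2 * \<sigma> x $ j $ A $ 2) = 0"
    using connection x unfolding spin_connection_def sum_2 by blast
  then show ?thesis by simp
qed

text \<open>The soldering form is parallel, and trace-free spin connections preserve both eps, so
  the covariant derivative passes to the spinor components of \<open>K\<close>.\<close>

lemma nabla_lower_eq:
  assumes x: "x \<in> U"
  shows "nabla_lower g K x i j = spin_metric (\<sigma> x $ j) (nabla_kill x i)"
proof -
  interpret l: linear "\<lambda>X. spin_metric X Y" for Y by (rule linear_spin_metric)
  define \<Gamma> where "\<Gamma> = (\<Sum>c\<in>UNIV. christoffel g x c i j *\<^sub>R \<sigma> x $ c)"
  have s: "smooth_on (\<lambda>z. \<chi> j. spin_metric (\<sigma> z $ j) (kill z)) U"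
    by (intro smooth_on_vec_lambda smooth_on_spin U smooth_sigma smooth_kill)
  have "pd (\<lambda>z. \<chi> j. spin_metric (\<sigma> z $ j) (kill z)) x i = pd (lower g K) x i"
    by (rule pd_cong[OF U x differentiable[OF s x]]) (simp add: vec_eq_iff lower_eq)
  then have "pd (lower g K) x i $ j = pd (\<lambda>z. spin_metric (\<sigma> z $ j) (kill z)) x i"
    using pd_nth[OF differentiable[OF s x], of j i] by simp
  also have "\<dots> = spin_metric (\<sigma> x $ j) (pd kill x i) + spin_metric (pd \<sigma> x i $ j) (kill x)"
    by (simp add: pd_spin(1)[OF differentiable[OF smooth_sigma x] differentiable[OF smooth_kill x]]
        pd_nth[OF differentiable[OF smooth(2) x]])
  finally have 1: "pd (lower g K) x i $ j = spin_metric (\<sigma> x $ j) (pd kill x i) + spin_metric (pd \<sigma> x i $ j) (kill x)" .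
  have 2: "(\<Sum>c\<in>UNIV. christoffel g x c i j * lower g K x $ c) = spin_metric \<Gamma> (kill x)"
    by (simp add: lower_eq[OF x] \<Gamma>_def l.sum l.scaleR)
  show ?thesis
    unfolding nabla_lower_def 1 2
    by (simp add: spin_metric_def nabla_kill_def pd_sigma[OF x] \<Gamma>_def[symmetric] tracefree[OF x] algebra_simps)
qed

text \<open>The exterior derivative is the antisymmetrised covariant one. The Christoffel terms
  cancel by symmetry and the soldering form is parallel, so only derivatives of the two spinors
  remain.\<close>

lemma ext_d_coframe:
  assumes a: "smooth_on a U" and b: "smooth_on b U" and x: "x \<in> U"
  shows "pd (coframe a b) x i $ j - pd (coframe a b) x j $ i
    = spin_metric (\<sigma> x $ j) (spin_tensor (nabla_spinor' \<omega> a x i) (b x) + spin_tensor (a x) (nabla_spinor' \<omega>' b x i))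
    - spin_metric (\<sigma> x $ i) (spin_tensor (nabla_spinor' \<omega> a x j) (b x) + spin_tensor (a x) (nabla_spinor' \<omega>' b x j))"
proof -
  define \<Gamma> where "\<Gamma> i j = (\<Sum>c\<in>UNIV. christoffel g x c i j *\<^sub>R \<sigma> x $ c)" for i j
  have \<Gamma>: "\<Gamma> i j = \<Gamma> j i" for i j unfolding \<Gamma>_def by (simp add: christoffel_sym[OF x, of _ i j])
  have "pd (coframe a b) x i $ j = spin_metric (\<Gamma> i j) (spin_tensor (a x) (b x))
    + spin_metric (\<sigma> x $ j) (spin_tensor (nabla_spinor' \<omega> a x i) (b x) + spin_tensor (a x) (nabla_spinor' \<omega>' b x i))" for i j
  proof -
    have "pd (coframe a b) x i $ j = pd (\<lambda>z. spin_metric (\<sigma> z $ j) (spin_tensor (a z) (b z))) x i"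
      using pd_nth[OF differentiable[OF smooth_coframe[OF a b] x], of j i] by (simp add: coframe_def)
    also have "\<dots> = spin_metric (\<sigma> x $ j) (spin_tensor (a x) (pd b x i) + spin_tensor (pd a x i) (b x))
        + spin_metric (pd \<sigma> x i $ j) (spin_tensor (a x) (b x))"
      by (simp add: pd_spin(1)[OF differentiable[OF smooth_sigma x] differentiable[OF smooth_on_spin(3)[OF U a b] x]]
          pd_spin(3)[OF differentiable[OF a x] differentiable[OF b x]] pd_nth[OF differentiable[OF smooth(2) x]])
    finally show ?thesis
      by (simp add: spin_metric_def spin_tensor_def nabla_spinor'_def matrix_vector_mult_def sum_2
          pd_sigma[OF x] \<Gamma>_def[symmetric] tracefree[OF x] algebra_simps)
  qed
  then show ?thesis using \<Gamma>[of i j] by simp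
qed

lemma pd_spin_bracket:
  assumes a: "smooth_on a U" and b: "smooth_on b U" and x: "x \<in> U" and tr: "w x i $ 2 $ 2 = - w x i $ 1 $ 1"
  shows "pd (\<lambda>z. spin_bracket (a z) (b z)) x i
    = spin_bracket (nabla_spinor' w a x i) (b x) + spin_bracket (a x) (nabla_spinor' w b x i)"
  unfolding pd_spin(2)[OF differentiable[OF a x] differentiable[OF b x]]
  by (simp add: spin_bracket_def nabla_spinor'_def
      matrix_vector_mult_def sum_2 tr algebra_simps)

lemma nabla_contract':
  assumes b: "smooth_on b U" and x: "x \<in> U"
  shows "nabla_spinor' \<omega> (\<lambda>z. contract' (kill z) (b z)) x i
    = contract' (nabla_kill x i) (b x) + contract' (kill x) (nabla_spinor' \<omega>' b x i)"
  unfolding nabla_spinor'_def pd_spin(4)[OF differentiable[OF smooth_kill x] differentiable[OF b x]]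
  by (simp add: vec_eq_iff forall_2 contract'_def nabla_kill_def matrix_vector_mult_def sum_2 tracefree[OF x] algebra_simps)

lemma nabla_scaleR:
  assumes "smooth_on f U" "smooth_on a U" "x \<in> U"
  shows "nabla_spinor' w (\<lambda>z. f z *\<^sub>R a z) x i = pd f x i *\<^sub>R a x + f x *\<^sub>R nabla_spinor' w a x i"
  by (simp add: nabla_spinor'_def pd_bilinear[OF bounded_bilinear_scaleR differentiable[OF assms(1,3)] differentiable[OF assms(2,3)]]
      matrix_vector_mult_scaleR algebra_simps)

lemma pd_norm2:
  assumes x: "x \<in> U"
  shows "pd n x i = 2 * spin_metric (nabla_kill x i) (kill x)"
proof -
  have "pd n x i = pd (\<lambda>z. spin_metric (kill z) (kill z)) x i"
    by (rule pd_cong[OF U x differentiable[OF smooth_n x]]) (simp add: norm2_eq)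
  also have "\<dots> = spin_metric (kill x) (pd kill x i) + spin_metric (pd kill x i) (kill x)"
    by (rule pd_spin(1)[OF differentiable[OF smooth_kill x] differentiable[OF smooth_kill x]])
  finally show ?thesis
    by (simp add: spin_metric_def nabla_kill_def tracefree[OF x] algebra_simps)
qed

text \<open>Invariance of a parallel spinor leaves just the condition that \<psi> annihilates it.
  Surjectivity of the soldering map replaces the second coordinate index by an arbitrary spinor
  matrix.\<close>

lemma nabla_kill_two_form:
  assumes x: "x \<in> U"
  shows "\<exists>\<phi> \<psi>. transpose \<phi> = \<phi> \<and> transpose \<psi> = \<psi> \<and> (\<forall>v. spin_form \<psi> v (\<iota> x) = 0) \<and>
    (\<forall>i Y. spin_metric (nabla_kill x i) Y = two_form \<phi> \<psi> (\<sigma> x $ i) Y)"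
proof -
  obtain \<phi> \<psi> where sym: "transpose \<phi> = \<phi>" "transpose \<psi> = \<psi>"
    and nabla: "\<And>a b. nabla_lower g K x a b = two_form \<phi> \<psi> (\<sigma> x $ a) (\<sigma> x $ b)"
    and \<psi>: "(eps ** \<psi>) *v \<iota> x = 0"
    using preserves[OF x] by blast
  have 2: "\<psi> $ 1 $ 1 * \<iota> x $ 1 + \<psi> $ 1 $ 2 * \<iota> x $ 2 = 0" "\<psi> $ 2 $ 1 * \<iota> x $ 1 + \<psi> $ 2 $ 2 * \<iota> x $ 2 = 0"
    using arg_cong[OF \<psi>, of "\<lambda>v. v $ 2"] arg_cong[OF \<psi>, of "\<lambda>v. v $ 1"]
    by (simp_all add: matrix_vector_mult_def matrix_matrix_mult_def sum_2)
  have "spin_form \<psi> v (\<iota> x) = v $ 1 * (\<psi> $ 1 $ 1 * \<iota> x $ 1 + \<psi> $ 1 $ 2 * \<iota> x $ 2) + v $ 2 * (\<psi> $ 2 $ 1 * \<iota> x $ 1 + \<psi> $ 2 $ 2 * \<iota> x $ 2)" for v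
    by (simp add: spin_form_def sum_2 algebra_simps)
  then have "spin_form \<psi> v (\<iota> x) = 0" for v by (simp add: 2)
  moreover have "spin_metric (nabla_kill x i) Y = two_form \<phi> \<psi> (\<sigma> x $ i) Y" for i Y
  proof -
    interpret l: linear "spin_metric X" for X
      by (rule linearI) (simp_all add: spin_metric_add spin_metric_scaleR)
    interpret q: linear "two_form \<phi> \<psi> X" for X
      by (rule linearI) (simp_all add: two_form_add two_form_scaleR)
    obtain v where v: "(\<Sum>a\<in>UNIV. v $ a *\<^sub>R \<sigma> x $ a) = Y" using tetrad_surj[OF x] by blast
    have "spin_metric (nabla_kill x i) (\<sigma> x $ j) = two_form \<phi> \<psi> (\<sigma> x $ i) (\<sigma> x $ j)" for j
      using nabla[of i j] nabla_lower_eq[OF x, of i j] by (simp add: spin_metric_commute)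
    then show ?thesis
      unfolding v[symmetric] by (simp add: l.sum l.scaleR q.sum q.scaleR)
  qed
  ultimately show ?thesis using sym by blast
qed

section \<open>The adapted coframe and its structure equations\<close>

definition "theta = coframe kappa \<iota>"

text \<open>On \<open>K\<close> the first form has the value n/2 and the second the value 1; the
  combination is the one that annihilates \<open>K\<close>.\<close>

definition "beta x = (\<chi> j. coframe kappa dual x $ j - n x / 2 * coframe tau \<iota> x $ j)"

definition "xi x = (\<chi> j. n x * coframe tau dual x $ j)"

lemma smooth_theta: "smooth_on theta U"
  unfolding theta_def by (rule smooth_coframe[OF smooth_kappa smooth(3)])

lemma smooth_beta: "smooth_on beta U"
  unfolding beta_def
  by (intro smooth_on_vec_lambda smooth_on_diff smooth_on_mult smooth_on_divide smooth_on_const smooth_on_vec_nth U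
      smooth_coframe smooth_kappa smooth_tau smooth_dual smooth(3) smooth_n) simp

lemma smooth_xi: "smooth_on xi U"
  unfolding xi_def
  by (intro smooth_on_vec_lambda smooth_on_mult smooth_on_vec_nth U smooth_coframe smooth_tau smooth_dual smooth_n)

text \<open>The covariant derivative of \<open>K\<close> is skew, so dK is twice it; the star then
  puts \<open>K\<close> in the second slot and reverses the sign of the \<phi> half.\<close>

lemma orbit_nu_eq:
  assumes x: "x \<in> U" and sym: "transpose \<phi> = \<phi>" "transpose \<psi> = \<psi>"
    and nabla: "\<And>i Y. spin_metric (nabla_kill x i) Y = two_form \<phi> \<psi> (\<sigma> x $ i) Y"
  shows "orbit_nu g \<sigma> K x d = 2 / n x * (2 * two_form 0 \<psi> (\<sigma> x $ d) (kill x) - 2 * two_form \<phi> 0 (\<sigma> x $ d) (kill x))"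
proof -
  define \<alpha> where "\<alpha> = (\<lambda>X Y Z. spin_metric X (kill x) * (2 * two_form \<phi> \<psi> Y Z)
    + spin_metric Y (kill x) * (2 * two_form \<phi> \<psi> Z X) + spin_metric Z (kill x) * (2 * two_form \<phi> \<psi> X Y))"
  have "ext_d (lower g K) x i j = nabla_lower g K x i j - nabla_lower g K x j i" for i j
    by (simp add: ext_d_def nabla_lower_def christoffel_sym[OF x, of _ i j])
  also have "\<dots> i j = 2 * two_form \<phi> \<psi> (\<sigma> x $ i) (\<sigma> x $ j)" for i j
    using two_form_antisym[OF sym, of "\<sigma> x $ j" "\<sigma> x $ i"]
    by (simp add: nabla_lower_eq[OF x] spin_metric_commute[of "\<sigma> x $ _"] nabla)
  finally have ext: "ext_d (lower g K) x i j = 2 * two_form \<phi> \<psi> (\<sigma> x $ i) (\<sigma> x $ j)" for i j .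
  have w: "wedge12 (($) (lower g K x)) (ext_d (lower g K) x) i j k = \<alpha> (\<sigma> x $ i) (\<sigma> x $ j) (\<sigma> x $ k)" for i j k
    by (simp add: wedge12_def ext lower_eq[OF x] \<alpha>_def)
  have v: "vol \<sigma> x a b c d = vol_spin (\<sigma> x $ a) (\<sigma> x $ b) (\<sigma> x $ c) (\<sigma> x $ d)" for a b c d
    by (simp add: vol_def vol_spin_def)
  have lin: "linear (\<lambda>X. \<alpha> X Y Z)" "linear (\<lambda>Y. \<alpha> X Y Z)" "linear (\<alpha> X Y)" for X Y Z
    unfolding \<alpha>_def
    by (rule linearI;
        simp add: linear_add[OF linear_spin_metric] linear_add[OF linear_two_form(1)] linear_add[OF linear_two_form(2)]
          linear_scale[OF linear_spin_metric] linear_scale[OF linear_two_form(1)] linear_scale[OF linear_two_form(2)]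
          distrib_left distrib_right mult_ac add_ac)+
  have "(\<Sum>a\<in>UNIV. \<Sum>b\<in>UNIV. \<Sum>c\<in>UNIV. \<Sum>i\<in>UNIV. \<Sum>j\<in>UNIV. \<Sum>k\<in>UNIV.
      vol_spin (\<sigma> x $ d) (\<sigma> x $ a) (\<sigma> x $ b) (\<sigma> x $ c) * ginv g x $ a $ i * ginv g x $ b $ j * ginv g x $ c $ k
        * \<alpha> (\<sigma> x $ i) (\<sigma> x $ j) (\<sigma> x $ k)) = triple_contraction (vol_spin (\<sigma> x $ d)) \<alpha>"
    by (rule contract_triple[where M = "\<lambda>a i. ginv g x $ a $ i" and s = "\<lambda>a. \<sigma> x $ a"])
       (rule ginv_contract[OF x] linear_vol_spin lin)+
  then have "star3 g \<sigma> x (wedge12 (($) (lower g K x)) (ext_d (lower g K) x)) d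
    = 1 / 6 * triple_contraction (vol_spin (\<sigma> x $ d)) \<alpha>"
    unfolding star3_def w v by simp
  then show ?thesis
    using star_wedge_spin[OF sym, of "\<sigma> x $ d" "kill x"] by (simp add: orbit_nu_def \<alpha>_def)
qed

text \<open>A predicate at a single point, so that \<gamma> and \<open>e\<close> can be chosen point
  by point; the integration asks no regularity of them.\<close>

definition structure_at :: "real^4 \<Rightarrow> real^4 \<Rightarrow> real \<Rightarrow> bool" where
  "structure_at x \<gamma> e \<longleftrightarrow> (\<forall>i j. pd theta x i $ j - pd theta x j $ i = 0) \<and>
    (\<forall>i j. pd beta x i $ j - pd beta x j $ i = theta x $ i * \<gamma> $ j - theta x $ j * \<gamma> $ i) \<and>
    (\<forall>i j. pd xi x i $ j - pd xi x j $ i = \<gamma> $ i * beta x $ j - \<gamma> $ j * beta x $ i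
        + e * (theta x $ i * xi x $ j - theta x $ j * xi x $ i)) \<and>
    (\<exists>a b c. \<forall>i. pd n x i = a * theta x $ i + b * beta x $ i + c * xi x $ i) \<and>
    (\<forall>d. orbit_nu g \<sigma> K x d + 2 * (pd n x d / n x) = 4 * e * theta x $ d)"

text \<open>Parallelism of \<iota> and the two normalised brackets reduce the derivatives of the
  frame to \<open>p\<close>, \<open>r\<close>, \<alpha> and components of \<phi>. Here
  \<open>p\<close> is known from the derivative of \<open>K\<close>, and \<alpha> is tied to
  \<open>r\<close> by the definition of \<open>tau\<close>, so the undetermined \<open>r\<close>
  survives only inside \<gamma>.\<close>

lemma structure_equations:
  assumes x: "x \<in> U"
  shows "\<exists>\<gamma> e. structure_at x \<gamma> e"
proof -
  obtain \<phi> \<psi> where sym: "transpose \<phi> = \<phi>" "transpose \<psi> = \<psi>" and \<psi>: "\<And>v. spin_form \<psi> v (\<iota> x) = 0"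
    and nabla: "\<And>i Y. spin_metric (nabla_kill x i) Y = two_form \<phi> \<psi> (\<sigma> x $ i) Y"
    using nabla_kill_two_form[OF x] by blast
  define f0 f1 f2 c where "f0 = spin_form \<phi> (kappa x) (kappa x)" and "f1 = spin_form \<phi> (kappa x) (tau x)"
    and "f2 = spin_form \<phi> (tau x) (tau x)" and "c = spin_form \<psi> (dual x) (dual x)"
  define E1 E2 E3 E4 where "E1 = coframe kappa \<iota> x" and "E2 = coframe tau dual x"
    and "E3 = coframe kappa dual x" and "E4 = coframe tau \<iota> x"
  have E: "spin_metric (\<sigma> x $ i) (spin_tensor (kappa x) (\<iota> x)) = E1 $ i" "spin_metric (\<sigma> x $ i) (spin_tensor (tau x) (dual x)) = E2 $ i"
    "spin_metric (\<sigma> x $ i) (spin_tensor (kappa x) (dual x)) = E3 $ i" "spin_metric (\<sigma> x $ i) (spin_tensor (tau x) (\<iota> x)) = E4 $ i" for i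
    by (simp_all add: E1_def E2_def E3_def E4_def coframe_def)
  note two_form = two_form_frame[OF kappa_tau_bracket[OF x] dual_bracket[OF x] sym \<psi>,
      folded f0_def f1_def f2_def c_def, of "\<sigma> x $ i" for i, unfolded E]
  define D D' where "D a i = nabla_spinor' \<omega> a x i" and "D' b i = nabla_spinor' \<omega>' b x i" for a b i
  define p where "p i = f1 * E4 $ i - f2 * E1 $ i" for i
  define r where "r i = spin_bracket (D tau i) (tau x)" for i
  define \<alpha> where "\<alpha> i = - spin_bracket (D' dual i) (dual x)" for i
  have n: "n x \<noteq> 0" by (rule norm[OF x])
  have D\<iota>: "D' \<iota> i = 0" for i unfolding D'_def by (rule parallel[OF x])
  have zero: "spin_tensor a 0 = 0" "contract' X 0 = 0" "spin_bracket a 0 = 0" for a X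
    by (simp_all add: spin_tensor_def contract'_def spin_bracket_def vec_eq_iff)
  have const: "pd (\<lambda>z. spin_bracket (a z) (b z)) x i = 0" if "smooth_on a U" "smooth_on b U" "\<And>z. z \<in> U \<Longrightarrow> spin_bracket (a z) (b z) = 1" for a b i
    using pd_cong[OF U x differentiable[OF smooth_on_spin(2)[OF U that(1,2)] x], of "\<lambda>z. 1" i] that(3)
    by (simp add: pd_const)
  have D\<kappa>: "D kappa i = contract' (nabla_kill x i) (\<iota> x)" for i
    using nabla_contract'[OF smooth(3) x, of i] D\<iota>[of i] unfolding D_def D'_def kappa_def[abs_def] by (simp add: zero)
  then have "spin_bracket (D kappa i) a = two_form \<phi> \<psi> (\<sigma> x $ i) (spin_tensor a (\<iota> x))" for i a
    by (simp add: spin_bracket_contract' nabla)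
  then have D\<kappa>': "spin_bracket (D kappa i) (tau x) = p i" "spin_bracket (D kappa i) (kappa x) = f0 * E4 $ i - f1 * E1 $ i" for i
    by (simp_all add: two_form p_def)
  have D\<kappa>: "D kappa i = p i *\<^sub>R kappa x + (f1 * E1 $ i - f0 * E4 $ i) *\<^sub>R tau x" for i
    by (subst spin_bracket_basis[OF kappa_tau_bracket[OF x]]) (simp add: D\<kappa>' algebra_simps)
  have "spin_bracket (D tau i) (kappa x) = p i" for i
    using const[OF smooth_kappa smooth_tau kappa_tau_bracket, of i] D\<kappa>'(1)[of i]
      pd_spin_bracket[where w = \<omega>, OF smooth_kappa smooth_tau x tracefree(1)[OF x], of i]
    by (simp add: D_def spin_bracket_def algebra_simps)
  then have D\<tau>: "D tau i = r i *\<^sub>R kappa x - p i *\<^sub>R tau x" for i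
    by (subst spin_bracket_basis[OF kappa_tau_bracket[OF x]]) (simp add: r_def)
  have "spin_bracket (D' dual i) (\<iota> x) = 0" for i
    using const[OF smooth_dual smooth(3) dual_bracket, of i] D\<iota>[of i]
      pd_spin_bracket[where w = \<omega>', OF smooth_dual smooth(3) x tracefree(2)[OF x], of i]
    by (simp add: D'_def zero)
  then have Dd: "D' dual i = \<alpha> i *\<^sub>R \<iota> x" for i
    by (subst spin_bracket_basis[OF dual_bracket[OF x]]) (simp add: \<alpha>_def)
  \<comment> \<open>Differentiate \<open>tau\<close> as -2/n times the contraction of
    \<open>K\<close> with o. The derivative of the factor multiplies \<open>tau\<close> itself and
    drops out of the bracket with \<open>tau\<close>.\<close>
  have \<alpha>: "\<alpha> i = - (n x / 2) * r i - (f1 * E2 $ i - f2 * E3 $ i + c * E4 $ i)" for i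
  proof -
    define l where "l z = contract' (kill z) (dual z)" for z
    have sl: "smooth_on l U" unfolding l_def by (rule smooth_on_spin(4)[OF U smooth_kill smooth_dual])
    have s2: "smooth_on (\<lambda>z. - 2 / n z) U"
      by (rule smooth_on_divide[OF U smooth_on_const smooth_n norm])
    have l: "l x = - (n x / 2) *\<^sub>R tau x" using n by (simp add: tau_def l_def)
    have Dt: "D tau i = pd (\<lambda>z. - 2 / n z) x i *\<^sub>R l x + (- 2 / n x) *\<^sub>R D l i"
      using nabla_scaleR[OF s2 sl x, of \<omega> i] unfolding D_def tau_def[abs_def] l_def by simp
    have "r i = pd (\<lambda>z. - 2 / n z) x i * spin_bracket (l x) (tau x) + (- 2 / n x) * spin_bracket (D l i) (tau x)"
      unfolding r_def Dt by (simp add: spin_bracket_def algebra_simps)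
    moreover have "spin_bracket (l x) (tau x) = 0" unfolding l by (simp add: spin_bracket_def)
    moreover have "D l i = contract' (nabla_kill x i) (dual x) + \<alpha> i *\<^sub>R kappa x"
      using nabla_contract'[OF smooth_dual x, of i] bounded_bilinear.scaleR_right[OF bounded_bilinear_spin(4)]
      by (simp add: D_def l_def[abs_def] Dd[unfolded D'_def] kappa_def)
    then have "spin_bracket (D l i) (tau x) = two_form \<phi> \<psi> (\<sigma> x $ i) (spin_tensor (tau x) (dual x)) + \<alpha> i * spin_bracket (kappa x) (tau x)"
      by (simp add: nabla[symmetric] spin_bracket_contract'[symmetric]) (simp add: spin_bracket_def algebra_simps)
    ultimately show ?thesis using n by (simp add: two_form kappa_tau_bracket[OF x] field_simps)
  qed
  have dn: "pd n x i = n x * p i + 2 * (f0 * E2 $ i - f1 * E3 $ i + c * E1 $ i)" for i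
    by (simp add: pd_norm2[OF x] nabla kill_decompose[OF x] two_form_add two_form_scaleR two_form p_def algebra_simps)
  have lin: "spin_metric X (spin_tensor (a *\<^sub>R u + b *\<^sub>R v) w) = a * spin_metric X (spin_tensor u w) + b * spin_metric X (spin_tensor v w)"
    "spin_metric X (spin_tensor (a *\<^sub>R u - b *\<^sub>R v) w) = a * spin_metric X (spin_tensor u w) - b * spin_metric X (spin_tensor v w)"
    "spin_metric X (spin_tensor w (a *\<^sub>R u)) = a * spin_metric X (spin_tensor w u)"
    for X a b u v w by (simp_all add: spin_metric_def spin_tensor_def algebra_simps)
  note ext = ext_d_coframe[OF _ _ x, folded D_def D'_def, unfolded spin_metric_add]
  have d1: "pd (coframe kappa \<iota>) x i $ j - pd (coframe kappa \<iota>) x j $ i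
      = (p i * E1 $ j + (f1 * E1 $ i - f0 * E4 $ i) * E4 $ j) - (p j * E1 $ i + (f1 * E1 $ j - f0 * E4 $ j) * E4 $ i)" for i j
    by (simp add: ext[OF smooth_kappa smooth(3)] D\<kappa> D\<iota> zero lin E) (simp add: spin_metric_def)
  have d3: "pd (coframe kappa dual) x i $ j - pd (coframe kappa dual) x j $ i
      = (p i * E3 $ j + (f1 * E1 $ i - f0 * E4 $ i) * E2 $ j + \<alpha> i * E1 $ j)
      - (p j * E3 $ i + (f1 * E1 $ j - f0 * E4 $ j) * E2 $ i + \<alpha> j * E1 $ i)" for i j
    by (simp add: ext[OF smooth_kappa smooth_dual] D\<kappa> Dd lin E)
  have d4: "pd (coframe tau \<iota>) x i $ j - pd (coframe tau \<iota>) x j $ i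
      = (r i * E1 $ j - p i * E4 $ j) - (r j * E1 $ i - p j * E4 $ i)" for i j
    by (simp add: ext[OF smooth_tau smooth(3)] D\<tau> D\<iota> zero lin E) (simp add: spin_metric_def)
  have d2: "pd (coframe tau dual) x i $ j - pd (coframe tau dual) x j $ i
      = (r i * E3 $ j - p i * E2 $ j + \<alpha> i * E4 $ j) - (r j * E3 $ i - p j * E2 $ i + \<alpha> j * E4 $ i)" for i j
    by (simp add: ext[OF smooth_tau smooth_dual] D\<tau> Dd lin E)
  note sc = smooth_coframe[OF smooth_kappa smooth(3)] smooth_coframe[OF smooth_kappa smooth_dual]
    smooth_coframe[OF smooth_tau smooth(3)] smooth_coframe[OF smooth_tau smooth_dual]
  note dc = sc[THEN differentiable[OF _ x]]
  note dcn = sc[THEN smooth_on_vec_nth[OF U], THEN differentiable[OF _ x]]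
  have dn2: "(\<lambda>z. n z / 2) differentiable (at x)" "n differentiable (at x)"
    by (rule differentiable[OF _ x], intro smooth_on_divide smooth_on_const smooth_n U; simp)+
  have pn2: "pd (\<lambda>z. n z / 2) x i = pd n x i / 2" for i
    using pd_mult[OF dn2(2) differentiable_const, of "1/2" i] by (simp add: pd_const)
  have pbeta: "pd beta x i $ j = pd (coframe kappa dual) x i $ j - (n x / 2 * pd (coframe tau \<iota>) x i $ j + pd n x i / 2 * E4 $ j)" for i j
    unfolding pd_nth[OF differentiable[OF smooth_beta x], symmetric]
    by (simp only: beta_def vec_lambda_beta pd_diff[OF dcn(2) differentiable_mult[OF dn2(1) dcn(3)]]
        pd_mult[OF dn2(1) dcn(3)] pn2 pd_nth[OF dc(2)] pd_nth[OF dc(3)] E4_def)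
  have pxi: "pd xi x i $ j = n x * pd (coframe tau dual) x i $ j + pd n x i * E2 $ j" for i j
    using pd_nth[OF differentiable[OF smooth_xi x], of j i]
    by (simp add: xi_def pd_mult dcn dn2 pd_nth dc E2_def)
  \<comment> \<open>Found from the derivative of \<open>beta\<close>, where every term without
    \<open>theta\<close> cancels. The 1/n in \<open>e\<close> compensates the n in
    \<open>xi\<close>.\<close>
  define \<gamma> where "\<gamma> = (\<chi> i. n x * r i + 2 * f1 * E2 $ i - 2 * f2 * E3 $ i)"
  define e where "e = 2 * c / n x"
  have ne: "n x * e = 2 * c" using n by (simp add: e_def)
  have vals: "theta x $ i = E1 $ i" "beta x $ i = E3 $ i - n x / 2 * E4 $ i" "xi x $ i = n x * E2 $ i" for i
    by (simp_all add: theta_def beta_def xi_def E1_def E2_def E3_def E4_def)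
  show ?thesis
    unfolding structure_at_def
  proof (rule exI[of _ \<gamma>], rule exI[of _ e], intro conjI allI)
    show "pd theta x i $ j - pd theta x j $ i = 0" for i j
      unfolding theta_def d1 p_def by (simp add: algebra_simps)
    show "pd beta x i $ j - pd beta x j $ i = theta x $ i * \<gamma> $ j - theta x $ j * \<gamma> $ i" for i j
    proof -
      have "pd beta x i $ j - pd beta x j $ i = (pd (coframe kappa dual) x i $ j - pd (coframe kappa dual) x j $ i)
        - n x / 2 * (pd (coframe tau \<iota>) x i $ j - pd (coframe tau \<iota>) x j $ i)
        - (pd n x i / 2 * E4 $ j - pd n x j / 2 * E4 $ i)"
        unfolding pbeta by (simp add: algebra_simps)
      then show ?thesis
        unfolding d3 d4 dn \<alpha> p_def vals \<gamma>_def by (simp add: field_simps)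
    qed
    show "pd xi x i $ j - pd xi x j $ i = \<gamma> $ i * beta x $ j - \<gamma> $ j * beta x $ i
        + e * (theta x $ i * xi x $ j - theta x $ j * xi x $ i)" for i j
    proof -
      have "pd xi x i $ j - pd xi x j $ i = n x * (pd (coframe tau dual) x i $ j - pd (coframe tau dual) x j $ i)
        + (pd n x i * E2 $ j - pd n x j * E2 $ i)"
        unfolding pxi by (simp add: algebra_simps)
      moreover have "e * (theta x $ i * xi x $ j - theta x $ j * xi x $ i) = 2 * c * (E1 $ i * E2 $ j - E1 $ j * E2 $ i)"
        unfolding vals ne[symmetric] by (simp add: algebra_simps)
      ultimately show ?thesis
        unfolding d2 dn \<alpha> p_def by (simp add: vals \<gamma>_def field_simps)
    qed
    \<comment> \<open>In the differential of n the forms \<open>E3\<close> and \<open>E4\<close>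
      occur exactly in the ratio of \<open>beta\<close>: n is constant along
      \<open>K\<close>.\<close>
    show "\<exists>a b c. \<forall>i. pd n x i = a * theta x $ i + b * beta x $ i + c * xi x $ i"
      using n
      by (intro exI[of _ "2 * c - n x * f2"] exI[of _ "- 2 * f1"] exI[of _ "2 * f0 / n x"])
         (simp add: dn p_def vals algebra_simps)
    show "orbit_nu g \<sigma> K x d + 2 * (pd n x d / n x) = 4 * e * theta x $ d" for d
    proof -
      have "pd n x d = 2 * two_form \<phi> \<psi> (\<sigma> x $ d) (kill x)"
        by (simp add: pd_norm2[OF x] nabla)
      then have "orbit_nu g \<sigma> K x d + 2 * (pd n x d / n x) = 2 / n x * (4 * two_form 0 \<psi> (\<sigma> x $ d) (kill x))"
        unfolding orbit_nu_eq[OF x sym nabla] two_form_split[of \<phi> \<psi>] using n by (simp add: field_simps)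
      also have "two_form 0 \<psi> (\<sigma> x $ d) (kill x) = c * E1 $ d"
        by (simp add: kill_decompose[OF x] two_form_add two_form_scaleR two_form)
      finally show ?thesis using n by (simp add: vals e_def)
    qed
  qed
qed

text \<open>Completing the square: as quadratic forms g = 2 E3 E4 - 2 E1 E2 and the dual of
  \<open>K\<close> is E3 + (n/2) E4, so its square minus n g is (E3 - (n/2) E4)^2 + 2 n E1
  E2.\<close>

lemma metric_coframe:
  assumes x: "x \<in> U"
  shows "- (n x)\<^sup>2 * orbit_h g K x a b
    = beta x $ a * beta x $ b + theta x $ a * xi x $ b + xi x $ a * theta x $ b"
proof -
  interpret l: linear "spin_metric X" for X
    by (rule linearI) (simp_all add: spin_metric_add spin_metric_scaleR)
  have low: "lower g K x $ a = coframe kappa dual x $ a + n x / 2 * coframe tau \<iota> x $ a" for a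
    by (simp add: lower_eq[OF x] kill_decompose[OF x] coframe_def spin_metric_add spin_metric_scaleR)
  have g: "g x $ a $ b = coframe tau \<iota> x $ b * coframe kappa dual x $ a - coframe tau dual x $ b * coframe kappa \<iota> x $ a
      - coframe kappa \<iota> x $ b * coframe tau dual x $ a + coframe kappa dual x $ b * coframe tau \<iota> x $ a"
    unfolding metric_eq[OF x]
    by (subst (1) spin_tensor_basis[OF kappa_tau_bracket[OF x] dual_bracket[OF x], of "\<sigma> x $ b"])
       (simp add: l.add l.diff l.scaleR coframe_def)
  have "- (n x)\<^sup>2 * orbit_h g K x a b = lower g K x $ a * lower g K x $ b - n x * g x $ a $ b"
    using norm[OF x] by (simp add: orbit_h_def field_simps power2_eq_square)
  then show ?thesis
    unfolding low g by (simp add: theta_def beta_def xi_def field_simps power2_eq_square)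
qed

lemma coframe_killing:
  assumes x: "x \<in> U"
  shows "theta x \<bullet> K x = 0 \<and> beta x \<bullet> K x = 0 \<and> xi x \<bullet> K x = 0"
proof -
  interpret l: linear "\<lambda>X. spin_metric X Y" for Y by (rule linear_spin_metric)
  have "coframe a b x \<bullet> K x = spin_metric (kill x) (spin_tensor (a x) (b x))" for a b
    by (simp add: inner_vec_def coframe_def kill_def l.sum l.scaleR mult.commute)
  also have "\<dots> a b = spin_bracket (contract' (kill x) (b x)) (a x)" for a b
    by (simp add: spin_bracket_contract')
  finally have c: "coframe a b x \<bullet> K x = spin_bracket (contract' (kill x) (b x)) (a x)" for a b .
  have l: "contract' (kill x) (dual x) = - (n x / 2) *\<^sub>R tau x"
    using norm[OF x] by (simp add: tau_def)
  have 1: "coframe kappa \<iota> x \<bullet> K x = 0" "coframe tau dual x \<bullet> K x = 0" "coframe tau \<iota> x \<bullet> K x = 1"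
    "coframe kappa dual x \<bullet> K x = n x / 2"
    unfolding c l kappa_def[symmetric] using kappa_tau_bracket[OF x]
    by (simp_all add: spin_bracket_def) (simp add: field_simps)?
  have "beta x = coframe kappa dual x - (n x / 2) *\<^sub>R coframe tau \<iota> x" "xi x = n x *\<^sub>R coframe tau dual x"
    by (simp_all add: beta_def xi_def vec_eq_iff)
  then show ?thesis by (simp add: theta_def 1 inner_diff_left)
qed

lemma coframe_at_coframe:
  assumes x: "x \<in> U"
  shows "coframe_at (theta x) (beta x) (xi x)"
  unfolding coframe_at_def
\<comment> \<open>The remaining tetrad form completes the basis; it has the value 1 on
  \<open>K\<close>.\<close>
proof (rule exI[of _ "coframe tau \<iota> x"], intro allI)
  fix a b c d
  interpret l: linear "\<lambda>X. spin_metric X Y" for Y by (rule linear_spin_metric)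
  \<comment> \<open>Coefficients in the null tetrad solved from the four prescribed values; the
    shift by (n/2) d undoes the subtraction in \<open>beta\<close>, and c/n the factor in
    \<open>xi\<close>.\<close>
  define N where "N = d *\<^sub>R spin_tensor (kappa x) (dual x) - (c / n x) *\<^sub>R spin_tensor (kappa x) (\<iota> x)
    - a *\<^sub>R spin_tensor (tau x) (dual x) + (b + n x / 2 * d) *\<^sub>R spin_tensor (tau x) (\<iota> x)"
  obtain v where v: "(\<Sum>a\<in>UNIV. v $ a *\<^sub>R \<sigma> x $ a) = N" using tetrad_surj[OF x] by blast
  have c: "coframe a b x \<bullet> v = spin_metric N (spin_tensor (a x) (b x))" for a b
    unfolding v[symmetric] by (simp add: inner_vec_def coframe_def l.sum l.scaleR mult.commute)
  have t: "spin_metric (spin_tensor u w) (spin_tensor u' w') = spin_bracket u u' * spin_bracket w w'" for u w u' w'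
    by (simp add: spin_defs algebra_simps)
  have b: "spin_bracket (tau x) (kappa x) = -1" "spin_bracket (\<iota> x) (dual x) = -1" "spin_bracket u u = 0" for u
    using kappa_tau_bracket[OF x] dual_bracket[OF x] by (simp_all add: spin_bracket_def algebra_simps)
  have 1: "coframe kappa \<iota> x \<bullet> v = a" "coframe tau dual x \<bullet> v = c / n x" "coframe tau \<iota> x \<bullet> v = d"
    "coframe kappa dual x \<bullet> v = b + n x / 2 * d"
    unfolding c N_def by (simp_all add: l.add l.diff l.scaleR t b kappa_tau_bracket[OF x] dual_bracket[OF x])
  have "beta x = coframe kappa dual x - (n x / 2) *\<^sub>R coframe tau \<iota> x" "xi x = n x *\<^sub>R coframe tau dual x"
    by (simp_all add: beta_def xi_def vec_eq_iff)
  then have "theta x \<bullet> v = a \<and> beta x \<bullet> v = b \<and> xi x \<bullet> v = c \<and> coframe tau \<iota> x \<bullet> v = d"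
    using norm[OF x] by (simp add: theta_def 1 inner_diff_left)
  then show "\<exists>w. theta x \<bullet> w = a \<and> beta x \<bullet> w = b \<and> xi x \<bullet> w = c \<and> coframe tau \<iota> x \<bullet> w = d" ..
qed

lemma local_dkp_form:
  assumes p: "p \<in> U"
  shows "\<exists>N \<pi> \<phi> u. p \<in> N \<and> N \<subseteq> U \<and> orbit_coordinates N K \<pi> \<and>
    has_dkp_form N (orbit_h g K) (orbit_nu g \<sigma> K) \<pi> \<phi> u"
proof -
  have "\<forall>x\<in>U. \<exists>\<gamma> e. structure_at x \<gamma> e"
    using structure_equations by blast
  then obtain \<gamma> e where P: "\<And>x. x \<in> U \<Longrightarrow> structure_at x (\<gamma> x) (e x)" by metis
  have "\<exists>N \<pi> \<phi> u. p \<in> N \<and> N \<subseteq> U \<and> orbit_coordinates N K \<pi> \<and>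
    smooth_on \<phi> (\<pi> ` N) \<and> smooth_on u (\<pi> ` N) \<and> (\<forall>z\<in>\<pi> ` N. \<phi> z > 0) \<and> (\<forall>q\<in>N. \<phi> (\<pi> q) = \<bar>n q\<bar>) \<and>
    (\<forall>q\<in>N. \<forall>i j. beta q $ i * beta q $ j + theta q $ i * xi q $ j + xi q $ i * theta q $ j
      = dkp_h u (\<pi> q) (pd \<pi> q i) (pd \<pi> q j)) \<and>
    (\<forall>q\<in>N. \<forall>i. 4 * e q * theta q $ i = dkp_nu u (\<pi> q) (pd \<pi> q i))"
    by (rule dkp_coordinates[OF U p smooth_theta smooth_beta smooth_xi smooth_n, of \<gamma>])
       (use P coframe_at_coframe coframe_killing norm in \<open>auto simp: structure_at_def\<close>)
  then obtain N \<pi> \<phi> u where N: "p \<in> N" "N \<subseteq> U" "orbit_coordinates N K \<pi>"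
    and \<phi>: "smooth_on \<phi> (\<pi> ` N)" "\<forall>z\<in>\<pi> ` N. \<phi> z > 0" "\<forall>q\<in>N. \<phi> (\<pi> q) = \<bar>n q\<bar>"
    and u: "smooth_on u (\<pi> ` N)"
    and h: "\<forall>q\<in>N. \<forall>i j. beta q $ i * beta q $ j + theta q $ i * xi q $ j + xi q $ i * theta q $ j
      = dkp_h u (\<pi> q) (pd \<pi> q i) (pd \<pi> q j)"
    and \<nu>: "\<forall>q\<in>N. \<forall>i. 4 * e q * theta q $ i = dkp_nu u (\<pi> q) (pd \<pi> q i)"
    by blast
  have oN: "open N" "open (\<pi> ` N)" and s\<pi>: "smooth_on \<pi> N"
    using N(3) by (auto simp: orbit_coordinates_def)
  have log: "frechet_derivative (\<lambda>z. ln (\<phi> z)) (at (\<pi> q)) (pd \<pi> q a) = pd n q a / n q" if q: "q \<in> N" for q a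
  proof -
    have qU: "q \<in> U" and \<pi>q: "\<pi> q \<in> \<pi> ` N" using q N(2) by auto
    have pos: "\<phi> (\<pi> q) > 0" using \<phi>(2) \<pi>q by blast
    note d\<phi> = smooth_on_has_derivative[OF \<phi>(1) oN(2) \<pi>q]
    have 1: "frechet_derivative (\<lambda>z. ln (\<phi> z)) (at (\<pi> q)) v = frechet_derivative \<phi> (at (\<pi> q)) v / \<phi> (\<pi> q)" for v
      using dird_eq[OF has_derivative_ln[OF pos d\<phi>], of v] by (simp add: divide_inverse mult.commute)
    have s\<phi>\<pi>: "smooth_on (\<lambda>q. \<phi> (\<pi> q)) N"
      by (rule smooth_on_compose[OF \<phi>(1) oN order_refl s\<pi>])
    have d\<phi>\<pi>: "(\<lambda>q. \<phi> (\<pi> q)) differentiable (at q)" by (rule smooth_on_differentiable[OF s\<phi>\<pi> oN(1) q])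
    have 2: "pd (\<lambda>q. \<phi> (\<pi> q)) q a = frechet_derivative \<phi> (at (\<pi> q)) (pd \<pi> q a)"
      using pd_eq[OF has_derivative_compose[OF smooth_on_has_derivative[OF s\<pi> oN(1) q] d\<phi>], of a]
      by (simp add: pd_def)
    have dn: "n differentiable (at q)" by (rule differentiable[OF smooth_n qU])
    \<comment> \<open>Comparing squares avoids differentiating the absolute value of n.\<close>
    have "pd (\<lambda>q. \<phi> (\<pi> q) * \<phi> (\<pi> q)) q a = pd (\<lambda>q. n q * n q) q a"
      by (rule pd_cong[OF oN(1) q differentiable_mult[OF d\<phi>\<pi> d\<phi>\<pi>]]) (use \<phi>(3) in simp)
    then have "\<phi> (\<pi> q) * pd (\<lambda>q. \<phi> (\<pi> q)) q a = n q * pd n q a"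
      by (simp add: pd_mult[OF d\<phi>\<pi> d\<phi>\<pi>] pd_mult[OF dn dn] mult.commute)
    moreover have "\<phi> (\<pi> q) * \<phi> (\<pi> q) = n q * n q" using \<phi>(3) q by simp
    ultimately have "(\<phi> (\<pi> q) * pd (\<lambda>q. \<phi> (\<pi> q)) q a) / (\<phi> (\<pi> q) * \<phi> (\<pi> q)) = (n q * pd n q a) / (n q * n q)"
      by (rule arg_cong2)
    then have "pd (\<lambda>q. \<phi> (\<pi> q)) q a / \<phi> (\<pi> q) = pd n q a / n q"
      using pos norm[OF qU] by simp
    then show ?thesis by (simp add: 1 2)
  qed
  have "has_dkp_form N (orbit_h g K) (orbit_nu g \<sigma> K) \<pi> \<phi> u"
    unfolding has_dkp_form_def
  proof (intro conjI ballI allI)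
    show "- (\<phi> (\<pi> q))\<^sup>2 * orbit_h g K q a b = dkp_h u (\<pi> q) (pd \<pi> q a) (pd \<pi> q b)" if q: "q \<in> N" for q a b
      using metric_coframe[of q a b] h q N(2) \<phi>(3) by auto
    show "orbit_nu g \<sigma> K q a + 2 * frechet_derivative (\<lambda>z. ln (\<phi> z)) (at (\<pi> q)) (pd \<pi> q a) = dkp_nu u (\<pi> q) (pd \<pi> q a)"
      if q: "q \<in> N" for q a
      using P[of q] \<nu> q N(2) unfolding log[OF q] structure_at_def by auto
  qed (use \<phi> u in auto)
  then show ?thesis using N by blast
qed

end

section \<open>From a single chart to the manifold\<close>

theorem corollary5p4:
  fixes A :: "('m::{t2_space,second_countable_topology}) chart set"
    and g :: "('m, real^4^4) field"
    and \<sigma> :: "('m, real^2^2^4) field"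
    and S S' :: "'m chart \<Rightarrow> ('m, real^2^2) field"
    and \<omega> \<omega>' :: "('m, 4 \<Rightarrow> real^2^2) field"
    and \<iota> :: "('m, real^2) field"
    and K :: "('m, real^4) field"
  assumes "null_kahler A g \<sigma> S S' \<omega> \<omega>' \<iota>"
    and "anti_self_dual A g \<sigma>"
    and "killing A g K"
    and "preserves_spinor' A g \<sigma> \<omega>' \<iota> K"
  shows "\<forall>c\<in>A. \<forall>p\<in>image_of c. norm2 (g c) (K c) p \<noteq> 0 \<longrightarrow>
    (\<exists>N \<pi> \<phi> u. p \<in> N \<and> N \<subseteq> {q\<in>image_of c. norm2 (g c) (K c) q \<noteq> 0} \<and>
       orbit_coordinates N (K c) \<pi> \<and>
       has_dkp_form N (orbit_h (g c) (K c)) (orbit_nu (g c) (\<sigma> c) (K c)) \<pi> \<phi> u)"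
proof (intro ballI impI)
  fix c p
  assume c: "c \<in> A" and p: "p \<in> image_of c" "norm2 (g c) (K c) p \<noteq> 0"
  define U where "U = {q\<in>image_of c. norm2 (g c) (K c) q \<noteq> 0}"
  have image: "open (image_of c)"
    using assms(1) c by (auto simp: null_kahler_def smooth_atlas_def)
  have smooth: "smooth_on (g c) (image_of c)" "smooth_on (\<sigma> c) (image_of c)"
    "smooth_on (\<iota> c) (image_of c)" "smooth_on (K c) (image_of c)"
  proof -
    have "neutral_metric A g" "spin_bundles A g \<sigma> S S'" "spinor_field' A S' \<iota>" "vector_field A K"
      using assms(1,3) by (simp_all add: null_kahler_def killing_def)
    then show "smooth_on (g c) (image_of c)" "smooth_on (\<sigma> c) (image_of c)"
      "smooth_on (\<iota> c) (image_of c)" "smooth_on (K c) (image_of c)"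
      using c by (simp_all add: neutral_metric_def spin_bundles_def spinor_field'_def vector_field_def)
  qed
  have "smooth_on (norm2 (g c) (K c)) (image_of c)"
    unfolding norm2_def[abs_def]
    by (intro smooth_on_sum smooth_on_mult smooth_on_vec_nth image smooth)
  then have "open (image_of c \<inter> norm2 (g c) (K c) -` (- {0}))"
    by (intro continuous_open_preimage smooth_on_continuous_on image) auto
  then have U: "open U" by (simp add: U_def Int_def vimage_def)
  have sub: "U \<subseteq> image_of c" by (auto simp: U_def)
  interpret null_kahler_chart U "g c" "\<sigma> c" "\<omega> c" "\<omega>' c" "\<iota> c" "K c"
  proof
    show "open U" by (rule U)
    show "smooth_on (g c) U" "smooth_on (\<sigma> c) U" "smooth_on (\<iota> c) U" "smooth_on (K c) U"
      using smooth smooth_on_subset[OF _ sub] by blast+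
    have nk: "solders (g c) (\<sigma> c) (image_of c)" "spin_connection (g c) (\<sigma> c) (\<omega> c) (\<omega>' c) (image_of c)"
      "\<And>x. x \<in> image_of c \<Longrightarrow> neutral_form (g c x)"
      "\<And>x. x \<in> image_of c \<Longrightarrow> \<iota> c x \<noteq> 0 \<and> (\<forall>a. nabla_spinor' (\<omega>' c) (\<iota> c) x a = 0)"
      using assms(1) c unfolding null_kahler_def neutral_metric_def spin_bundles_def by blast+
    show "solders (g c) (\<sigma> c) U" using nk(1) sub unfolding solders_def by blast
    show "spin_connection (g c) (\<sigma> c) (\<omega> c) (\<omega>' c) U" using nk(2) sub unfolding spin_connection_def by blast
    fix x assume x: "x \<in> U"
    then have xi: "x \<in> image_of c" using sub by blast
    show "neutral_form (g c x)" by (rule nk(3)[OF xi])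
    show "\<iota> c x \<noteq> 0" using nk(4)[OF xi] by blast
    show parallel: "nabla_spinor' (\<omega>' c) (\<iota> c) x a = 0" for a using nk(4)[OF xi] by blast
    show "norm2 (g c) (K c) x \<noteq> 0" using x by (simp add: U_def)
    show "\<exists>\<phi> \<psi>. transpose \<phi> = \<phi> \<and> transpose \<psi> = \<psi> \<and>
      (\<forall>a b. nabla_lower (g c) (K c) x a b = two_form \<phi> \<psi> (\<sigma> c x $ a) (\<sigma> c x $ b)) \<and> (eps ** \<psi>) *v \<iota> c x = 0"
      using assms(4)[unfolded preserves_spinor'_def two_form_def[symmetric], rule_format, OF c xi]
      by (simp add: parallel)
  qed
  show "\<exists>N \<pi> \<phi> u. p \<in> N \<and> N \<subseteq> {q\<in>image_of c. norm2 (g c) (K c) q \<noteq> 0} \<and>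
       orbit_coordinates N (K c) \<pi> \<and>
       has_dkp_form N (orbit_h (g c) (K c)) (orbit_nu (g c) (\<sigma> c) (K c)) \<pi> \<phi> u"
    using local_dkp_form[of p] p unfolding U_def by blast
qed

end
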